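(* Let $F\in\mathcal C^0(\mathbb R,\mathbb R_+)$ be strictly decreasing on $\mathbb R_-$, with $F(\mathbb R_-)=\mathbb R_+$ and $F(\mathbb R_+)=\{0\}$. Define on $\mathbb R^3\times\mathbb R^3$ $$Q_0(x,v)=F\left(\frac{|v|^2}{2}+\psi_0(x)\right),\qquad Q_1(x,v)=F\left(\frac{|v|^2}{2}+\psi_1(x)\right),$$ where $\psi_0,\psi_1:\mathbb R^3\to\mathbb R$ are two continuous, radially symmetric functions, nondecreasing in $|x|$, such that the sets $\{x:\psi_0(x)<0\}$ and $\{x:\psi_1(x)<0\}$ are bounded. If $Q_0$ and $Q_1$ are equimeasurable, i.e. $$\forall t>0,\quad \mathrm{meas}\{(x,v)\in\mathbb R^6: Q_0(x,v)>t\}=\mathrm{meas}\{(x,v)\in\mathbb R^6: Q_1(x,v)>t\},$$ then $Q_0=Q_1$. In particular, for $j$ satisfying (H1) and (H2) below: (i) Poisson-Manev case ($\delta>0$, $\kappa\ge0$): two equimeasurable steady states of the Vlasov-Manev system which minimize $I(M_1,M_j)=\inf_{f\in\mathcal F(M_1,M_j)}\mathcal H(f)$, where $M_1,M_j>0$ satisfy the subcritical condition $\kappa M_1^{\frac{p-3}{3(p-1)}}(M_1+M_j)^{\frac{2}{3(p-1)}}<K_j^M$, are equal up to a translation in space. (ii) Pure Manev case ($\delta=0$, $\kappa=1$): two equimeasurable steady states of the Vlasov-Manev system which minimize $J(M_1,M_j)=\inf_{f\in\mathcal F(M_1,M_j)}\frac{\||v|^2f\|_{L^1}}{E_{pot}^M(f)}$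 and which have the same kinetic energy $\||v|^2 f\|_{L^1}$ are equal up to a translation in space.
   Context: meas denotes Lebesgue measure. Assumptions on $j:\mathbb R_+\to\mathbb R_+$: (H1) $j$ is $\mathcal C^2$, $j(0)=j'(0)=0$, $j''(t)>0$ for $t>0$; (H2) there exist $p,q>3$ with $p\le \frac{tj'(t)}{j(t)}\le q$ for all $t>0$. For $f=f(x,v)\ge0$ on $\mathbb R^3\times\mathbb R^3$ put $\rho_f(x)=\int f(x,v)\,dv$, $\phi_f^P(x)=-\int\frac{\rho_f(y)}{4\pi|x-y|}dy$, $\phi_f^M(x)=-\int\frac{\rho_f(y)}{2\pi^2|x-y|^2}dy$, $\phi_f=\delta\phi_f^P+\kappa\phi_f^M$, $E_{pot}^P(f)=-\int\phi_f^P\rho_f$, $E_{pot}^M(f)=-\int\phi_f^M\rho_f$, $E_{pot}=\delta E_{pot}^P+\kappa E_{pot}^M$, $\mathcal H(f)=\||v|^2f\|_{L^1}-E_{pot}(f)$. The Vlasov-Manev system is $\partial_tf+v\cdot\nabla_xf-\nabla_x\phi_f\cdot\nabla_vf=0$; a steady state is a time-independent solution $f=f(x,v)\ge 0$ (at least in the weak sense). $\mathcal E_j=\{f\ge0:\ \|f\|_{L^1}+\|j(f)\|_{L^1}+\||v|^2f\|_{L^1}<\infty\}$, $\mathcal F(M_1,M_j)=\{f\in\mathcal E_j:\|f\|_{L^1}=M_1,\|j(f)\|_{L^1}=M_j\}$, and $$K_j^M=\inf_{f\in\mathcal E_j\setminus\{0\}}\frac{\||v|^2f\|_{L^1}\|f\|_{L^1}^{\frac{p-3}{3(p-1)}}\|f+j(f)\|_{L^1}^{\frac{2}{3(p-1)}}}{E_{pot}^M(f)}.$$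 *)

theory Defs
  imports "HOL-Analysis.Analysis"
begin

type_synonym R3 = "real ^ 3"
type_synonym phase = "R3 \<times> R3"

text \<open>
  Phase-space densities are Borel functions of (x, v), i.e. Borel representatives of
  Lebesgue classes; identities between elements of the energy space below are therefore
  understood almost everywhere.
\<close>

definition equimeasurable :: "(phase \<Rightarrow> real) \<Rightarrow> (phase \<Rightarrow> real) \<Rightarrow> bool" where
  "equimeasurable f g \<longleftrightarrow>
     (\<forall>t>0. emeasure lborel {z. f z > t} = emeasure lborel {z. g z > t})"

definition H1 :: "(real \<Rightarrow> real) \<Rightarrow> bool" where
  "H1 j \<longleftrightarrow> (\<forall>t\<ge>0. j t \<ge> 0) \<and> j 0 = 0 \<and>
     (\<exists>j' j''. (\<forall>t\<ge>0. (j has_real_derivative j' t) (at t within {0..})) \<and>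
        (\<forall>t\<ge>0. (j' has_real_derivative j'' t) (at t within {0..})) \<and>
        continuous_on {0..} j'' \<and> j' 0 = 0 \<and> (\<forall>t>0. j'' t > 0))"

definition H2 :: "(real \<Rightarrow> real) \<Rightarrow> real \<Rightarrow> real \<Rightarrow> bool" where
  "H2 j p q \<longleftrightarrow> p > 3 \<and> q > 3 \<and>
     (\<forall>t>0. p \<le> t * deriv j t / j t \<and> t * deriv j t / j t \<le> q)"

definition L1norm :: "(phase \<Rightarrow> real) \<Rightarrow> real" where
  "L1norm f = (LINT z|lborel. \<bar>f z\<bar>)"

definition kinetic :: "(phase \<Rightarrow> real) \<Rightarrow> real" where
  "kinetic f = L1norm (\<lambda>(x, v). (norm v)\<^sup>2 * f (x, v))"

text \<open>
  The energies below are only evaluated on the energy space. There, under (H1) and (H2),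
  the integrals defining the density and the potentials converge for almost every x, and
  both potential energies are finite (interpolation and Hardy-Littlewood-Sobolev), so the
  value 0 that the Bochner integral gives to a divergent integral plays no role. Neither
  does the value of the kernels on the diagonal.
\<close>

definition density :: "(phase \<Rightarrow> real) \<Rightarrow> R3 \<Rightarrow> real" where
  "density f x = (LINT v|lborel. f (x, v))"

definition phiP :: "(phase \<Rightarrow> real) \<Rightarrow> R3 \<Rightarrow> real" where
  "phiP f x = - (LINT y|lborel. density f y / (4 * pi * norm (x - y)))"

definition phiM :: "(phase \<Rightarrow> real) \<Rightarrow> R3 \<Rightarrow> real" where
  "phiM f x = - (LINT y|lborel. density f y / (2 * pi\<^sup>2 * (norm (x - y))\<^sup>2))"

definition phi :: "real \<Rightarrow> real \<Rightarrow> (phase \<Rightarrow> real) \<Rightarrow> R3 \<Rightarrow> real" where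
  "phi \<delta> \<kappa> f x = \<delta> * phiP f x + \<kappa> * phiM f x"

definition EpotP :: "(phase \<Rightarrow> real) \<Rightarrow> real" where
  "EpotP f = - (LINT x|lborel. phiP f x * density f x)"

definition EpotM :: "(phase \<Rightarrow> real) \<Rightarrow> real" where
  "EpotM f = - (LINT x|lborel. phiM f x * density f x)"

definition Epot :: "real \<Rightarrow> real \<Rightarrow> (phase \<Rightarrow> real) \<Rightarrow> real" where
  "Epot \<delta> \<kappa> f = \<delta> * EpotP f + \<kappa> * EpotM f"

definition Hamiltonian :: "real \<Rightarrow> real \<Rightarrow> (phase \<Rightarrow> real) \<Rightarrow> real" where
  "Hamiltonian \<delta> \<kappa> f = kinetic f - Epot \<delta> \<kappa> f"

definition energy_space :: "(real \<Rightarrow> real) \<Rightarrow> (phase \<Rightarrow> real) set" where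
  "energy_space j = {f. f \<in> borel_measurable borel \<and> (\<forall>z. f z \<ge> 0) \<and>
     integrable lborel f \<and> integrable lborel (\<lambda>z. j (f z)) \<and>
     integrable lborel (\<lambda>(x, v). (norm v)\<^sup>2 * f (x, v))}"

definition constraint_set :: "(real \<Rightarrow> real) \<Rightarrow> real \<Rightarrow> real \<Rightarrow> (phase \<Rightarrow> real) set" where
  "constraint_set j M1 Mj =
     {f \<in> energy_space j. L1norm f = M1 \<and> L1norm (\<lambda>z. j (f z)) = Mj}"

definition KjM :: "(real \<Rightarrow> real) \<Rightarrow> real \<Rightarrow> real" where
  "KjM j p = (INF f \<in> {f \<in> energy_space j. \<not> (AE z in lborel. f z = 0)}.
     kinetic f * L1norm f powr ((p - 3) / (3 * (p - 1)))
       * L1norm (\<lambda>z. f z + j (f z)) powr (2 / (3 * (p - 1))) / EpotM f)"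

text \<open>
  This infimum is taken in the extended reals because the Hamiltonian need not be bounded
  below on the constraint set without the subcritical condition.
\<close>

definition I_inf :: "real \<Rightarrow> real \<Rightarrow> (real \<Rightarrow> real) \<Rightarrow> real \<Rightarrow> real \<Rightarrow> ereal" where
  "I_inf \<delta> \<kappa> j M1 Mj = (INF f \<in> constraint_set j M1 Mj. ereal (Hamiltonian \<delta> \<kappa> f))"

definition minimizes_I ::
    "real \<Rightarrow> real \<Rightarrow> (real \<Rightarrow> real) \<Rightarrow> real \<Rightarrow> real \<Rightarrow> (phase \<Rightarrow> real) \<Rightarrow> bool" where
  "minimizes_I \<delta> \<kappa> j M1 Mj f \<longleftrightarrow>
     f \<in> constraint_set j M1 Mj \<and> ereal (Hamiltonian \<delta> \<kappa> f) = I_inf \<delta> \<kappa> j M1 Mj"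

definition J_inf :: "(real \<Rightarrow> real) \<Rightarrow> real \<Rightarrow> real \<Rightarrow> ereal" where
  "J_inf j M1 Mj = (INF f \<in> constraint_set j M1 Mj. ereal (kinetic f / EpotM f))"

definition minimizes_J ::
    "(real \<Rightarrow> real) \<Rightarrow> real \<Rightarrow> real \<Rightarrow> (phase \<Rightarrow> real) \<Rightarrow> bool" where
  "minimizes_J j M1 Mj f \<longleftrightarrow>
     f \<in> constraint_set j M1 Mj \<and> ereal (kinetic f / EpotM f) = J_inf j M1 Mj"

primrec Ck :: "nat \<Rightarrow> ('a::euclidean_space \<Rightarrow> real) \<Rightarrow> bool" where
  "Ck 0 f \<longleftrightarrow> continuous_on UNIV f"
| "Ck (Suc k) f \<longleftrightarrow> f differentiable_on UNIV \<and>
     (\<forall>b\<in>Basis. Ck k (\<lambda>x. frechet_derivative f (at x) b))"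

definition test_function :: "('a::euclidean_space \<Rightarrow> real) \<Rightarrow> bool" where
  "test_function \<theta> \<longleftrightarrow> (\<forall>k. Ck k \<theta>) \<and> compact (closure {x. \<theta> x \<noteq> 0})"

definition locally_integrable ::
    "('a::euclidean_space \<Rightarrow> 'b::euclidean_space) \<Rightarrow> bool" where
  "locally_integrable g \<longleftrightarrow> (\<forall>K. compact K \<longrightarrow> set_integrable lborel K g)"

definition weak_gradient :: "(R3 \<Rightarrow> real) \<Rightarrow> (R3 \<Rightarrow> R3) \<Rightarrow> bool" where
  "weak_gradient u G \<longleftrightarrow> locally_integrable u \<and> locally_integrable G \<and>
     (\<forall>\<eta>. test_function \<eta> \<longrightarrow> (\<forall>b\<in>Basis.
        (LINT x|lborel. u x * frechet_derivative \<eta> (at x) b)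
          = - (LINT x|lborel. (G x \<bullet> b) * \<eta> x)))"

text \<open>
  Time-independent weak solutions of the Vlasov-Manev system. The transport field
  (v, - grad phi) is divergence free in (x, v), and the derivative of the test function in
  this direction is v . grad_x theta - grad phi . grad_v theta. The gradient of the potential
  is taken in the sense of distributions.
\<close>

definition steady_state :: "real \<Rightarrow> real \<Rightarrow> (phase \<Rightarrow> real) \<Rightarrow> bool" where
  "steady_state \<delta> \<kappa> f \<longleftrightarrow> f \<in> borel_measurable borel \<and> (\<forall>z. f z \<ge> 0) \<and>
     (\<exists>G. weak_gradient (phi \<delta> \<kappa> f) G \<and>
        (\<forall>\<theta>. test_function \<theta> \<longrightarrow>
           integrable lborel
             (\<lambda>(x, v). f (x, v) * frechet_derivative \<theta> (at (x, v)) (v, - G x)) \<and>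
           (LINT (x, v)|lborel.
              f (x, v) * frechet_derivative \<theta> (at (x, v)) (v, - G x)) = 0))"

definition equal_up_to_translation :: "(phase \<Rightarrow> real) \<Rightarrow> (phase \<Rightarrow> real) \<Rightarrow> bool" where
  "equal_up_to_translation f g \<longleftrightarrow>
     (\<exists>a::R3. AE (x, v) in lborel. g (x, v) = f (x - a, v))"

end

theory Submission imports Defs begin

text \<open>
  For the profiles of the first claim, the measures of the superlevel sets of \<open>Q\<^sub>i\<close> are Abel
  transforms of the distribution function of \<open>\<psi>\<^sub>i\<close>; inverting them shows that the sublevel
  sets of \<open>\<psi>\<^sub>0\<close> and \<open>\<psi>\<^sub>1\<close>, which are concentric balls, have equal volumes.

  Minimizers are reduced to this case. Concentrating a competitor in space shows that the constraint on
  \<open>j\<close> may be relaxed to an inequality, so the first variation runs over a convex set and a separating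
  hyperplane yields Lagrange multipliers: \<open>j'(f) = (h(x) - |v|\<^sup>2 / 2\<mu>)\<^sub>+\<close> with \<open>h\<close> an affine function of
  the potential. Swapping the two halves of the density across a plane is a measure preserving
  rearrangement that increases the interaction energy unless the density already dominates on one
  side; this holds for all planes, so the potential is radially decreasing about some centre. The
  multipliers \<open>\<mu>\<close> of two minimizers may differ, but after rescaling \<open>(x, v)\<close> to \<open>(b x, v / b)\<close> the
  profiles agree; how the energies change under this scaling forces \<open>b = 1\<close>.
\<close>

section \<open>Maps that scale Lebesgue measure\<close>

text \<open>The exact constraint on the integral of j(f) does not survive convex combinations, the
  inequality does; hence relaxation precedes the first variation. Separation may produce degenerate
  multipliers. They are excluded because a nonzero integrable f can neither be constant on R^6 nor
  live on the null set where |v|^2 equals a function of x. The kernel |x|^(-2) is handled by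
  densities in L^r with r > 3/2, and interpolating L^p against the second velocity moment gives such
  an r exactly when p > 3. The comparison across planes does not name a centre: the median planes in
  the three coordinate directions meet in one point, their reflections compose to the point
  reflection there, so every plane through that point halves the mass. A minimizer of the quotient
  minimizes the Hamiltonian with \<delta> = 0 and \<kappa> equal to the minimal ratio, so both
  variational problems share one argument. In that case the Hamiltonian vanishes along the whole
  scaling orbit and only the kinetic energy can fix the scale.\<close>

abbreviation "wdensity \<equiv> Nonnegative_Lebesgue_Integration.density"

lemma fst_borel_measurable [measurable]: "fst \<in> borel_measurable (borel :: ('a::second_countable_topology \<times> 'b::second_countable_topology) measure)"
  and snd_borel_measurable [measurable]: "snd \<in> borel_measurable (borel :: ('a \<times> 'b) measure)"
  by (simp_all add: borel_prod[symmetric])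

text \<open>\<open>k\<close> plays the role of the Jacobian. The push-forward form asks for no
  smoothness of \<open>T\<close>, so dilations, reflections and the discontinuous swap of
  \<open>scales_swap_on\<close> share one change of variables.\<close>

definition scales_lborel :: "('a::euclidean_space \<Rightarrow> 'a) \<Rightarrow> real \<Rightarrow> bool" where
  "scales_lborel T k \<longleftrightarrow> T \<in> borel_measurable borel \<and> k > 0 \<and>
     lborel = wdensity (distr lborel borel T) (\<lambda>_. ennreal k)"

lemma scales_measurable: "scales_lborel T k \<Longrightarrow> T \<in> borel_measurable borel"
  and scales_pos: "scales_lborel T k \<Longrightarrow> k > 0"
  by (auto simp: scales_lborel_def)

lemma scales_nn_integral:
  assumes "scales_lborel T k" and [measurable]: "F \<in> borel_measurable borel"
  shows "(\<integral>\<^sup>+x. F x \<partial>lborel) = ennreal k * (\<integral>\<^sup>+x. F (T x) \<partial>lborel)"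
proof -
  have [measurable]: "T \<in> borel_measurable borel" and
    eq: "lborel = wdensity (distr lborel borel T) (\<lambda>_. ennreal k)"
    using assms(1) by (auto simp: scales_lborel_def)
  show ?thesis
    by (subst eq) (simp add: nn_integral_density nn_integral_distr nn_integral_cmult)
qed

lemma scales_emeasure:
  assumes "scales_lborel T k" and [measurable]: "A \<in> sets borel"
  shows "emeasure lborel A = ennreal k * emeasure lborel (T -` A)"
proof -
  have [measurable]: "T \<in> borel_measurable borel"
    using assms(1) by (auto simp: scales_lborel_def)
  have m: "T -` A \<in> sets borel"
    using measurable_sets[of T borel borel A] by simp
  have "emeasure lborel A = (\<integral>\<^sup>+x. indicator A x \<partial>lborel)" by simp
  also have "\<dots> = ennreal k * (\<integral>\<^sup>+x. indicator A (T x) \<partial>lborel)"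
    by (rule scales_nn_integral[OF assms(1)]) simp
  also have "(\<lambda>x. indicator A (T x)) = (indicator (T -` A) :: _ \<Rightarrow> ennreal)"
    by (auto simp: indicator_def fun_eq_iff)
  finally show ?thesis using m by simp
qed

lemma scales_lborelI:
  assumes [measurable]: "T \<in> borel_measurable borel" and "k > 0"
    and "\<And>A. A \<in> sets borel \<Longrightarrow> emeasure lborel A = ennreal k * emeasure lborel (T -` A)"
  shows "scales_lborel T k"
  unfolding scales_lborel_def
proof (intro conjI assms(1,2) measure_eqI)
  fix A :: "'a set" assume "A \<in> sets lborel"
  then have [measurable]: "A \<in> sets borel" by simp
  have m: "T -` A \<in> sets borel"
    using measurable_sets[of T borel borel A] by simp
  have "emeasure (wdensity (distr lborel borel T) (\<lambda>_. ennreal k)) A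
      = ennreal k * emeasure lborel (T -` A)"
    by (subst emeasure_density_const) (auto simp: emeasure_distr)
  then show "emeasure lborel A = emeasure (wdensity (distr lborel borel T) (\<lambda>_. ennreal k)) A"
    using assms(3)[of A] by simp
qed simp

lemma scales_integrable_iff:
  fixes F :: "'a::euclidean_space \<Rightarrow> real"
  assumes "scales_lborel T k" and [measurable]: "F \<in> borel_measurable borel"
  shows "integrable lborel (\<lambda>x. F (T x)) \<longleftrightarrow> integrable lborel F"
proof -
  have [measurable]: "T \<in> borel_measurable borel" and k: "k > 0" and
    eq: "lborel = wdensity (distr lborel borel T) (\<lambda>_. ennreal k)"
    using assms(1) by (auto simp: scales_lborel_def)
  have "integrable lborel F \<longleftrightarrow> integrable (wdensity (distr lborel borel T) (\<lambda>_. ennreal k)) F"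
    using eq by metis
  also have "\<dots> \<longleftrightarrow> integrable lborel (\<lambda>x. F (T x))"
    using k by (simp add: integrable_density integrable_distr_eq)
  finally show ?thesis ..
qed

lemma scales_integral:
  fixes F :: "'a::euclidean_space \<Rightarrow> real"
  assumes "scales_lborel T k" and [measurable]: "F \<in> borel_measurable borel"
  shows "(LINT x|lborel. F x) = k * (LINT x|lborel. F (T x))"
proof -
  have [measurable]: "T \<in> borel_measurable borel" and k: "k > 0" and
    eq: "lborel = wdensity (distr lborel borel T) (\<lambda>_. ennreal k)"
    using assms(1) by (auto simp: scales_lborel_def)
  have "(LINT x|lborel. F x) = (LINT x|wdensity (distr lborel borel T) (\<lambda>_. ennreal k). F x)"
    using eq by metis
  also have "\<dots> = k * (LINT x|lborel. F (T x))"
    using k by (simp add: integral_density integral_distr)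
  finally show ?thesis .
qed

lemma scales_AE:
  assumes "scales_lborel T k" and P: "AE x in lborel. P x"
  shows "AE x in lborel. P (T x)"
proof -
  have [measurable]: "T \<in> borel_measurable borel" and k: "k > 0" and
    eq: "lborel = wdensity (distr lborel borel T) (\<lambda>_. ennreal k)"
    using assms(1) by (auto simp: scales_lborel_def)
  have "AE x in wdensity (distr lborel borel T) (\<lambda>_. ennreal k). P x"
    using P eq by metis
  then have "AE x in distr lborel borel T. P x"
    using k by (simp add: AE_density)
  then show ?thesis
    by (rule AE_distrD[rotated]) simp
qed

lemma measurable_vimage_borel:
  "T \<in> borel_measurable borel \<Longrightarrow> A \<in> sets borel \<Longrightarrow> T -` A \<in> sets borel"
  using measurable_sets[of T borel borel A] by simp

text \<open>By Fubini: the slice of the preimage over \<open>x\<close> is the slice of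
  \<open>A\<close> over \<open>T x\<close>, so the scaling of \<open>T\<close> applies to the
  measure of the slices.\<close>

lemma scales_map_fst:
  fixes T :: "'a::euclidean_space \<Rightarrow> 'a"
  assumes T: "scales_lborel T k"
  shows "scales_lborel (\<lambda>z::'a \<times> 'b::euclidean_space. (T (fst z), snd z)) k"
proof (rule scales_lborelI)
  have [measurable]: "T \<in> borel_measurable borel" using T by (rule scales_measurable)
  show m: "(\<lambda>z::'a \<times> 'b. (T (fst z), snd z)) \<in> borel_measurable borel"
    by (simp add: borel_prod[symmetric])
  show "k > 0" using T by (rule scales_pos)
  fix A :: "('a \<times> 'b) set" assume A: "A \<in> sets borel"
  have A': "A \<in> sets (lborel \<Otimes>\<^sub>M lborel)"
    using A by (subst lborel_prod) simp
  have A2: "(\<lambda>z. (T (fst z), snd z)) -` A \<in> sets (lborel \<Otimes>\<^sub>M lborel)"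
    using measurable_vimage_borel[OF m A] by (subst lborel_prod) simp
  have "emeasure lborel A = (\<integral>\<^sup>+x. emeasure lborel (Pair x -` A) \<partial>lborel)"
    using lborel.emeasure_pair_measure_alt[OF A'] by (simp add: lborel_prod)
  also have "\<dots> = ennreal k * (\<integral>\<^sup>+x. emeasure lborel (Pair (T x) -` A) \<partial>lborel)"
    using lborel.measurable_emeasure_Pair[OF A'] by (intro scales_nn_integral T) simp
  also have "(\<lambda>x. Pair (T x) -` A) = (\<lambda>x. Pair x -` ((\<lambda>z. (T (fst z), snd z)) -` A))"
    by auto
  also have "(\<integral>\<^sup>+x. emeasure lborel (Pair x -` ((\<lambda>z. (T (fst z), snd z)) -` A)) \<partial>lborel)
      = emeasure lborel ((\<lambda>z. (T (fst z), snd z)) -` A)"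
    using lborel.emeasure_pair_measure_alt[OF A2] unfolding lborel_prod by (rule sym)
  finally show "emeasure lborel A = ennreal k * emeasure lborel ((\<lambda>z. (T (fst z), snd z)) -` A)" .
qed

lemma scales_affine:
  assumes "c > 0"
  shows "scales_lborel (\<lambda>x::'a::euclidean_space. a + c *\<^sub>R x) (c ^ DIM('a))"
  using assms lborel_affine[of c a] by (simp add: scales_lborel_def ennreal_power)

lemma scales_compose:
  assumes S: "scales_lborel S k" and T: "scales_lborel T l"
  shows "scales_lborel (\<lambda>x. S (T x)) (k * l)"
proof (rule scales_lborelI)
  have [measurable]: "S \<in> borel_measurable borel" "T \<in> borel_measurable borel"
    using S T by (auto simp: scales_measurable)
  show "(\<lambda>x. S (T x)) \<in> borel_measurable borel" by simp
  show "k * l > 0" using S T by (simp add: scales_pos)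
  fix A :: "'a set" assume A: "A \<in> sets borel"
  have "(\<lambda>x. S (T x)) -` A = T -` (S -` A)" by auto
  then show "emeasure lborel A = ennreal (k * l) * emeasure lborel ((\<lambda>x. S (T x)) -` A)"
    using scales_emeasure[OF S A] scales_emeasure[OF T measurable_vimage_borel[OF _ A]]
      scales_pos[OF S] scales_pos[OF T]
    by (simp add: ennreal_mult mult.assoc)
qed

lemma scales_swap:
  "scales_lborel (\<lambda>z::'a::euclidean_space \<times> 'a. (snd z, fst z)) 1"
proof (rule scales_lborelI)
  show m: "(\<lambda>z::'a \<times> 'a. (snd z, fst z)) \<in> borel_measurable borel"
    by (simp add: borel_prod[symmetric])
  fix A :: "('a \<times> 'a) set" assume A: "A \<in> sets borel"
  have eq: "(lborel :: ('a \<times> 'a) measure) = distr lborel lborel (\<lambda>(x, y). (y, x))"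
    using lborel_pair.distr_pair_swap[where 'a='a and 'b='a] unfolding lborel_prod .
  have m': "(\<lambda>(x, y). (y, x)) \<in> (lborel :: ('a \<times> 'a) measure) \<rightarrow>\<^sub>M (lborel :: ('a \<times> 'a) measure)"
    using m by (simp add: case_prod_beta')
  have "emeasure lborel A = emeasure (distr lborel lborel (\<lambda>(x, y). (y, x))) A"
    by (subst eq) (rule HOL.refl)
  also have "\<dots> = emeasure lborel ((\<lambda>(x, y). (y, x)) -` A \<inter> space lborel)"
    by (rule emeasure_distr[OF m']) (use A in simp)
  finally show "emeasure lborel A = ennreal 1 * emeasure lborel ((\<lambda>z. (snd z, fst z)) -` A)"
    by (simp add: case_prod_beta')
qed simp

lemma scales_map_snd:
  fixes T :: "'a::euclidean_space \<Rightarrow> 'a"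
  assumes T: "scales_lborel T k"
  shows "scales_lborel (\<lambda>z::'a \<times> 'a. (fst z, T (snd z))) k"
  using scales_compose[OF scales_compose[OF scales_swap scales_map_fst[OF T]] scales_swap] by simp

lemma scales_phase_affine:
  assumes "c > 0" "d > 0"
  shows "scales_lborel (\<lambda>z::phase. (a + c *\<^sub>R fst z, d *\<^sub>R snd z)) (c ^ 3 * d ^ 3)"
  using scales_compose[OF scales_map_fst[OF scales_affine[OF assms(1), of a]]
      scales_map_snd[OF scales_affine[OF assms(2), of 0]]] by simp

section \<open>Reflections in the planes \<open>x \<bullet> e = c\<close> with unit normal
  \<open>e\<close>\<close>

definition mirror :: "'a::euclidean_space \<Rightarrow> real \<Rightarrow> 'a \<Rightarrow> 'a" where
  "mirror e c x = x - (2 * (x \<bullet> e - c)) *\<^sub>R e"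

lemma mirror_measurable [measurable]: "mirror e c \<in> borel_measurable borel"
  unfolding mirror_def by measurable

lemma mirror_inner: "norm e = 1 \<Longrightarrow> mirror e c x \<bullet> e = 2 * c - x \<bullet> e"
  by (simp add: mirror_def algebra_simps dot_square_norm)

lemma mirror_mirror [simp]: "norm e = 1 \<Longrightarrow> mirror e c (mirror e c x) = x"
  using mirror_inner[of e c x] by (simp add: mirror_def[of e c "mirror e c x"]) (simp add: mirror_def algebra_simps)

lemma orthogonal_mirror: "norm e = 1 \<Longrightarrow> orthogonal_transformation (mirror e 0)"
  unfolding orthogonal_transformation_def
proof
  show "linear (mirror e 0)"
    by (rule linearI) (auto simp: mirror_def algebra_simps inner_left_distrib)
  show "norm e = 1 \<Longrightarrow> \<forall>v w. mirror e 0 v \<bullet> mirror e 0 w = v \<bullet> w"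
    by (auto simp: mirror_def inner_diff_left inner_diff_right dot_square_norm inner_commute)
qed

lemma mirror_eq: "mirror e c x = mirror e 0 x + (2 * c) *\<^sub>R e"
  by (simp add: mirror_def algebra_simps)

lemma norm_mirror_diff: "norm e = 1 \<Longrightarrow> norm (mirror e c x - mirror e c y) = norm (x - y)"
  using orthogonal_transformation_norm[OF orthogonal_mirror[of e], of "x - y"]
    linear_diff[OF orthogonal_transformation_linear[OF orthogonal_mirror[of e]], of x y]
  by (simp add: mirror_eq[of e c])

lemma scales_mirror:
  fixes e :: R3
  assumes e: "norm e = 1"
  shows "scales_lborel (mirror e c) 1"
proof -
  have 0: "scales_lborel (mirror e 0) 1"
  proof (rule scales_lborelI)
    show m: "mirror e 0 \<in> borel_measurable borel" by simp
    have inv: "mirror e 0 -` A = mirror e 0 ` A" for A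
      proof (intro set_eqI iffI)
      fix x assume "x \<in> mirror e 0 -` A"
      then show "x \<in> mirror e 0 ` A"
        using mirror_mirror[OF e, of 0 x] by (metis imageI vimageD)
    qed (use mirror_mirror[OF e, of 0] in auto)
    \<comment> \<open>Orthogonal invariance is available for sets of finite Lebesgue measure, hence
      for bounded Borel sets; a general Borel set is then exhausted by its intersections with
      balls.\<close>
    have fin: "emeasure lborel A = emeasure lborel (mirror e 0 -` A)"
      if A: "A \<in> sets borel" "bounded A" for A
    proof -
      have Al: "A \<in> lmeasurable" using A 
        by (metis bounded_set_imp_lmeasurable sets_completionI_sets sets_lborel)
      have B: "mirror e 0 ` A \<in> lmeasurable" "measure lebesgue (mirror e 0 ` A) = measure lebesgue A"
        using measurable_orthogonal_image[OF orthogonal_mirror[OF e] Al]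
          measure_orthogonal_image[OF orthogonal_mirror[OF e] Al] by auto
      have "emeasure lebesgue (mirror e 0 ` A) = emeasure lebesgue A"
        using B(2) fmeasurableD2[OF B(1)] fmeasurableD2[OF Al] by (metis emeasure_eq_ennreal_measure)
      moreover have "mirror e 0 ` A \<in> sets borel"
        using measurable_vimage_borel[OF m A(1)] inv by simp
      ultimately show ?thesis using A inv by simp
    qed
    fix A :: "R3 set" assume A: "A \<in> sets borel"
    define D where "D n = A \<inter> ball 0 (real n)" for n
    have 1: "(\<Union>n. D n) = A" 
      by (auto simp: D_def) (use reals_Archimedean2 in blast)
    have inc: "incseq D" by (auto simp: D_def incseq_def)
    have Dm: "D n \<in> sets borel" "bounded (D n)" for n
      using A by (auto simp: D_def intro: bounded_subset[OF bounded_ball])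
    have Vm: "mirror e 0 -` D n \<in> sets borel" for n using measurable_vimage_borel[OF m Dm(1)] .
    have "emeasure lborel A = (SUP n. emeasure lborel (D n))"
      using SUP_emeasure_incseq[of D lborel] inc Dm 1 by (auto simp: image_subset_iff)
    also have "\<dots> = (SUP n. emeasure lborel (mirror e 0 -` D n))"
      using fin Dm by simp
    also have "\<dots> = emeasure lborel (\<Union>n. mirror e 0 -` D n)"
      using inc Vm by (intro SUP_emeasure_incseq) (auto simp: image_subset_iff incseq_def)
    also have "(\<Union>n. mirror e 0 -` D n) = mirror e 0 -` A"
      using 1 by auto
    finally show "emeasure lborel A = ennreal 1 * emeasure lborel (mirror e 0 -` A)" by simp
  qed simp
  have "scales_lborel (\<lambda>x::R3. (2 * c) *\<^sub>R e + 1 *\<^sub>R x) 1"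
    using scales_affine[of 1 "(2 * c) *\<^sub>R e"] by simp
  from scales_compose[OF this 0] show ?thesis
    by (simp add: mirror_eq[of e c, abs_def] add.commute)
qed

section \<open>Abel inversion and radially decreasing profiles\<close>

text \<open>Three velocity components and one auxiliary variable make up a four-dimensional space,
  in which the set is the ball of radius sqrt(2y).\<close>

lemma emeasure_sublevel_4:
  "emeasure lborel {u::R3 \<times> real. (norm (fst u))\<^sup>2 / 2 + (snd u)\<^sup>2 / 2 < y}
     = ennreal (4 * unit_ball_vol 4 * (max 0 y)\<^sup>2)"
proof (cases "y > 0")
  case False
  have "{u::R3 \<times> real. (norm (fst u))\<^sup>2 / 2 + (snd u)\<^sup>2 / 2 < y} = {}"
  proof -
    have "\<not> (norm (fst u))\<^sup>2 / 2 + (snd u)\<^sup>2 / 2 < y" for u :: "R3 \<times> real"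
      using False zero_le_power2[of "norm (fst u)"] zero_le_power2[of "snd u"] by linarith
    then show ?thesis by auto
  qed
  then show ?thesis using False by simp
next
  case True
  have "{u::R3 \<times> real. (norm (fst u))\<^sup>2 / 2 + (snd u)\<^sup>2 / 2 < y} = ball 0 (sqrt (2 * y))"
  proof -
    have "(norm (fst u))\<^sup>2 / 2 + (snd u)\<^sup>2 / 2 < y \<longleftrightarrow> norm u < sqrt (2 * y)" for u :: "R3 \<times> real"
      by (auto simp: norm_prod_def)
    then show ?thesis by auto
  qed
  moreover have "emeasure lborel (ball (0::R3 \<times> real) (sqrt (2 * y)))
     = ennreal (unit_ball_vol 4 * sqrt (2 * y) ^ 4)"
    using True by (subst emeasure_ball) auto
  moreover have "sqrt (2 * y) ^ 4 = 4 * y\<^sup>2"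
    using True by (simp add: power4_eq_xxxx power2_eq_square)
  ultimately show ?thesis using True by (simp add: mult_ac)
qed

text \<open>
  Adding one velocity dimension turns the exponent 3/2 of the velocity integral into 2, so that
  the Abel transform is inverted by differentiating twice.
\<close>

lemma nn_integral_emeasure_superlevel:
  fixes h :: "R3 \<Rightarrow> real"
  assumes [measurable]: "h \<in> borel_measurable borel"
  shows "(\<integral>\<^sup>+w. emeasure lborel {z::phase. h (fst z) - (norm (snd z))\<^sup>2 / 2 > s + w\<^sup>2 / 2} \<partial>lborel)
     = ennreal (4 * unit_ball_vol 4) * (\<integral>\<^sup>+x. ennreal ((max 0 (h x - s))\<^sup>2) \<partial>lborel)"
proof -
  define g :: "R3 \<Rightarrow> R3 \<Rightarrow> real \<Rightarrow> ennreal" where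
    "g x v w = (if h x - (norm v)\<^sup>2 / 2 > s + w\<^sup>2 / 2 then 1 else 0)" for x v w
  have mg [measurable]: "(\<lambda>(x, v, w). g x v w) \<in> borel_measurable (borel \<Otimes>\<^sub>M (borel \<Otimes>\<^sub>M borel))"
    unfolding g_def by measurable
  have mgw: "(\<lambda>z. g (fst z) (snd z) w) \<in> borel_measurable (lborel \<Otimes>\<^sub>M lborel)" for w
    unfolding g_def by measurable
  have 1: "emeasure lborel {z::phase. h (fst z) - (norm (snd z))\<^sup>2 / 2 > s + w\<^sup>2 / 2}
      = (\<integral>\<^sup>+x. \<integral>\<^sup>+v. g x v w \<partial>lborel \<partial>lborel)" for w
  proof -
    have m: "{z::phase. h (fst z) - (norm (snd z))\<^sup>2 / 2 > s + w\<^sup>2 / 2} \<in> sets borel"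
      by measurable
    have "emeasure lborel {z::phase. h (fst z) - (norm (snd z))\<^sup>2 / 2 > s + w\<^sup>2 / 2}
       = (\<integral>\<^sup>+z. g (fst z) (snd z) w \<partial>(lborel \<Otimes>\<^sub>M lborel))"
      unfolding lborel_prod nn_integral_indicator[OF m[folded sets_lborel], symmetric]
      by (rule nn_integral_cong) (simp add: g_def indicator_def)
    also have "\<dots> = (\<integral>\<^sup>+x. \<integral>\<^sup>+v. g x v w \<partial>lborel \<partial>lborel)"
      using mgw by (subst lborel.nn_integral_fst[symmetric]) (auto simp: case_prod_beta)
    finally show ?thesis .
  qed
  have 2: "(\<integral>\<^sup>+w. \<integral>\<^sup>+v. g x v w \<partial>lborel \<partial>lborel) = ennreal (4 * unit_ball_vol 4 * (max 0 (h x - s))\<^sup>2)" for x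
  proof -
    have m: "{u::R3 \<times> real. (norm (fst u))\<^sup>2 / 2 + (snd u)\<^sup>2 / 2 < h x - s} \<in> sets borel"
      by measurable
    have "(\<integral>\<^sup>+w. \<integral>\<^sup>+v. g x v w \<partial>lborel \<partial>lborel) = (\<integral>\<^sup>+u. g x (fst u) (snd u) \<partial>(lborel \<Otimes>\<^sub>M lborel))"
      by (subst lborel_pair.nn_integral_snd[symmetric]) auto
    also have "\<dots> = emeasure lborel {u::R3 \<times> real. (norm (fst u))\<^sup>2 / 2 + (snd u)\<^sup>2 / 2 < h x - s}"
      unfolding lborel_prod nn_integral_indicator[OF m[folded sets_lborel], symmetric]
      by (rule nn_integral_cong) (auto simp: g_def indicator_def field_simps)
    finally show ?thesis unfolding emeasure_sublevel_4 .
  qed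
  have "(\<integral>\<^sup>+w. emeasure lborel {z::phase. h (fst z) - (norm (snd z))\<^sup>2 / 2 > s + w\<^sup>2 / 2} \<partial>lborel)
     = (\<integral>\<^sup>+w. \<integral>\<^sup>+x. \<integral>\<^sup>+v. g x v w \<partial>lborel \<partial>lborel \<partial>lborel)"
    by (simp only: 1)
  also have "\<dots> = (\<integral>\<^sup>+x. \<integral>\<^sup>+w. \<integral>\<^sup>+v. g x v w \<partial>lborel \<partial>lborel \<partial>lborel)"
    by (rule lborel_pair.Fubini') (unfold g_def, measurable)
  also have "\<dots> = ennreal (4 * unit_ball_vol 4) * (\<integral>\<^sup>+x. ennreal ((max 0 (h x - s))\<^sup>2) \<partial>lborel)"
    unfolding 2 by (subst nn_integral_cmult[symmetric]) (auto simp: ennreal_mult)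
  finally show ?thesis .
qed

text \<open>The second difference, with step 1, of the squared positive part: a continuous ramp from
  0 to 2. Compressed towards 0 it tends to twice the indicator of the positive half-line, so it acts
  as the second derivative that inverts the Abel transform.\<close>

definition kink :: "real \<Rightarrow> real" where
  "kink u = (max 0 u)\<^sup>2 - 2 * (max 0 (u - 1))\<^sup>2 + (max 0 (u - 2))\<^sup>2"

lemma kink_measurable [measurable]: "kink \<in> borel_measurable borel"
  unfolding kink_def by measurable

lemma kink_nonpos: "u \<le> 0 \<Longrightarrow> kink u = 0"
  by (simp add: kink_def)

lemma kink_large: "u \<ge> 2 \<Longrightarrow> kink u = 2"
  by (simp add: kink_def power2_eq_square algebra_simps)

lemma kink_bounds: "0 \<le> kink u" "kink u \<le> 2"
proof -
  consider "u \<le> 0" | "0 < u" "u \<le> 1" | "1 < u" "u < 2" | "u \<ge> 2" by linarith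
  then have "0 \<le> kink u \<and> kink u \<le> 2"
  proof cases
    case 2
    then have "kink u = u\<^sup>2" "u\<^sup>2 \<le> 1" by (auto simp: kink_def power_le_one)
    then show ?thesis by simp
  next
    case 3
    then have "kink u = 2 - (2 - u)\<^sup>2"
      by (simp add: kink_def power2_eq_square algebra_simps)
    moreover have "(2 - u)\<^sup>2 \<le> 1" using 3 by (intro power_le_one) auto
    moreover have "(2 - u)\<^sup>2 \<ge> 0" by simp
    ultimately show ?thesis by linarith
  qed (auto simp: kink_nonpos kink_large)
  then show "0 \<le> kink u" "kink u \<le> 2" by auto
qed

text \<open>By homogeneity of degree 2, the compressed ramp is a second difference with step
  \<open>1 / n\<close>. Its integral is therefore determined by the integrals of the squared
  positive parts of \<open>h - s\<close> at three levels \<open>s\<close>.\<close>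

lemma kink_scale:
  assumes "n > 0"
  shows "kink (n * r) = n\<^sup>2 * ((max 0 r)\<^sup>2 - 2 * (max 0 (r - 1 / n))\<^sup>2 + (max 0 (r - 2 / n))\<^sup>2)"
proof -
  have "max 0 (n * r - a) = n * max 0 (r - a / n)" for a
    using assms by (auto simp: max_def field_simps)
  from this[of 0] this[of 1] this[of 2] show ?thesis
    by (simp add: kink_def power_mult_distrib algebra_simps)
qed

text \<open>Chebyshev: where \<open>h\<close> exceeds \<open>s\<close>, the integrand is at least
  \<open>(s / 2)\<^sup>2\<close>.\<close>

lemma emeasure_superlevel_finite:
  fixes h :: "'a::euclidean_space \<Rightarrow> real"
  assumes [measurable]: "h \<in> borel_measurable borel"
    and fin: "(\<integral>\<^sup>+x. ennreal ((max 0 (h x - s / 2))\<^sup>2) \<partial>lborel) < \<infinity>" and s: "s > 0"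
  shows "emeasure lborel {x. h x > s} < \<infinity>"
proof -
  have "ennreal ((s / 2)\<^sup>2) * emeasure lborel {x. h x > s} = (\<integral>\<^sup>+x. ennreal ((s / 2)\<^sup>2) * indicator {x. h x > s} x \<partial>lborel)"
    by (subst nn_integral_cmult_indicator) auto
  also have "\<dots> \<le> (\<integral>\<^sup>+x. ennreal ((max 0 (h x - s / 2))\<^sup>2) \<partial>lborel)"
    using s by (intro nn_integral_mono) (auto simp: indicator_def intro!: ennreal_leI power_mono)
  finally have "ennreal ((s / 2)\<^sup>2) * emeasure lborel {x. h x > s} < \<infinity>"
    using fin by (rule le_less_trans)
  then show ?thesis using s by (auto simp: ennreal_mult_less_top)
qed

lemma kink_integral_limit:
  fixes h :: "'a::euclidean_space \<Rightarrow> real"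
  assumes [measurable]: "h \<in> borel_measurable borel"
    and fin: "\<And>s. s > 0 \<Longrightarrow> (\<integral>\<^sup>+x. ennreal ((max 0 (h x - s))\<^sup>2) \<partial>lborel) < \<infinity>" and s: "s > 0"
  shows "(\<lambda>n. LINT x|lborel. kink (real (Suc n) * (h x - s))) \<longlonglongrightarrow> 2 * measure lborel {x. h x > s}"
proof -
  have f: "emeasure lborel {x. h x > s} < \<infinity>"
    using emeasure_superlevel_finite[OF assms(1) fin s, of] s by simp
  have lim: "(\<lambda>n. kink (real (Suc n) * (h x - s))) \<longlonglongrightarrow> 2 * indicator {x. h x > s} x" for x
  proof (cases "h x > s")
    case True
    obtain N where N: "real N > 2 / (h x - s)" using reals_Archimedean2 by blast
    have "kink (real (Suc n) * (h x - s)) = 2" if "n \<ge> N" for n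
    proof (rule kink_large)
      have "2 / (h x - s) \<le> real (Suc n)" using N that by simp
      then show "2 \<le> real (Suc n) * (h x - s)" using True by (simp add: field_simps)
    qed
    then have "\<forall>\<^sub>F n in sequentially. kink (real (Suc n) * (h x - s)) = 2"
      unfolding eventually_sequentially by blast
    then show ?thesis using True by (simp add: tendsto_eventually)
  next
    case False
    then have "kink (real (Suc n) * (h x - s)) = 0" for n
      by (intro kink_nonpos) (simp add: mult_le_0_iff)
    then show ?thesis using False by simp
  qed
  \<comment> \<open>The ramp lies entirely to the right of 0, so all approximants are supported in
    the superlevel set of finite measure; this gives the dominating function.\<close>
  have bd: "norm (kink (real (Suc n) * (h x - s))) \<le> 2 * indicator {x. h x > s} x" for n x
    using kink_bounds[of "real (Suc n) * (h x - s)"] kink_nonpos[of "real (Suc n) * (h x - s)"]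
    by (cases "h x > s") (auto simp: mult_le_0_iff)
  have "(\<lambda>n. LINT x|lborel. kink (real (Suc n) * (h x - s))) \<longlonglongrightarrow> (LINT x|lborel. 2 * indicator {x. h x > s} x)"
    by (rule integral_dominated_convergence[where w="\<lambda>x. 2 * indicator {x. h x > s} x"])
      (use f lim bd in \<open>auto intro!: integrable_real_indicator\<close>)
  then show ?thesis by simp
qed

text \<open>Integrating the hypothesis at the levels \<open>s + w\<^sup>2 / 2\<close> over
  \<open>w\<close> equates the integrals of the squared positive parts of \<open>h0 - s\<close> and
  \<open>h1 - s\<close> for every \<open>s > 0\<close>, and transfers finiteness from
  \<open>h0\<close> to \<open>h1\<close>. Second differences in \<open>s\<close> then recover the
  measures of the superlevel sets.\<close>

lemma superlevel_measures_eq: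
  fixes h0 h1 :: "R3 \<Rightarrow> real"
  assumes m [measurable]: "h0 \<in> borel_measurable borel" "h1 \<in> borel_measurable borel"
    and eq: "\<And>s. s > 0 \<Longrightarrow> emeasure lborel {z::phase. h0 (fst z) - (norm (snd z))\<^sup>2 / 2 > s}
        = emeasure lborel {z::phase. h1 (fst z) - (norm (snd z))\<^sup>2 / 2 > s}"
    and fin: "\<And>s. s > 0 \<Longrightarrow> (\<integral>\<^sup>+x. ennreal ((max 0 (h0 x - s))\<^sup>2) \<partial>lborel) < \<infinity>"
    and s: "s > 0"
  shows "emeasure lborel {x. h0 x > s} = emeasure lborel {x. h1 x > s}"
    and "emeasure lborel {x. h0 x > s} < \<infinity>"
proof -
  have eq2: "(\<integral>\<^sup>+x. ennreal ((max 0 (h0 x - s))\<^sup>2) \<partial>lborel) = (\<integral>\<^sup>+x. ennreal ((max 0 (h1 x - s))\<^sup>2) \<partial>lborel)"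
    if s: "s > 0" for s
  proof -
    have "s + w\<^sup>2 / 2 > 0" for w :: real using s by (simp add: add_pos_nonneg)
    then have "ennreal (4 * unit_ball_vol 4) * (\<integral>\<^sup>+x. ennreal ((max 0 (h0 x - s))\<^sup>2) \<partial>lborel)
      = ennreal (4 * unit_ball_vol 4) * (\<integral>\<^sup>+x. ennreal ((max 0 (h1 x - s))\<^sup>2) \<partial>lborel)"
      using eq by (simp add: nn_integral_emeasure_superlevel[symmetric])
    moreover have "0 < 4 * unit_ball_vol 4" by simp
    ultimately show ?thesis
      by (metis ennreal_mult_cancel_left ennreal_eq_0_iff ennreal_neq_top not_less)
  qed
  have fin1: "(\<integral>\<^sup>+x. ennreal ((max 0 (h1 x - s))\<^sup>2) \<partial>lborel) < \<infinity>" if "s > 0" for s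
    using fin[OF that] eq2[OF that] by simp
  have int: "integrable lborel (\<lambda>x. (max 0 (h0 x - s))\<^sup>2)" "integrable lborel (\<lambda>x. (max 0 (h1 x - s))\<^sup>2)"
    if "s > 0" for s
    using fin[OF that] fin1[OF that] by (auto intro!: integrableI_nonneg)
  have eq3: "(LINT x|lborel. (max 0 (h0 x - s))\<^sup>2) = (LINT x|lborel. (max 0 (h1 x - s))\<^sup>2)" if "s > 0" for s
    using eq2[OF that] by (simp add: integral_eq_nn_integral)
  have form: "(LINT x|lborel. kink (real (Suc n) * (h x - s)))
      = (real (Suc n))\<^sup>2 * ((LINT x|lborel. (max 0 (h x - s))\<^sup>2)
         - 2 * (LINT x|lborel. (max 0 (h x - (s + 1 / real (Suc n))))\<^sup>2)
         + (LINT x|lborel. (max 0 (h x - (s + 2 / real (Suc n))))\<^sup>2))"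
    if i: "\<And>s. s > 0 \<Longrightarrow> integrable lborel (\<lambda>x. (max 0 (h x - s))\<^sup>2)" for n and h :: "R3 \<Rightarrow> real"
  proof -
    have p: "s + 1 / real (Suc n) > 0" "s + 2 / real (Suc n) > 0" using s by (auto simp: add_pos_pos)
    have "kink (real (Suc n) * (h x - s)) = (real (Suc n))\<^sup>2 * ((max 0 (h x - s))\<^sup>2
         - 2 * (max 0 (h x - (s + 1 / real (Suc n))))\<^sup>2 + (max 0 (h x - (s + 2 / real (Suc n))))\<^sup>2)" for x
      by (subst kink_scale) (simp_all add: diff_diff_eq)
    then show ?thesis
      using i[OF s] i[OF p(1)] i[OF p(2)] by simp
  qed
  have "(LINT x|lborel. kink (real (Suc n) * (h0 x - s))) = (LINT x|lborel. kink (real (Suc n) * (h1 x - s)))" for n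
  proof -
    have p: "s + 1 / real (Suc n) > 0" "s + 2 / real (Suc n) > 0" using s by (auto simp: add_pos_pos)
    show ?thesis
      using form[OF int(1), of n] form[OF int(2), of n] eq3[OF s] eq3[OF p(1)] eq3[OF p(2)] by simp
  qed
  then have "2 * measure lborel {x. h0 x > s} = 2 * measure lborel {x. h1 x > s}"
    using LIMSEQ_unique[OF kink_integral_limit[OF m(1) fin s]] kink_integral_limit[OF m(2) fin1 s] by simp
  moreover have f0: "emeasure lborel {x. h0 x > s} < \<infinity>" "emeasure lborel {x. h1 x > s} < \<infinity>"
    using emeasure_superlevel_finite[OF m(1) fin s] emeasure_superlevel_finite[OF m(2) fin1 s] s by auto
  ultimately show "emeasure lborel {x. h0 x > s} = emeasure lborel {x. h1 x > s}"
    by (simp add: emeasure_eq_ennreal_measure)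
  show "emeasure lborel {x. h0 x > s} < \<infinity>" by (rule f0)
qed

text \<open>The origin is exempted because a potential may be infinite there.\<close>

definition radially_decreasing :: "('a::euclidean_space \<Rightarrow> real) \<Rightarrow> bool" where
  "radially_decreasing u \<longleftrightarrow> (\<forall>x y. x \<noteq> 0 \<and> norm x \<le> norm y \<longrightarrow> u y \<le> u x)"

text \<open>Away from the origin the superlevel sets of the two functions at one level are nested:
  of two points violating this, the one nearer to the origin would lie in both. Nested sets of equal
  finite measure agree almost everywhere, and rational levels leave only one null set to
  discard.\<close>

lemma radially_decreasing_unique:
  fixes u0 u1 :: "'a::euclidean_space \<Rightarrow> real"
  assumes m [measurable]: "u0 \<in> borel_measurable borel" "u1 \<in> borel_measurable borel"
    and rad: "radially_decreasing u0" "radially_decreasing u1"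
    and eq: "\<And>s. s > 0 \<Longrightarrow> emeasure lborel {x. u0 x > s} = emeasure lborel {x. u1 x > s}"
    and fin: "\<And>s. s > 0 \<Longrightarrow> emeasure lborel {x. u0 x > s} < \<infinity>"
  shows "AE x in lborel. max 0 (u0 x) = max 0 (u1 x)"
proof -
  have z: "AE x in lborel. x \<noteq> (0::'a)" by (rule AE_lborel_singleton)
  have sub: "AE x in lborel. x \<in> B \<longrightarrow> x \<in> A"
    if "A \<subseteq> B" "emeasure lborel A = emeasure lborel B" "emeasure lborel A < \<infinity>" "A \<in> sets borel" "B \<in> sets borel"
    for A B :: "'a set"
  proof -
    have "emeasure lborel (B - A) = 0"
      using emeasure_Diff[of lborel A B] that by (simp add: less_top)
    then have "AE x in lborel. x \<notin> B - A"
      using that by (intro AE_not_in null_setsI) auto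
    then show ?thesis by auto
  qed
  have lev: "AE x in lborel. u0 x > s \<longleftrightarrow> u1 x > s" if s: "s > 0" for s
  proof -
    define A where "A = {x. u0 x > s} - {0}"
    define B where "B = {x. u1 x > s} - {0}"
    have [measurable]: "A \<in> sets borel" "B \<in> sets borel" by (auto simp: A_def B_def)
    have eA: "emeasure lborel A = emeasure lborel {x. u0 x > s}"
      and eB: "emeasure lborel B = emeasure lborel {x. u1 x > s}"
      unfolding A_def B_def by (auto intro!: emeasure_Diff_null_set null_setsI)
    have "A \<subseteq> B \<or> B \<subseteq> A"
    proof (rule ccontr)
      assume "\<not> ?thesis"
      then obtain x y where xy: "x \<in> A" "x \<notin> B" "y \<in> B" "y \<notin> A" by blast
      then have ne: "x \<noteq> 0" "y \<noteq> 0" by (auto simp: A_def B_def)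
      show False
      proof (cases "norm x \<le> norm y")
        case True
        then have "u1 y \<le> u1 x" using rad(2) ne by (auto simp: radially_decreasing_def)
        then show False using xy ne by (auto simp: A_def B_def)
      next
        case False
        then have "u0 x \<le> u0 y" using rad(1) ne by (auto simp: radially_decreasing_def)
        then show False using xy ne by (auto simp: A_def B_def)
      qed
    qed
    then have "AE x in lborel. x \<in> A \<longleftrightarrow> x \<in> B"
    proof
      assume "A \<subseteq> B"
      then show ?thesis using sub[of A B] eq[OF s] fin[OF s] eA eB by (auto elim!: eventually_mono)
    next
      assume "B \<subseteq> A"
      then show ?thesis using sub[of B A] eq[OF s] fin[OF s] eA eB by (auto elim!: eventually_mono)
    qed
    then show ?thesis using z by eventually_elim (auto simp: A_def B_def)
  qed
  have "AE x in lborel. \<forall>s\<in>{s\<in>\<rat>. s > 0}. u0 x > s \<longleftrightarrow> u1 x > s"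
    by (intro AE_ball_countable[THEN iffD2] ballI lev) (auto intro: countable_subset[OF _ countable_rat])
  then show ?thesis
  proof eventually_elim
    case (elim x)
    have le: "max 0 a \<le> max 0 b" if H: "\<forall>s\<in>{s\<in>\<rat>. s > 0}. a > s \<longrightarrow> b > s" for a b :: real
    proof (rule ccontr)
      assume "\<not> ?thesis"
      then have "max 0 b < max 0 a" by (rule not_le_imp_less)
      then obtain s where "s \<in> \<rat>" "max 0 b < s" "s < max 0 a" using Rats_dense_in_real by blast
      then show False using H[rule_format, of s] by (auto simp: less_max_iff_disj)
    qed
    show ?case using le[of "u0 x" "u1 x"] le[of "u1 x" "u0 x"] elim by (intro antisym) auto
  qed
qed

section \<open>The Casimir function\<close>

locale casimir =
  fixes j :: "real \<Rightarrow> real" and p q :: real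
  assumes H1: "H1 j" and H2: "H2 j p q"
begin

text \<open>\<open>H1\<close> controls \<open>j\<close> only on the half-line, so the two-sided
  \<open>deriv\<close> says nothing at 0; the value there is the one-sided derivative.\<close>

definition dj :: "real \<Rightarrow> real" where "dj t = (if t > 0 then deriv j t else 0)"

lemma p_gt: "p > 3" and q_gt: "q > 3"
  using H2 by (auto simp: H2_def)

lemma j_zero [simp]: "j 0 = 0" and j_nonneg: "t \<ge> 0 \<Longrightarrow> j t \<ge> 0"
  using H1 by (auto simp: H1_def)

lemma
  shows dj_within: "t \<ge> 0 \<Longrightarrow> (j has_real_derivative dj t) (at t within {0..})"
    and dj_DERIV: "t > 0 \<Longrightarrow> (j has_real_derivative dj t) (at t)"
    and dj_zero [simp]: "dj 0 = 0"
    and dj_cont: "continuous_on {0..} dj"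
    and dj_less: "0 \<le> s \<Longrightarrow> s < t \<Longrightarrow> dj s < dj t"
proof -
  obtain j' j'' where J: "\<And>t. t \<ge> 0 \<Longrightarrow> (j has_real_derivative j' t) (at t within {0..})"
    "\<And>t. t \<ge> 0 \<Longrightarrow> (j' has_real_derivative j'' t) (at t within {0..})"
    "j' 0 = 0" "\<And>t. t > 0 \<Longrightarrow> j'' t > 0"
    using H1 unfolding H1_def by blast
  have at: "at t within {0..} = at t" if "t > 0" for t :: real
    using that by (intro at_within_interior) auto
  have eq: "dj t = j' t" if "t \<ge> 0" for t
  proof (cases "t = 0")
    case False
    then have "(j has_real_derivative j' t) (at t)" using J(1)[of t] at[of t] that by simp
    then show ?thesis using False that by (simp add: dj_def DERIV_imp_deriv)
  qed (simp add: dj_def J)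
  show 1: "t \<ge> 0 \<Longrightarrow> (j has_real_derivative dj t) (at t within {0..})" using J(1) eq by simp
  show "t > 0 \<Longrightarrow> (j has_real_derivative dj t) (at t)" using J(1)[of t] eq[of t] at[of t] by simp
  show "dj 0 = 0" by (simp add: dj_def)
  have c: "continuous_on {0..} j'"
    using J(2) by (auto simp: continuous_on_eq_continuous_within intro: DERIV_continuous)
  then show "continuous_on {0..} dj"
    using eq by (simp cong: continuous_on_cong_simp)
  show "dj s < dj t" if "0 \<le> s" "s < t" for s t
  proof -
    have "j' s < j' t"
    proof (rule DERIV_pos_imp_increasing_open[OF that(2)])
      show "\<exists>y. (j' has_real_derivative y) (at x) \<and> 0 < y" if "s < x" "x < t" for x
        using J(2)[of x] J(4)[of x] at[of x] that \<open>0 \<le> s\<close> by auto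
      show "continuous_on {s..t} j'" by (rule continuous_on_subset[OF c]) (use that in auto)
    qed
    then show ?thesis using eq that by simp
  qed
qed

lemma dj_pos: "t > 0 \<Longrightarrow> dj t > 0"
  using dj_less[of 0 t] by simp

lemma dj_nonneg: "t \<ge> 0 \<Longrightarrow> dj t \<ge> 0"
  using dj_pos[of t] by (cases "t = 0") auto

lemma dj_inj: "0 \<le> s \<Longrightarrow> 0 \<le> t \<Longrightarrow> dj s = dj t \<Longrightarrow> s = t"
  using dj_less[of s t] dj_less[of t s] by (cases s t rule: linorder_cases) auto

lemma dj_less_iff: "0 \<le> s \<Longrightarrow> 0 \<le> t \<Longrightarrow> dj s < dj t \<longleftrightarrow> s < t"
  using dj_less[of s t] dj_less[of t s] by (cases s t rule: linorder_cases) auto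

lemma j_cont: "continuous_on {0..} j"
  using dj_within by (auto simp: continuous_on_eq_continuous_within intro: DERIV_continuous)

lemma j_pos: "t > 0 \<Longrightarrow> j t > 0"
proof -
  assume t: "t > 0"
  have "j 0 < j t"
  proof (rule DERIV_pos_imp_increasing_open[OF t])
    show "\<exists>y. (j has_real_derivative y) (at x) \<and> 0 < y" if "0 < x" "x < t" for x
      using dj_DERIV[of x] dj_pos[of x] that by auto
    show "continuous_on {0..t} j" using j_cont by (rule continuous_on_subset) auto
  qed
  then show ?thesis by simp
qed

lemma j_tangent:
  assumes "s \<ge> 0" "t \<ge> 0"
  shows "j t \<ge> j s + dj s * (t - s)"
proof (cases s t rule: linorder_cases)
  case less
  have "continuous_on {s..t} j" by (rule continuous_on_subset[OF j_cont]) (use assms in auto)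
  then obtain l z where z: "s < z" "z < t" "DERIV j z :> l" "j t - j s = (t - s) * l"
    using MVT[of s t j] less dj_DERIV assms by (metis le_less_trans real_differentiable_def)
  then have "l = dj z" using dj_DERIV[of z] assms DERIV_unique by fastforce
  moreover have "dj s \<le> dj z" using dj_less[of s z] z assms by simp
  ultimately show ?thesis using z less by (simp add: algebra_simps) (smt (verit) mult_left_mono mult.commute right_diff_distrib)
next
  case greater
  have "continuous_on {t..s} j" using j_cont by (rule continuous_on_subset) (use assms in auto)
  then obtain l z where z: "t < z" "z < s" "DERIV j z :> l" "j s - j t = (s - t) * l"
    using MVT[of t s j] greater dj_DERIV assms by (metis le_less_trans real_differentiable_def)
  then have "l = dj z" using dj_DERIV[of z] assms DERIV_unique by fastforce
  moreover have "dj z \<le> dj s" using dj_less[of z s] z assms by simp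
  ultimately have "j s - j t \<le> (s - t) * dj s" using z greater by (simp add: mult_left_mono)
  then show ?thesis by (simp add: algebra_simps)
qed simp

lemma j_convex:
  assumes "0 \<le> a" "0 \<le> b" "0 \<le> t" "t \<le> 1"
  shows "j ((1 - t) * a + t * b) \<le> (1 - t) * j a + t * j b"
proof -
  define m where "m = (1 - t) * a + t * b"
  have m: "m \<ge> 0" using assms by (simp add: m_def)
  have "(1 - t) * (j m + dj m * (a - m)) + t * (j m + dj m * (b - m)) \<le> (1 - t) * j a + t * j b"
    using j_tangent[OF m assms(1)] j_tangent[OF m assms(2)] assms
    by (intro add_mono mult_left_mono) auto
  moreover have "(1 - t) * (j m + dj m * (a - m)) + t * (j m + dj m * (b - m)) = j m + dj m * ((1 - t) * a + t * b - m)"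
    by (simp add: algebra_simps)
  ultimately show ?thesis by (simp add: m_def)
qed

lemma j_dj: "t \<ge> 0 \<Longrightarrow> p * j t \<le> t * dj t" "t \<ge> 0 \<Longrightarrow> t * dj t \<le> q * j t"
proof -
  have "p * j t \<le> t * dj t \<and> t * dj t \<le> q * j t" if "t \<ge> 0"
  proof (cases "t = 0")
    case False
    then have t: "t > 0" using that by simp
    then have "p \<le> t * dj t / j t" "t * dj t / j t \<le> q"
      using H2 by (auto simp: H2_def dj_def)
    then show ?thesis using j_pos[OF t] by (simp add: field_simps)
  qed simp
  then show "t \<ge> 0 \<Longrightarrow> p * j t \<le> t * dj t" "t \<ge> 0 \<Longrightarrow> t * dj t \<le> q * j t" by auto
qed

text \<open>\<open>H2\<close> bounds the derivative of ln j with respect to ln t between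
  \<open>p\<close> and \<open>q\<close>; hence \<open>ln (j (x * t)) - c * ln x\<close> is
  increasing in \<open>x\<close> for \<open>c = p\<close> and decreasing for
  \<open>c = q\<close>.\<close>

lemma j_growth:
  assumes a: "a \<ge> 1" and t: "t \<ge> 0"
  shows "a powr p * j t \<le> j (a * t)" "j (a * t) \<le> a powr q * j t"
proof -
  have "a powr p * j t \<le> j (a * t) \<and> j (a * t) \<le> a powr q * j t"
  proof (cases "t = 0")
    case False
    then have t: "t > 0" using t by simp
    have d: "((\<lambda>x. ln (j (x * t)) - c * ln x) has_real_derivative (t * dj (x * t) / j (x * t) - c / x)) (at x)"
      if "x \<ge> 1" for x c
    proof -
      have x: "x * t > 0" "x > 0" using that t by auto
      have "((\<lambda>x. j (x * t)) has_real_derivative (dj (x * t) * t)) (at x)"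
        using x by (intro DERIV_chain2[where g="\<lambda>x. x * t" and f=j] dj_DERIV) (auto intro!: derivative_eq_intros)
      then show ?thesis using j_pos[OF x(1)] x(2)
        by (auto intro!: derivative_eq_intros simp: field_simps)
    qed
    have b: "t * dj (x * t) / j (x * t) - p / x \<ge> 0" "t * dj (x * t) / j (x * t) - q / x \<le> 0" if "x \<ge> 1" for x
    proof -
      have x: "x * t > 0" "x > 0" using that t by auto
      show "t * dj (x * t) / j (x * t) - p / x \<ge> 0" "t * dj (x * t) / j (x * t) - q / x \<le> 0"
        using j_dj[of "x * t"] x j_pos[OF x(1)] by (auto simp: field_simps)
    qed
    have at: "a * t > 0" using a t by simp
    have "ln (j (1 * t)) - p * ln 1 \<le> ln (j (a * t)) - p * ln a"
      by (rule DERIV_nonneg_imp_nondecreasing[OF a]) (use d b in blast)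
    then have "ln (a powr p * j t) \<le> ln (j (a * t))" using j_pos[OF t] a by (simp add: ln_mult ln_powr)
    then have 1: "a powr p * j t \<le> j (a * t)" using j_pos[OF t] j_pos[OF at] a by simp
    have "ln (j (1 * t)) - q * ln 1 \<ge> ln (j (a * t)) - q * ln a"
      by (rule DERIV_nonpos_imp_nonincreasing[OF a]) (use d b in blast)
    then have "ln (a powr q * j t) \<ge> ln (j (a * t))" using j_pos[OF t] a by (simp add: ln_mult ln_powr)
    then have 2: "a powr q * j t \<ge> j (a * t)" using j_pos[OF t] j_pos[OF at] a by simp
    show ?thesis using 1 2 by simp
  qed simp
  then show "a powr p * j t \<le> j (a * t)" "j (a * t) \<le> a powr q * j t" by auto
qed

lemma dj_surj:
  assumes "y \<ge> 0"
  obtains t where "t \<ge> 0" "dj t = y"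
proof -
  \<comment> \<open>From \<open>p * j b \<le> b * dj b\<close> and
    \<open>j b \<ge> b\<^sup>2 * j 1\<close> one gets \<open>dj b \<ge> p * b * j 1\<close>; this
    \<open>b\<close> lifts the right-hand side above \<open>y\<close>.\<close>
  define b where "b = max 1 (y / (p * j 1))"
  have pj: "p * j 1 > 0" using p_gt j_pos[of 1] by simp
  have b: "b \<ge> 1" by (simp add: b_def)
  have "b powr 2 \<le> b powr p" using b p_gt by (intro powr_mono) auto
  then have "p * (b * b) * j 1 \<le> p * (b powr p * j 1)"
    using b p_gt j_pos[of 1] by (simp add: power2_eq_square mult_right_mono)
  also have "\<dots> \<le> p * j b" using j_growth(1)[OF b, of 1] p_gt by simp
  also have "\<dots> \<le> b * dj b" using j_dj(1)[of b] b by simp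
  finally have "b * (p * b * j 1) \<le> b * dj b" by (simp add: mult_ac)
  then have "p * b * j 1 \<le> dj b" using b by (subst (asm) mult_le_cancel_left_pos) auto
  moreover have "y \<le> p * b * j 1"
  proof -
    have "y / (p * j 1) \<le> b" by (simp add: b_def)
    then show ?thesis using pj by (simp add: field_simps)
  qed
  ultimately have "dj 0 \<le> y" "y \<le> dj b" using assms by auto
  then obtain t where "0 \<le> t" "t \<le> b" "dj t = y"
    using IVT'[of dj 0 y b] b continuous_on_subset[OF dj_cont, of "{0..b}"] by auto
  then show ?thesis using that by blast
qed

lemma j_comp_measurable:
  assumes "f \<in> borel_measurable M" "\<And>x. f x \<ge> 0"
  shows "(\<lambda>x. j (f x)) \<in> borel_measurable M"
proof -
  have "continuous_on UNIV (\<lambda>t. j (max 0 t))"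
    by (rule continuous_on_compose2[OF j_cont]) (auto intro!: continuous_intros)
  then have "(\<lambda>t. j (max 0 t)) \<in> borel_measurable borel" by (rule borel_measurable_continuous_onI)
  from measurable_compose[OF assms(1) this] show ?thesis using assms(2) by (simp add: max_absorb2)
qed

lemma dj_comp_measurable:
  assumes "f \<in> borel_measurable M" "\<And>x. f x \<ge> 0"
  shows "(\<lambda>x. dj (f x)) \<in> borel_measurable M"
proof -
  have "continuous_on UNIV (\<lambda>t. dj (max 0 t))"
    by (rule continuous_on_compose2[OF dj_cont]) (auto intro!: continuous_intros)
  then have "(\<lambda>t. dj (max 0 t)) \<in> borel_measurable borel" by (rule borel_measurable_continuous_onI)
  from measurable_compose[OF assms(1) this] show ?thesis using assms(2) by (simp add: max_absorb2)
qed

text \<open>This embeds the energy space into L^p, the form in which the growth of \<open>j\<close>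
  enters the density estimate; the linear term covers values below 1.\<close>

lemma powr_le_j: "t \<ge> 0 \<Longrightarrow> t powr p \<le> t + j t / j 1"
proof (cases "t \<ge> 1")
  case True
  have "t powr p \<le> j t / j 1" using j_growth(1)[OF True, of 1] j_pos[of 1] by (simp add: field_simps)
  then show ?thesis using True by simp
next
  case False
  assume t: "t \<ge> 0"
  have "t powr p \<le> t powr 1" using False t p_gt by (intro powr_mono') auto
  moreover have "j t / j 1 \<ge> 0" using j_nonneg[OF t] j_pos[of 1] by simp
  ultimately show ?thesis using t by simp
qed

end

section \<open>Integrability of the densities\<close>

text \<open>Dyadic shells: for 2^(-n-1) \<le> |x| < 2^(-n) the integrand is at most
  2^(\<beta>(n+1)), while the ball of radius 2^(-n) has volume of order 8^(-n). The resulting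
  geometric series has ratio 2^(\<beta>-3) < 1.\<close>

lemma nn_integral_norm_powr_ball:
  fixes \<beta> :: real
  assumes "0 \<le> \<beta>" "\<beta> < 3"
  shows "(\<integral>\<^sup>+x. ennreal (norm x powr (- \<beta>)) * indicator (ball (0::R3) 1) x \<partial>lborel) < \<infinity>"
proof -
  define g :: "nat \<Rightarrow> R3 \<Rightarrow> ennreal" where
    "g n x = ennreal (2 powr (\<beta> * real (Suc n))) * indicator (ball 0 ((1/2) ^ n)) x" for n x
  have le: "ennreal (norm x powr (- \<beta>)) * indicator (ball 0 1) x \<le> (\<Sum>n. g n x)" for x :: R3
  proof (cases "x \<noteq> 0 \<and> norm x < 1")
    case True
    then obtain m where "(1/2::real) ^ m < norm x" using real_arch_pow_inv[of "norm x" "1/2"] by auto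
    then have ex: "(1/2::real) ^ m \<le> norm x" by simp
    define m where "m = (LEAST m. (1/2::real) ^ m \<le> norm x)"
    have m: "(1/2::real) ^ m \<le> norm x" unfolding m_def using ex by (rule LeastI)
    have "m \<noteq> 0" using m True by (cases m) auto
    then obtain n where n: "m = Suc n" using not0_implies_Suc by blast
    have "norm x < (1/2) ^ n" using not_less_Least[of n "\<lambda>m. (1/2::real) ^ m \<le> norm x"] n m_def by force
    then have i: "x \<in> ball 0 ((1/2) ^ n)" by simp
    have "norm x powr (- \<beta>) \<le> ((1/2) ^ Suc n) powr (- \<beta>)"
      using m n assms True by (intro powr_mono2') auto
    also have "((1/2::real) ^ Suc n) powr (- \<beta>) = 2 powr (\<beta> * real (Suc n))"
      by (simp add: powr_realpow[symmetric] powr_powr powr_divide powr_minus_divide mult.commute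
          del: powr_realpow power_Suc of_nat_Suc)
    finally have "ennreal (norm x powr (- \<beta>)) * indicator (ball 0 1) x \<le> g n x"
      using i True by (simp add: g_def ennreal_leI)
    also have "g n x \<le> (\<Sum>n. g n x)" 
      using sum_le_suminf[of "\<lambda>n. g n x" "{n}"] by (simp add: summableI)
    finally show ?thesis .
  qed (auto simp: indicator_def)
  have "(\<integral>\<^sup>+x. ennreal (norm x powr (- \<beta>)) * indicator (ball (0::R3) 1) x \<partial>lborel)
     \<le> (\<integral>\<^sup>+x. (\<Sum>n. g n x) \<partial>lborel)"
    by (intro nn_integral_mono le)
  also have "\<dots> = (\<Sum>n. \<integral>\<^sup>+x. g n x \<partial>lborel)"
    unfolding g_def
    by (intro nn_integral_suminf borel_measurable_times_ennreal borel_measurable_const borel_measurable_indicator) simp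
  also have "\<dots> = (\<Sum>n. ennreal (2 powr \<beta> * unit_ball_vol 3 * (2 powr (\<beta> - 3)) ^ n))"
  proof (rule suminf_cong)
    fix n
    have "(\<integral>\<^sup>+x. g n x \<partial>lborel) = ennreal (2 powr (\<beta> * real (Suc n))) * ennreal (unit_ball_vol 3 * ((1/2) ^ n) ^ 3)"
      unfolding g_def by (subst nn_integral_cmult_indicator) (auto simp: emeasure_ball)
    also have "\<dots> = ennreal (2 powr \<beta> * unit_ball_vol 3 * (2 powr (\<beta> - 3)) ^ n)"
    proof -
      have "((1/2::real) ^ n) ^ 3 = 2 powr (- 3 * real n)"
        by (simp add: power_divide powr_minus_divide powr_realpow[symmetric] powr_powr power_mult[symmetric] mult.commute)
      moreover have "(2 powr (\<beta> - 3)) ^ n = 2 powr ((\<beta> - 3) * real n)"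
        by (simp add: powr_realpow[symmetric] powr_powr)
      moreover have "2 powr (\<beta> * real (Suc n)) * 2 powr (- 3 * real n) = 2 powr \<beta> * 2 powr ((\<beta> - 3) * real n)"
        by (simp add: powr_add[symmetric] algebra_simps)
      ultimately show ?thesis by (simp add: ennreal_mult[symmetric] mult_ac)
    qed
    finally show "(\<integral>\<^sup>+x. g n x \<partial>lborel) = ennreal (2 powr \<beta> * unit_ball_vol 3 * (2 powr (\<beta> - 3)) ^ n)" .
  qed
  also have "\<dots> < \<infinity>"
  proof -
    have "2 powr (\<beta> - 3) < 2 powr 0" using assms by (intro powr_less_mono) auto
    then have "summable (\<lambda>n. 2 powr \<beta> * unit_ball_vol 3 * (2 powr (\<beta> - 3)) ^ n)"
      by (intro summable_mult summable_geometric) simp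
    then show ?thesis by (subst suminf_ennreal2) (auto simp: less_top)
  qed
  finally show ?thesis .
qed

text \<open>A pointwise stand-in for the Hardy-Littlewood-Sobolev inequality. The left side is the
  weighted geometric mean of the three summands with weights 1 - 1/r, 1 - 1/r and 2/r - 1, hence at
  most their maximum. Each summand couples at most two of the three factors, so it integrates to a
  product.\<close>

lemma young_pointwise:
  fixes a b k r :: real
  assumes "a \<ge> 0" "b \<ge> 0" "k \<ge> 0" and r: "1 < r" "r \<le> 2"
  shows "a * b * k \<le> a powr r * k powr (r / (2 * (r - 1))) + b powr r * k powr (r / (2 * (r - 1))) + a powr r * b powr r"
proof (cases "a = 0 \<or> b = 0 \<or> k = 0")
  case False
  then have pos: "a > 0" "b > 0" "k > 0" using assms by auto
  define s where "s = r / (2 * (r - 1))"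
  define \<alpha> where "\<alpha> = 1 - 1 / r"
  define \<gamma> where "\<gamma> = 2 / r - 1"
  have nn: "\<alpha> \<ge> 0" "\<gamma> \<ge> 0" using r by (auto simp: \<alpha>_def \<gamma>_def field_simps)
  have "\<alpha> = (r - 1) / r" using r by (simp add: \<alpha>_def field_simps)
  then have "s * \<alpha> + s * \<alpha> = 1" using r by (simp add: s_def)
  moreover have "r * \<alpha> + r * \<gamma> = 1" "\<alpha> + \<alpha> + \<gamma> = 1"
    using r by (auto simp: \<alpha>_def \<gamma>_def field_simps)
  ultimately have e: "r * \<alpha> + r * \<gamma> = 1" "s * \<alpha> + s * \<alpha> = 1" "\<alpha> + \<alpha> + \<gamma> = 1" by auto
  define X Y Z where "X = a powr r * k powr s" and "Y = b powr r * k powr s" and "Z = a powr r * b powr r"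
  define m where "m = max X (max Y Z)"
  have XYZ: "X > 0" "Y > 0" "Z > 0" using pos by (auto simp: X_def Y_def Z_def)
  then have m: "m > 0" "X \<le> m" "Y \<le> m" "Z \<le> m" by (auto simp: m_def)
  have "X powr \<alpha> * Y powr \<alpha> * Z powr \<gamma>
      = (a powr (r * \<alpha>) * a powr (r * \<gamma>)) * (b powr (r * \<alpha>) * b powr (r * \<gamma>)) * (k powr (s * \<alpha>) * k powr (s * \<alpha>))"
    using pos by (simp add: X_def Y_def Z_def powr_mult powr_powr mult_ac)
  also have "\<dots> = a * b * k"
    using pos e by (simp add: powr_add[symmetric])
  finally have "a * b * k = X powr \<alpha> * Y powr \<alpha> * Z powr \<gamma>" ..
  also have "\<dots> \<le> m powr \<alpha> * m powr \<alpha> * m powr \<gamma>"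
    using XYZ m nn by (intro mult_mono powr_mono2 mult_nonneg_nonneg) auto
  also have "\<dots> = m" using m e(3) by (simp add: powr_add[symmetric])
  also have "m \<le> X + Y + Z" using XYZ by (auto simp: m_def)
  finally show ?thesis by (simp add: X_def Y_def Z_def s_def)
qed (use assms in auto)

definition good_density :: "real \<Rightarrow> (R3 \<Rightarrow> real) \<Rightarrow> bool" where
  "good_density r \<rho> \<longleftrightarrow> \<rho> \<in> borel_measurable borel \<and> (\<forall>x. 0 \<le> \<rho> x) \<and> integrable lborel \<rho> \<and>
     integrable lborel (\<lambda>x. \<rho> x powr r)"

lemma good_densityD:
  assumes "good_density r \<rho>"
  shows "\<rho> \<in> borel_measurable borel" "0 \<le> \<rho> x" "integrable lborel \<rho>" "integrable lborel (\<lambda>x. \<rho> x powr r)"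
  using assms by (auto simp: good_density_def)

lemma nn_integral_convolution_fst:
  fixes F K :: "R3 \<Rightarrow> ennreal"
  assumes [measurable]: "F \<in> borel_measurable borel" "K \<in> borel_measurable borel"
  shows "(\<integral>\<^sup>+z. F (fst z) * K (snd z - fst z) \<partial>lborel) = (\<integral>\<^sup>+x. F x \<partial>lborel) * (\<integral>\<^sup>+x. K x \<partial>lborel)"
proof -
  have tr: "(\<integral>\<^sup>+y. K (y - x) \<partial>lborel) = (\<integral>\<^sup>+y. K y \<partial>lborel)" for x
    using scales_nn_integral[OF scales_affine[of 1 "- x"], of K] by simp
  have "(\<integral>\<^sup>+z. F (fst z) * K (snd z - fst z) \<partial>lborel) = (\<integral>\<^sup>+x. \<integral>\<^sup>+y. F x * K (y - x) \<partial>lborel \<partial>lborel)"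
    by (subst lborel_prod[symmetric], subst lborel.nn_integral_fst[symmetric]) (auto simp: lborel_prod)
  also have "\<dots> = (\<integral>\<^sup>+x. F x * (\<integral>\<^sup>+y. K y \<partial>lborel) \<partial>lborel)"
    by (simp add: nn_integral_cmult tr)
  also have "\<dots> = (\<integral>\<^sup>+x. F x \<partial>lborel) * (\<integral>\<^sup>+x. K x \<partial>lborel)"
    by (rule nn_integral_multc) simp
  finally show ?thesis .
qed

lemma nn_integral_convolution_snd:
  fixes F K :: "R3 \<Rightarrow> ennreal"
  assumes [measurable]: "F \<in> borel_measurable borel" "K \<in> borel_measurable borel"
  shows "(\<integral>\<^sup>+z. F (snd z) * K (fst z - snd z) \<partial>lborel) = (\<integral>\<^sup>+x. F x \<partial>lborel) * (\<integral>\<^sup>+x. K x \<partial>lborel)"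
  using scales_nn_integral[OF scales_swap, of "\<lambda>z. F (snd z) * K (fst z - snd z)"]
    nn_integral_convolution_fst[OF assms] by simp

lemma nn_integral_product:
  fixes F G :: "R3 \<Rightarrow> ennreal"
  assumes [measurable]: "F \<in> borel_measurable borel" "G \<in> borel_measurable borel"
  shows "(\<integral>\<^sup>+z. F (fst z) * G (snd z) \<partial>lborel) = (\<integral>\<^sup>+x. F x \<partial>lborel) * (\<integral>\<^sup>+x. G x \<partial>lborel)"
  by (subst lborel_prod[symmetric], subst lborel.nn_integral_fst[symmetric])
    (auto simp: nn_integral_cmult nn_integral_multc)

lemma integrable_nn_less_top:
  "integrable M f \<Longrightarrow> (\<And>x. f x \<ge> 0) \<Longrightarrow> (\<integral>\<^sup>+x. ennreal (f x) \<partial>M) < \<infinity>" for f :: "_ \<Rightarrow> real"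
  by (simp add: integrable_iff_bounded)

text \<open>Pairs at distance at least 1 are bounded by the product of the masses. For close pairs
  \<open>young_pointwise\<close> turns the kernel into the power -r/(r-1) of the distance, and r >
  3/2 is exactly what makes that exponent larger than -3, hence locally integrable.\<close>

lemma good_pair_integrable_sq:
  assumes \<rho>: "good_density r \<rho>" and \<sigma>: "good_density r \<sigma>" and r: "3 / 2 < r" "r \<le> 2"
  shows "integrable lborel (\<lambda>z. \<rho> (fst z) * \<sigma> (snd z) * (1 / (norm (fst z - snd z))\<^sup>2))"
proof -
  note [measurable] = good_densityD(1)[OF \<rho>] good_densityD(1)[OF \<sigma>]
  note nn = good_densityD(2)[OF \<rho>] good_densityD(2)[OF \<sigma>]
  define \<beta> where "\<beta> = r / (r - 1)"
  define K :: "R3 \<Rightarrow> ennreal" where "K x = ennreal (norm x powr (- \<beta>)) * indicator (ball 0 1) x" for x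
  have \<beta>: "0 \<le> \<beta>" "\<beta> < 3" using r by (auto simp: \<beta>_def field_simps)
  have [measurable]: "ball (0::R3) 1 \<in> sets borel" by simp
  have Km [measurable]: "K \<in> borel_measurable borel" unfolding K_def by measurable
  have Kf: "(\<integral>\<^sup>+x. K x \<partial>lborel) < \<infinity>" unfolding K_def by (rule nn_integral_norm_powr_ball[OF \<beta>])
  have Ksym: "K (- x) = K x" for x by (simp add: K_def indicator_def)
  have le: "ennreal (\<rho> x * \<sigma> y * (1 / (norm (x - y))\<^sup>2))
      \<le> ennreal (\<rho> x) * ennreal (\<sigma> y) + (ennreal (\<rho> x powr r) * K (y - x) + ennreal (\<sigma> y powr r) * K (x - y)
        + ennreal (\<rho> x powr r) * ennreal (\<sigma> y powr r))" for x y
  proof (cases "norm (x - y) < 1")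
    case False
    then have "1 \<le> (norm (x - y))\<^sup>2" by (intro one_le_power) simp
    then have "1 / (norm (x - y))\<^sup>2 \<le> 1" by (simp add: divide_le_eq)
    then have "\<rho> x * \<sigma> y * (1 / (norm (x - y))\<^sup>2) \<le> \<rho> x * \<sigma> y * 1"
      using nn by (intro mult_left_mono mult_nonneg_nonneg) auto
    then show ?thesis using nn by (simp add: ennreal_mult[symmetric] ennreal_leI add_increasing2)
  next
    case True
    have "(1 / (norm (x - y))\<^sup>2) powr (r / (2 * (r - 1))) = norm (x - y) powr (- \<beta>)"
    proof (cases "x = y")
      case False
      then have n: "norm (x - y) > 0" by simp
      have "1 / (norm (x - y))\<^sup>2 = norm (x - y) powr (- 2)"
        using n by (simp add: powr_minus_divide)
      then have "(1 / (norm (x - y))\<^sup>2) powr (r / (2 * (r - 1))) = norm (x - y) powr (- 2 * (r / (2 * (r - 1))))"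
        by (simp only: powr_powr)
      also have "- 2 * (r / (2 * (r - 1))) = - \<beta>"
        using r by (simp add: \<beta>_def field_simps)
      finally show ?thesis .
    qed simp
    then have "\<rho> x * \<sigma> y * (1 / (norm (x - y))\<^sup>2) \<le> \<rho> x powr r * norm (x - y) powr (- \<beta>)
        + \<sigma> y powr r * norm (x - y) powr (- \<beta>) + \<rho> x powr r * \<sigma> y powr r"
      using young_pointwise[of "\<rho> x" "\<sigma> y" "1 / (norm (x - y))\<^sup>2" r] nn r by simp
    then have "ennreal (\<rho> x * \<sigma> y * (1 / (norm (x - y))\<^sup>2)) \<le> ennreal (\<rho> x powr r) * K (y - x) + ennreal (\<sigma> y powr r) * K (x - y)
        + ennreal (\<rho> x powr r) * ennreal (\<sigma> y powr r)"
      using True Ksym[of "x - y"] by (simp add: K_def ennreal_mult[symmetric] ennreal_plus[symmetric] ennreal_leI norm_minus_commute del: ennreal_plus)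
    then show ?thesis by (rule order_trans) (simp add: add_increasing)
  qed
  have "(\<integral>\<^sup>+z. ennreal (\<rho> (fst z) * \<sigma> (snd z) * (1 / (norm (fst z - snd z))\<^sup>2)) \<partial>lborel)
     \<le> (\<integral>\<^sup>+z. ennreal (\<rho> (fst z)) * ennreal (\<sigma> (snd z)) + (ennreal (\<rho> (fst z) powr r) * K (snd z - fst z)
        + ennreal (\<sigma> (snd z) powr r) * K (fst z - snd z)
        + ennreal (\<rho> (fst z) powr r) * ennreal (\<sigma> (snd z) powr r)) \<partial>lborel)"
    by (intro nn_integral_mono le)
  also have "\<dots> = (\<integral>\<^sup>+x. \<rho> x \<partial>lborel) * (\<integral>\<^sup>+x. \<sigma> x \<partial>lborel) + ((\<integral>\<^sup>+x. \<rho> x powr r \<partial>lborel) * (\<integral>\<^sup>+x. K x \<partial>lborel)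
      + (\<integral>\<^sup>+x. \<sigma> x powr r \<partial>lborel) * (\<integral>\<^sup>+x. K x \<partial>lborel)
      + (\<integral>\<^sup>+x. \<rho> x powr r \<partial>lborel) * (\<integral>\<^sup>+x. \<sigma> x powr r \<partial>lborel))"
    using nn_integral_product[of "\<lambda>x. ennreal (\<rho> x)" "\<lambda>x. ennreal (\<sigma> x)"]
      nn_integral_product[of "\<lambda>x. ennreal (\<rho> x powr r)" "\<lambda>x. ennreal (\<sigma> x powr r)"]
      nn_integral_convolution_fst[of "\<lambda>x. ennreal (\<rho> x powr r)" K]
      nn_integral_convolution_snd[of "\<lambda>x. ennreal (\<sigma> x powr r)" K]
    by (simp add: nn_integral_add)
  also have "\<dots> < \<infinity>"
    using Kf integrable_nn_less_top[OF good_densityD(3)[OF \<rho>] nn(1)] integrable_nn_less_top[OF good_densityD(3)[OF \<sigma>] nn(2)]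
      integrable_nn_less_top[OF good_densityD(4)[OF \<rho>]] integrable_nn_less_top[OF good_densityD(4)[OF \<sigma>]]
    by (simp add: ennreal_mult_less_top)
  finally show ?thesis
    by (intro integrableI_nonneg) (auto simp: nn)
qed

section \<open>Spatial densities of the energy space lie in L^1 and L^r\<close>

context casimir begin

text \<open>The interpolation exponent between L^p in phase space and the second velocity moment. It
  equals 3/2 at \<open>p = 3\<close>, so the assumption on \<open>p\<close> places it above the
  threshold of the Manev kernel.\<close>

definition r where "r = (5 * p - 3) / (3 * p - 1)"

lemma r_bounds: "3 / 2 < r" "r \<le> 2"
  using p_gt by (auto simp: r_def field_simps)

lemma energy_spaceD:
  assumes "f \<in> energy_space j"
  shows "f \<in> borel_measurable borel" "f z \<ge> 0" "integrable lborel f" "integrable lborel (\<lambda>z. j (f z))"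
    "integrable lborel (\<lambda>z. (norm (snd z))\<^sup>2 * f z)"
proof -
  have "(\<lambda>(x, v). (norm v)\<^sup>2 * f (x, v)) = (\<lambda>z. (norm (snd z))\<^sup>2 * f z)" by auto
  with assms show "f \<in> borel_measurable borel" "f z \<ge> 0" "integrable lborel f" "integrable lborel (\<lambda>z. j (f z))"
    "integrable lborel (\<lambda>z. (norm (snd z))\<^sup>2 * f z)"
    unfolding energy_space_def mem_Collect_eq by metis+
qed

lemma density_nonneg: "f \<in> energy_space j \<Longrightarrow> density f x \<ge> 0"
  by (auto simp: density_def energy_spaceD(2) intro!: integral_nonneg_AE)

lemma density_measurable:
  assumes [measurable]: "f \<in> borel_measurable borel"
  shows "density f \<in> borel_measurable borel"
proof -
  have [measurable]: "f \<in> borel_measurable (borel \<Otimes>\<^sub>M borel)" by (simp add: borel_prod)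
  show ?thesis unfolding density_def[abs_def] by measurable
qed

lemma density_integrable:
  assumes "integrable lborel f"
  shows "integrable lborel (density f)"
  using lborel_pair.integrable_fst'[of f] assms unfolding density_def[abs_def] lborel_prod by simp

text \<open>Velocities are split three ways: where \<open>g\<close> is at most \<open>L\<close> and
  the speed is below \<open>R\<close> the volume bound applies, where \<open>g\<close> exceeds
  \<open>L\<close> the p-th power wins, and for speeds beyond \<open>R\<close> the kinetic term
  does.\<close>

lemma density_bound:
  assumes g: "integrable lborel g" "\<And>v. g v \<ge> 0" and F: "integrable lborel F" 
    and le: "\<And>v. g v powr p \<le> F v" "\<And>v. (norm v)\<^sup>2 * g v \<le> F v"
  shows "(LINT v|lborel. g v) \<le> (unit_ball_vol 3 + 2) * (LINT v|lborel. F (v::R3)) powr (1 / r)"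
proof -
  define A where "A = (LINT v|lborel. F v)"
  have Fn: "F v \<ge> 0" for v using le(1)[of v] by (meson order_trans powr_ge_zero)
  then have A0: "A \<ge> 0" by (simp add: A_def)
  have gm [measurable]: "g \<in> borel_measurable borel" using g(1) by auto
  show ?thesis
  proof (cases "A = 0")
    case True
    have "AE v in lborel. F v = 0"
      using integral_nonneg_eq_0_iff_AE[OF F] Fn True by (simp add: A_def)
    then have "AE v in lborel. g v = 0"
    proof eventually_elim
      case (elim v)
      then have "g v powr p = 0" using le(1)[of v] by (metis antisym powr_ge_zero)
      then show ?case by simp
    qed
    then have "(LINT v|lborel. g v) = 0" by (simp add: integral_eq_zero_AE)
    then show ?thesis by simp
  next
    case False
    then have A: "A > 0" using A0 by simp
    \<comment> \<open>The three contributions are L R^3, A / L^(p-1) and A / R^2. Equating them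
      gives R^2 = L^(p-1) and L R^5 = A, which determine \<open>L\<close> and
      \<open>R\<close>.\<close>
    define L where "L = A powr (2 / (5 * p - 3))"
    define R where "R = L powr ((p - 1) / 2)"
    have L: "L > 0" and R: "R > 0" using A by (auto simp: L_def R_def)
    have R2: "R\<^sup>2 = L powr (p - 1)"
      by (simp add: R_def power2_eq_square powr_add[symmetric])
    have pw: "g v \<le> L * indicator (ball 0 R) v + 2 * (F v / R\<^sup>2)" for v
    proof -
      have F2: "0 \<le> F v / R\<^sup>2" using Fn R by simp
      consider "g v \<le> L" "norm v < R" | "g v > L" | "norm v \<ge> R" by linarith
      then show ?thesis
      proof cases
        case 1 then show ?thesis using F2 by simp
      next
        case 2
        have "g v * L powr (p - 1) \<le> g v * g v powr (p - 1)"
          using 2 L p_gt g(2) by (intro mult_left_mono powr_mono2) auto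
        also have "\<dots> = g v powr p"
          using 2 L powr_add[of "g v" 1 "p - 1"] by simp
        finally have "g v * R\<^sup>2 \<le> F v" using le(1)[of v] R2 by simp
        then have "g v \<le> F v / R\<^sup>2" using R by (simp add: field_simps)
        moreover have "0 \<le> L * indicator (ball 0 R) v" using L by simp
        ultimately show ?thesis using F2 by linarith
      next
        case 3
        have "R\<^sup>2 * g v \<le> (norm v)\<^sup>2 * g v"
          using 3 R g(2) by (intro mult_right_mono power_mono) auto
        then have "g v * R\<^sup>2 \<le> F v" using le(2)[of v] by (simp add: mult.commute)
        then have "g v \<le> F v / R\<^sup>2" using R by (simp add: field_simps)
        moreover have "0 \<le> L * indicator (ball 0 R) v" using L by simp
        ultimately show ?thesis using F2 by linarith
      qed
    qed
    have ib: "integrable lborel (indicator (ball (0::R3) R) :: R3 \<Rightarrow> real)"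
      by (rule integrable_real_indicator) (auto simp: emeasure_ball R less_imp_le)
    have "(LINT v|lborel. g v) \<le> (LINT v|lborel. L * indicator (ball 0 R) v + 2 * (F v / R\<^sup>2))"
      using g F ib by (intro integral_mono pw) auto
    also have "\<dots> = L * measure lborel (ball (0::R3) R) + 2 * (A / R\<^sup>2)"
      using F ib by (simp add: A_def)
    also have "measure lborel (ball (0::R3) R) = unit_ball_vol 3 * R ^ 3"
      using R by (simp add: measure_def emeasure_ball)
    also have "L * (unit_ball_vol 3 * R ^ 3) + 2 * (A / R\<^sup>2) = (unit_ball_vol 3 + 2) * A powr (1 / r)"
    proof -
      define w where "w = 5 * p - 3"
      have w: "w > 0" using p_gt by (simp add: w_def)
      have "L * R ^ 3 = L powr (1 + 3 * ((p - 1) / 2))"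
        using L R by (simp add: R_def powr_add powr_realpow[symmetric] powr_powr mult.commute)
      also have "\<dots> = A powr (2 / w * (1 + 3 * ((p - 1) / 2)))"
        using A by (simp add: L_def w_def powr_powr)
      also have "2 / w * (1 + 3 * ((p - 1) / 2)) = 1 / r"
        using w by (simp add: r_def w_def field_simps)
      finally have 1: "L * R ^ 3 = A powr (1 / r)" .
      have "A / R\<^sup>2 = A powr 1 / A powr (2 / w * (p - 1))"
        using A R2 by (simp add: L_def w_def powr_powr)
      also have "\<dots> = A powr (1 - 2 / w * (p - 1))" by (simp add: powr_diff)
      also have "1 - 2 / w * (p - 1) = 1 / r"
        using w by (simp add: r_def w_def field_simps)
      finally show ?thesis using 1 by (simp add: algebra_simps)
    qed
    finally show ?thesis by (simp add: A_def)
  qed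
qed

lemma good_density_density:
  assumes f: "f \<in> energy_space j"
  shows "good_density r (density f)"
  unfolding good_density_def
proof (intro conjI allI)
  note E = energy_spaceD[OF f]
  show "density f \<in> borel_measurable borel" by (rule density_measurable[OF E(1)])
  show "0 \<le> density f x" for x by (rule density_nonneg[OF f])
  show "integrable lborel (density f)" by (rule density_integrable[OF E(3)])
  define F where "F z = f z powr p + (norm (snd z))\<^sup>2 * f z" for z
  have [measurable]: "f \<in> borel_measurable borel" by (rule E(1))
  have "integrable lborel (\<lambda>z. f z powr p)"
  proof (rule Bochner_Integration.integrable_bound)
    show "integrable lborel (\<lambda>z. f z + j (f z) / j 1)" using E by auto
    show "AE z in lborel. norm (f z powr p) \<le> norm (f z + j (f z) / j 1)"
      using order_trans[OF powr_le_j[OF E(2)] abs_ge_self] by (intro AE_I2) simp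
  qed simp
  then have F: "integrable lborel F" unfolding F_def using E(5) by auto
  define A where "A x = (LINT v|lborel. F (x, v))" for x
  have A: "integrable lborel A"
    using lborel_pair.integrable_fst'[of F] F unfolding A_def lborel_prod by simp
  have ae: "AE x in lborel. integrable lborel (\<lambda>v. F (x, v))" "AE x in lborel. integrable lborel (\<lambda>v. f (x, v))"
    using lborel_pair.AE_integrable_fst'[of F] lborel_pair.AE_integrable_fst'[of f] F E(3) unfolding lborel_prod by auto
  have bd: "AE x in lborel. density f x powr r \<le> (unit_ball_vol 3 + 2) powr r * A x"
    using ae
  proof eventually_elim
    case (elim x)
    have "density f x \<le> (unit_ball_vol 3 + 2) * A x powr (1 / r)"
      unfolding density_def A_def
      by (rule density_bound) (use elim E(2) in \<open>auto simp: F_def\<close>)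
    then have "density f x powr r \<le> ((unit_ball_vol 3 + 2) * A x powr (1 / r)) powr r"
      using density_nonneg[OF f] r_bounds by (intro powr_mono2) auto
    also have "A x \<ge> 0" unfolding A_def F_def using E(2) by (intro integral_nonneg_AE) auto
    then have "((unit_ball_vol 3 + 2) * A x powr (1 / r)) powr r = (unit_ball_vol 3 + 2) powr r * A x"
      using r_bounds by (simp add: powr_mult powr_powr)
    finally show ?case .
  qed
  show "integrable lborel (\<lambda>x. density f x powr r)"
  proof (rule Bochner_Integration.integrable_bound)
    show "integrable lborel (\<lambda>x. (unit_ball_vol 3 + 2) powr r * A x)" using A by simp
    show "(\<lambda>x. density f x powr r) \<in> borel_measurable lborel"
      using density_measurable[OF E(1)] by simp
    show "AE x in lborel. norm (density f x powr r) \<le> norm ((unit_ball_vol 3 + 2) powr r * A x)"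
      using bd by eventually_elim (auto intro: order_trans)
  qed
qed

end

section \<open>The interaction energy\<close>

lemma AE_lborel_fst:
  fixes P :: "'a::euclidean_space \<Rightarrow> bool"
  assumes "AE x in lborel. P x"
  shows "AE z in (lborel :: ('a \<times> 'b::euclidean_space) measure). P (fst z)"
proof -
  obtain N where N: "{x. \<not> P x} \<subseteq> N" "emeasure lborel N = 0" "N \<in> sets lborel"
    using AE_E[OF assms] by auto
  have "emeasure (lborel \<Otimes>\<^sub>M lborel) (N \<times> (UNIV :: 'b set)) = emeasure lborel N * emeasure lborel (UNIV :: 'b set)"
    by (rule lborel.emeasure_pair_measure_Times) (use N in auto)
  then have "emeasure lborel (N \<times> (UNIV :: 'b set)) = 0"
    using N(2) by (simp add: lborel_prod)
  moreover have "N \<times> (UNIV :: 'b set) \<in> sets lborel"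
  proof -
    have "N \<times> (UNIV :: 'b set) \<in> sets (lborel \<Otimes>\<^sub>M lborel)"
      using N(3) by (intro pair_measureI) auto
    then show ?thesis unfolding lborel_prod .
  qed
  ultimately show ?thesis
    by (intro AE_I[where N="N \<times> UNIV"]) (use N(1) in auto)
qed

lemma AE_lborel_snd:
  fixes P :: "'a::euclidean_space \<Rightarrow> bool"
  assumes "AE x in lborel. P x"
  shows "AE z in (lborel :: ('a \<times> 'a) measure). P (snd z)"
  using scales_AE[OF scales_swap AE_lborel_fst[OF assms]] by simp

lemma AE_lborel_pairI:
  fixes P :: "'a::euclidean_space \<Rightarrow> 'b::euclidean_space \<Rightarrow> bool"
  assumes "{z. P (fst z) (snd z)} \<in> sets borel" "\<And>x. AE y in lborel. P x y"
  shows "AE z in lborel. P (fst z) (snd z)"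
proof -
  have "AE z in lborel \<Otimes>\<^sub>M lborel. P (fst z) (snd z)"
  proof (rule lborel_pair.AE_pair_measure)
    show "{z \<in> space (lborel \<Otimes>\<^sub>M lborel). P (fst z) (snd z)} \<in> sets (lborel \<Otimes>\<^sub>M lborel)"
      unfolding lborel_prod using assms(1) by simp
  qed (use assms(2) in simp)
  from this[unfolded lborel_prod] show ?thesis .
qed

lemma AE_fst_neq_snd: "AE z in (lborel :: ('a::euclidean_space \<times> 'a) measure). fst z \<noteq> snd z"
proof -
  have "AE y in lborel. x \<noteq> y" for x :: 'a
    using AE_lborel_singleton[of x] by (auto elim: eventually_mono)
  moreover have "{z :: 'a \<times> 'a. fst z \<noteq> snd z} \<in> sets borel"
    by (intro borel_open open_Collect_neq continuous_intros)
  ultimately show ?thesis by (intro AE_lborel_pairI)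
qed

text \<open>The positive kernel of \<open>- phi\<close>. On the diagonal division by zero gives 0,
  so kernel comparisons are made for distinct points and the diagonal is discarded as a null
  set.\<close>

definition ker :: "real \<Rightarrow> real \<Rightarrow> R3 \<Rightarrow> R3 \<Rightarrow> real" where
  "ker \<delta> \<kappa> x y = \<delta> / (4 * pi * norm (x - y)) + \<kappa> / (2 * pi\<^sup>2 * (norm (x - y))\<^sup>2)"

lemma ker_measurable [measurable (raw)]:
  assumes [measurable]: "f \<in> borel_measurable M" "g \<in> borel_measurable M"
  shows "(\<lambda>z. ker \<delta> \<kappa> (f z) (g z)) \<in> borel_measurable M"
  unfolding ker_def by measurable

lemma ker_nonneg: "\<delta> \<ge> 0 \<Longrightarrow> \<kappa> \<ge> 0 \<Longrightarrow> ker \<delta> \<kappa> x y \<ge> 0"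
  by (simp add: ker_def)

lemma ker_sym: "ker \<delta> \<kappa> x y = ker \<delta> \<kappa> y x"
  by (simp add: ker_def norm_minus_commute)

lemma ker_cong: "norm (x - y) = norm (x' - y') \<Longrightarrow> ker \<delta> \<kappa> x y = ker \<delta> \<kappa> x' y'"
  by (simp add: ker_def)

lemma ker_pos: "\<delta> \<ge> 0 \<Longrightarrow> \<kappa> \<ge> 0 \<Longrightarrow> \<delta> + \<kappa> > 0 \<Longrightarrow> x \<noteq> y \<Longrightarrow> ker \<delta> \<kappa> x y > 0"
  by (cases "\<delta> = 0") (auto simp: ker_def intro!: add_pos_nonneg)

lemma ker_strict:
  assumes "\<delta> \<ge> 0" "\<kappa> \<ge> 0" "\<delta> + \<kappa> > 0" "0 < norm (x - y)" "norm (x - y) < norm (x' - y')"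
  shows "ker \<delta> \<kappa> x' y' < ker \<delta> \<kappa> x y"
proof -
  define a b where "a = norm (x - y)" and "b = norm (x' - y')"
  have ab: "0 < a" "a < b" using assms by (auto simp: a_def b_def)
  have 1: "4 * pi * a < 4 * pi * b" "0 < 4 * pi * a" using ab by auto
  have 2: "2 * pi\<^sup>2 * a\<^sup>2 < 2 * pi\<^sup>2 * b\<^sup>2" "0 < 2 * pi\<^sup>2 * a\<^sup>2"
    using ab by (auto intro!: power_strict_mono)
  have pp: "0 < (4 * pi * b) * (4 * pi * a)" "0 < (2 * pi\<^sup>2 * b\<^sup>2) * (2 * pi\<^sup>2 * a\<^sup>2)"
    using mult_pos_pos[OF less_trans[OF 1(2) 1(1)] 1(2)] mult_pos_pos[OF less_trans[OF 2(2) 2(1)] 2(2)] .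
  have le: "\<delta> / (4 * pi * b) \<le> \<delta> / (4 * pi * a)"
    using divide_left_mono[OF less_imp_le[OF 1(1)] assms(1) pp(1)] .
  have le': "\<kappa> / (2 * pi\<^sup>2 * b\<^sup>2) \<le> \<kappa> / (2 * pi\<^sup>2 * a\<^sup>2)"
    using divide_left_mono[OF less_imp_le[OF 2(1)] assms(2) pp(2)] .
  show ?thesis
  proof (cases "\<delta> = 0")
    case True
    then have "\<kappa> / (2 * pi\<^sup>2 * b\<^sup>2) < \<kappa> / (2 * pi\<^sup>2 * a\<^sup>2)"
      using divide_strict_left_mono[OF 2(1) _ pp(2), of \<kappa>] assms(3) True by simp
    then show ?thesis using le le' by (simp add: ker_def a_def b_def)
  next
    case False
    then have "\<delta> / (4 * pi * b) < \<delta> / (4 * pi * a)"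
      using divide_strict_left_mono[OF 1(1) _ pp(1), of \<delta>] assms(1) False by simp
    then show ?thesis using le le' by (simp add: ker_def a_def b_def)
  qed
qed

definition interact :: "real \<Rightarrow> real \<Rightarrow> (R3 \<Rightarrow> real) \<Rightarrow> (R3 \<Rightarrow> real) \<Rightarrow> real" where
  "interact \<delta> \<kappa> \<rho> \<sigma> = (LINT z|lborel. \<rho> (fst z) * \<sigma> (snd z) * ker \<delta> \<kappa> (fst z) (snd z))"

definition pot :: "real \<Rightarrow> real \<Rightarrow> (R3 \<Rightarrow> real) \<Rightarrow> R3 \<Rightarrow> real" where
  "pot \<delta> \<kappa> \<rho> x = (LINT y|lborel. \<rho> y * ker \<delta> \<kappa> x y)"

lemma good_product_integrable:
  assumes \<rho>: "good_density r \<rho>" and \<sigma>: "good_density r \<sigma>"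
  shows "integrable lborel (\<lambda>z. \<rho> (fst z) * \<sigma> (snd z))"
proof -
  note [measurable] = good_densityD(1)[OF \<rho>] good_densityD(1)[OF \<sigma>]
  note nn = good_densityD(2)[OF \<rho>] good_densityD(2)[OF \<sigma>]
  have "(\<integral>\<^sup>+z. ennreal (\<rho> (fst z) * \<sigma> (snd z)) \<partial>lborel) = (\<integral>\<^sup>+x. \<rho> x \<partial>lborel) * (\<integral>\<^sup>+x. \<sigma> x \<partial>lborel)"
    using nn_integral_product[of "\<lambda>x. ennreal (\<rho> x)" "\<lambda>x. ennreal (\<sigma> x)"] nn by (simp add: ennreal_mult)
  also have "\<dots> < \<infinity>"
    using integrable_nn_less_top[OF good_densityD(3)[OF \<rho>] nn(1)] integrable_nn_less_top[OF good_densityD(3)[OF \<sigma>] nn(2)]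
    by (simp add: ennreal_mult_less_top)
  finally show ?thesis by (intro integrableI_nonneg) (auto simp: nn)
qed

text \<open>Since 1/d \<le> 1 + 1/d^2, the Poisson kernel is dominated by a constant plus the Manev
  kernel, which is already treated.\<close>

lemma good_pair_integrable:
  assumes \<rho>: "good_density r \<rho>" and \<sigma>: "good_density r \<sigma>" and r: "3 / 2 < r" "r \<le> 2"
  shows "integrable lborel (\<lambda>z. \<rho> (fst z) * \<sigma> (snd z) * ker \<delta> \<kappa> (fst z) (snd z))"
proof -
  note [measurable] = good_densityD(1)[OF \<rho>] good_densityD(1)[OF \<sigma>]
  note nn = good_densityD(2)[OF \<rho>] good_densityD(2)[OF \<sigma>]
  define S where "S z = \<rho> (fst z) * \<sigma> (snd z) * (1 / (norm (fst z - snd z))\<^sup>2)" for z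
  have S: "integrable lborel S" unfolding S_def by (rule good_pair_integrable_sq[OF assms])
  have 1: "integrable lborel (\<lambda>z. \<rho> (fst z) * \<sigma> (snd z) * (1 / norm (fst z - snd z)))"
  proof (rule Bochner_Integration.integrable_bound)
    show "integrable lborel (\<lambda>z. \<rho> (fst z) * \<sigma> (snd z) + S z)"
      using S good_product_integrable[OF \<rho> \<sigma>] by simp
    have "\<rho> x * \<sigma> y * (1 / norm (x - y)) \<le> \<rho> x * \<sigma> y + \<rho> x * \<sigma> y * (1 / (norm (x - y))\<^sup>2)" for x y
    proof -
      have "2 * (1 / norm (x - y)) \<le> 1 + (1 / norm (x - y))\<^sup>2"
        using sum_squares_bound[of 1 "1 / norm (x - y)"] by simp
      moreover have "0 \<le> 1 / norm (x - y)" by simp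
      ultimately have "1 / norm (x - y) \<le> 1 + (1 / norm (x - y))\<^sup>2" by linarith
      then have "1 / norm (x - y) \<le> 1 + 1 / (norm (x - y))\<^sup>2" by (simp add: power_divide)
      then have "\<rho> x * \<sigma> y * (1 / norm (x - y)) \<le> \<rho> x * \<sigma> y * (1 + 1 / (norm (x - y))\<^sup>2)"
        using nn by (intro mult_left_mono) auto
      then show ?thesis by (simp add: algebra_simps)
    qed
    then show "AE z in lborel. norm (\<rho> (fst z) * \<sigma> (snd z) * (1 / norm (fst z - snd z))) \<le> norm (\<rho> (fst z) * \<sigma> (snd z) + S z)"
      using nn by (intro AE_I2) (auto simp: S_def)
  qed measurable
  have eq: "(\<lambda>z. \<rho> (fst z) * \<sigma> (snd z) * ker \<delta> \<kappa> (fst z) (snd z))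
     = (\<lambda>z. \<delta> / (4 * pi) * (\<rho> (fst z) * \<sigma> (snd z) * (1 / norm (fst z - snd z))) + \<kappa> / (2 * pi\<^sup>2) * S z)"
    unfolding ker_def S_def by (rule ext) (simp add: distrib_left mult_ac)
  show ?thesis unfolding eq by (intro Bochner_Integration.integrable_add integrable_mult_right 1 S)
qed

lemma interact_sym: "interact \<delta> \<kappa> \<rho> \<sigma> = interact \<delta> \<kappa> \<sigma> \<rho>"
  if [measurable]: "\<rho> \<in> borel_measurable borel" "\<sigma> \<in> borel_measurable borel"
proof -
  have "interact \<delta> \<kappa> \<rho> \<sigma> = (LINT z|lborel. \<rho> (snd z) * \<sigma> (fst z) * ker \<delta> \<kappa> (snd z) (fst z))"
    unfolding interact_def
    using scales_integral[OF scales_swap, of "\<lambda>z. \<rho> (fst z) * \<sigma> (snd z) * ker \<delta> \<kappa> (fst z) (snd z)"] by simp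
  also have "\<dots> = interact \<delta> \<kappa> \<sigma> \<rho>"
    unfolding interact_def by (simp add: ker_sym[of _ _ "snd _"] mult.commute)
  finally show ?thesis .
qed

lemma interact_AE_cong:
  assumes "AE x in lborel. \<rho> x = \<rho>' x" "AE x in lborel. \<sigma> x = \<sigma>' x"
    and [measurable]: "\<rho> \<in> borel_measurable borel" "\<sigma> \<in> borel_measurable borel"
       "\<rho>' \<in> borel_measurable borel" "\<sigma>' \<in> borel_measurable borel"
  shows "interact \<delta> \<kappa> \<rho> \<sigma> = interact \<delta> \<kappa> \<rho>' \<sigma>'"
  unfolding interact_def
proof (rule integral_cong_AE)
  show "AE z in lborel. \<rho> (fst z) * \<sigma> (snd z) * ker \<delta> \<kappa> (fst z) (snd z) = \<rho>' (fst z) * \<sigma>' (snd z) * ker \<delta> \<kappa> (fst z) (snd z)"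
    using AE_lborel_fst[OF assms(1)] AE_lborel_snd[OF assms(2)] by eventually_elim simp
qed measurable

lemma interact_nonneg:
  "\<delta> \<ge> 0 \<Longrightarrow> \<kappa> \<ge> 0 \<Longrightarrow> (\<And>x. \<rho> x \<ge> 0) \<Longrightarrow> (\<And>x. \<sigma> x \<ge> 0) \<Longrightarrow> interact \<delta> \<kappa> \<rho> \<sigma> \<ge> 0"
  unfolding interact_def by (intro integral_nonneg_AE AE_I2 mult_nonneg_nonneg ker_nonneg) auto

lemma interact_pos:
  assumes \<rho>: "good_density r \<rho>" and r: "3 / 2 < r" "r \<le> 2"
    and d: "\<delta> \<ge> 0" "\<kappa> \<ge> 0" "\<delta> + \<kappa> > 0" and pos: "(LINT x|lborel. \<rho> x) > 0"
  shows "interact \<delta> \<kappa> \<rho> \<rho> > 0"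
proof (rule ccontr)
  note nn = good_densityD(2)[OF \<rho>]
  note [measurable] = good_densityD(1)[OF \<rho>]
  assume "\<not> ?thesis"
  then have "interact \<delta> \<kappa> \<rho> \<rho> = 0" using interact_nonneg[of \<delta> \<kappa> \<rho> \<rho>] d nn by simp
  then have "AE z in lborel. \<rho> (fst z) * \<rho> (snd z) * ker \<delta> \<kappa> (fst z) (snd z) = 0"
    unfolding interact_def
    by (subst (asm) integral_nonneg_eq_0_iff_AE) (use good_pair_integrable[OF \<rho> \<rho> r] ker_nonneg d nn in auto)
  then have "AE z in lborel. \<rho> (fst z) * \<rho> (snd z) = 0"
    using AE_fst_neq_snd
  proof eventually_elim
    case (elim z)
    then show ?case using ker_pos[OF d, of "fst z" "snd z"] by auto
  qed
  then have "(\<integral>\<^sup>+z. ennreal (\<rho> (fst z)) * ennreal (\<rho> (snd z)) \<partial>lborel) = 0"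
    by (subst nn_integral_0_iff_AE) (auto simp: ennreal_mult[symmetric] nn elim: eventually_mono)
  then have "(\<integral>\<^sup>+x. ennreal (\<rho> x) \<partial>lborel) = 0"
    using nn_integral_product[of "\<lambda>x. ennreal (\<rho> x)" "\<lambda>x. ennreal (\<rho> x)"] by simp
  then have "(LINT x|lborel. \<rho> x) = 0"
    using nn by (simp add: integral_eq_nn_integral)
  then show False using pos by simp
qed

lemma interact_lincomb:
  assumes \<rho>: "good_density r \<rho>" and \<sigma>: "good_density r \<sigma>" and r: "3 / 2 < r" "r \<le> 2"
  shows "interact \<delta> \<kappa> (\<lambda>x. (1 - t) * \<rho> x + t * \<sigma> x) (\<lambda>x. (1 - t) * \<rho> x + t * \<sigma> x)
     = (1 - t)\<^sup>2 * interact \<delta> \<kappa> \<rho> \<rho> + 2 * t * (1 - t) * interact \<delta> \<kappa> \<rho> \<sigma> + t\<^sup>2 * interact \<delta> \<kappa> \<sigma> \<sigma>"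
proof -
  note i = good_pair_integrable[OF \<rho> \<rho> r, of \<delta> \<kappa>] good_pair_integrable[OF \<rho> \<sigma> r, of \<delta> \<kappa>]
    good_pair_integrable[OF \<sigma> \<rho> r, of \<delta> \<kappa>] good_pair_integrable[OF \<sigma> \<sigma> r, of \<delta> \<kappa>]
  have "interact \<delta> \<kappa> (\<lambda>x. (1 - t) * \<rho> x + t * \<sigma> x) (\<lambda>x. (1 - t) * \<rho> x + t * \<sigma> x)
     = (LINT z|lborel. (1 - t)\<^sup>2 * (\<rho> (fst z) * \<rho> (snd z) * ker \<delta> \<kappa> (fst z) (snd z))
        + (t * (1 - t)) * (\<rho> (fst z) * \<sigma> (snd z) * ker \<delta> \<kappa> (fst z) (snd z))
        + (t * (1 - t)) * (\<sigma> (fst z) * \<rho> (snd z) * ker \<delta> \<kappa> (fst z) (snd z))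
        + t\<^sup>2 * (\<sigma> (fst z) * \<sigma> (snd z) * ker \<delta> \<kappa> (fst z) (snd z)))"
    unfolding interact_def by (intro Bochner_Integration.integral_cong) (auto simp: power2_eq_square algebra_simps)
  also have "\<dots> = (1 - t)\<^sup>2 * interact \<delta> \<kappa> \<rho> \<rho> + (t * (1 - t)) * interact \<delta> \<kappa> \<rho> \<sigma>
     + (t * (1 - t)) * interact \<delta> \<kappa> \<sigma> \<rho> + t\<^sup>2 * interact \<delta> \<kappa> \<sigma> \<sigma>"
    unfolding interact_def using i by simp
  finally show ?thesis
    using interact_sym[OF good_densityD(1)[OF \<rho>] good_densityD(1)[OF \<sigma>]] by simp
qed

lemma interact_split:
  assumes \<rho>: "good_density r \<rho>" and \<sigma>: "good_density r \<sigma>" and r: "3 / 2 < r" "r \<le> 2"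
  shows "interact \<delta> \<kappa> \<rho> \<sigma> = \<delta> * interact 1 0 \<rho> \<sigma> + \<kappa> * interact 0 1 \<rho> \<sigma>"
proof -
  have "interact \<delta> \<kappa> \<rho> \<sigma> = (LINT z|lborel. \<delta> * (\<rho> (fst z) * \<sigma> (snd z) * ker 1 0 (fst z) (snd z))
     + \<kappa> * (\<rho> (fst z) * \<sigma> (snd z) * ker 0 1 (fst z) (snd z)))"
    unfolding interact_def by (intro Bochner_Integration.integral_cong) (auto simp: ker_def algebra_simps add_divide_distrib)
  then show ?thesis
    unfolding interact_def using good_pair_integrable[OF assms] by simp
qed

lemma interact_pot:
  assumes \<rho>: "good_density r \<rho>" and \<sigma>: "good_density r \<sigma>" and r: "3 / 2 < r" "r \<le> 2"
  shows "interact \<delta> \<kappa> \<rho> \<sigma> = (LINT x|lborel. \<rho> x * pot \<delta> \<kappa> \<sigma> x)"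
    and "integrable lborel (\<lambda>x. \<rho> x * pot \<delta> \<kappa> \<sigma> x)"
proof -
  have i: "integrable (lborel \<Otimes>\<^sub>M lborel) (\<lambda>z. \<rho> (fst z) * \<sigma> (snd z) * ker \<delta> \<kappa> (fst z) (snd z))"
    using good_pair_integrable[OF assms] by (simp add: lborel_prod)
  have eq: "(LINT y|lborel. \<rho> x * \<sigma> y * ker \<delta> \<kappa> x y) = \<rho> x * pot \<delta> \<kappa> \<sigma> x" for x
    unfolding pot_def by (simp add: mult.assoc)
  show "interact \<delta> \<kappa> \<rho> \<sigma> = (LINT x|lborel. \<rho> x * pot \<delta> \<kappa> \<sigma> x)"
    using lborel_pair.integral_fst'[OF i] unfolding interact_def lborel_prod by (simp add: eq)
  show "integrable lborel (\<lambda>x. \<rho> x * pot \<delta> \<kappa> \<sigma> x)"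
    using lborel_pair.integrable_fst'[OF i] by (simp add: eq)
qed

text \<open>\<open>pot\<close> returns 0 where its integral diverges, which would spoil pointwise
  comparisons. This version keeps the value infinity, so inequalities are proved for it and
  transferred to \<open>pot\<close> where it is finite.\<close>

definition upot :: "real \<Rightarrow> real \<Rightarrow> (R3 \<Rightarrow> real) \<Rightarrow> R3 \<Rightarrow> ennreal" where
  "upot \<delta> \<kappa> \<rho> x = (\<integral>\<^sup>+y. ennreal (\<rho> y * ker \<delta> \<kappa> x y) \<partial>lborel)"

lemma pot_measurable [measurable]:
  assumes [measurable]: "\<rho> \<in> borel_measurable borel"
  shows "pot \<delta> \<kappa> \<rho> \<in> borel_measurable borel"
  unfolding pot_def[abs_def] by measurable

lemma pot_nonneg:
  "\<delta> \<ge> 0 \<Longrightarrow> \<kappa> \<ge> 0 \<Longrightarrow> (\<And>x. \<rho> x \<ge> 0) \<Longrightarrow> pot \<delta> \<kappa> \<rho> x \<ge> 0"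
  unfolding pot_def by (intro integral_nonneg_AE AE_I2 mult_nonneg_nonneg ker_nonneg) auto

lemma pot_eq_upot:
  assumes "\<delta> \<ge> 0" "\<kappa> \<ge> 0" "\<And>x. \<rho> x \<ge> 0" and [measurable]: "\<rho> \<in> borel_measurable borel"
  shows "pot \<delta> \<kappa> \<rho> x = enn2real (upot \<delta> \<kappa> \<rho> x)"
  unfolding pot_def upot_def using assms by (intro integral_eq_nn_integral) (auto simp: ker_nonneg)

text \<open>The indicator of a ball is itself a good density, so its interaction with
  \<open>\<rho>\<close> is finite; Fubini makes the potential finite almost everywhere in that
  ball.\<close>

lemma upot_finite_AE:
  assumes \<rho>: "good_density r \<rho>" and r: "3 / 2 < r" "r \<le> 2" and d: "\<delta> \<ge> 0" "\<kappa> \<ge> 0"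
  shows "AE x in lborel. upot \<delta> \<kappa> \<rho> x < \<infinity>"
proof -
  note nn = good_densityD(2)[OF \<rho>]
  note [measurable] = good_densityD(1)[OF \<rho>]
  have "AE x in lborel. x \<in> ball 0 (real n) \<longrightarrow> upot \<delta> \<kappa> \<rho> x < \<infinity>" for n
  proof -
    have i: "integrable lborel (indicator (ball (0::R3) (real n)) :: R3 \<Rightarrow> real)"
      by (rule integrable_real_indicator) (auto simp: emeasure_ball)
    have "(\<lambda>x::R3. (indicator (ball 0 (real n)) x :: real) powr r) = indicator (ball 0 (real n))"
      by (auto simp: indicator_def)
    then have g: "good_density r (indicator (ball (0::R3) (real n)))"
      using i by (simp add: good_density_def)
    have "integrable (lborel \<Otimes>\<^sub>M lborel) (\<lambda>z. indicator (ball 0 (real n)) (fst z) * \<rho> (snd z) * ker \<delta> \<kappa> (fst z) (snd z))"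
      using good_pair_integrable[OF g \<rho> r] by (simp add: lborel_prod)
    from lborel_pair.AE_integrable_fst'[OF this]
    show ?thesis
    proof eventually_elim
      case (elim x)
      show ?case
      proof
        assume "x \<in> ball 0 (real n)"
        then have "integrable lborel (\<lambda>y. \<rho> y * ker \<delta> \<kappa> x y)" using elim by simp
        then show "upot \<delta> \<kappa> \<rho> x < \<infinity>"
          unfolding upot_def by (rule integrable_nn_less_top) (simp add: nn ker_nonneg d)
      qed
    qed
  qed
  then have "AE x in lborel. \<forall>n. x \<in> ball 0 (real n) \<longrightarrow> upot \<delta> \<kappa> \<rho> x < \<infinity>"
    by (subst AE_all_countable) blast
  then show ?thesis
  proof eventually_elim
    case (elim x)
    obtain n where "norm x < real n" using reals_Archimedean2 by blast
    then show ?case using elim by auto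
  qed
qed

section \<open>Energies expressed through the interaction form\<close>

context casimir begin

lemma L1norm_eq: "f \<in> energy_space j \<Longrightarrow> L1norm f = (LINT z|lborel. f z)"
  and L1norm_j_eq: "f \<in> energy_space j \<Longrightarrow> L1norm (\<lambda>z. j (f z)) = (LINT z|lborel. j (f z))"
  and kinetic_eq: "f \<in> energy_space j \<Longrightarrow> kinetic f = (LINT z|lborel. (norm (snd z))\<^sup>2 * f z)"
  by (simp_all add: L1norm_def kinetic_def energy_spaceD(2)[of f] j_nonneg case_prod_beta abs_mult)

lemma mass_density:
  "f \<in> energy_space j \<Longrightarrow> (LINT x|lborel. density f x) = (LINT z|lborel. f z)"
  using lborel_pair.integral_fst'[of f] energy_spaceD(3)[of f]
  unfolding density_def lborel_prod by simp

lemma Epot_eq: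
  assumes f: "f \<in> energy_space j"
  shows "EpotP f = interact 1 0 (density f) (density f)"
    and "EpotM f = interact 0 1 (density f) (density f)"
    and "Epot \<delta> \<kappa> f = interact \<delta> \<kappa> (density f) (density f)"
proof -
  note g = good_density_density[OF f]
  have "phiP f x = - pot 1 0 (density f) x" "phiM f x = - pot 0 1 (density f) x" for x
    by (simp_all add: phiP_def phiM_def pot_def ker_def)
  then show 1: "EpotP f = interact 1 0 (density f) (density f)"
    "EpotM f = interact 0 1 (density f) (density f)"
    by (simp_all add: EpotP_def EpotM_def interact_pot(1)[OF g g r_bounds] mult.commute)
  then show "Epot \<delta> \<kappa> f = interact \<delta> \<kappa> (density f) (density f)"
    by (simp add: Epot_def interact_split[OF g g r_bounds, of \<delta> \<kappa>])
qed

text \<open>Moving the potential inside a phase space integral makes the linearized energy an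
  integral of a pointwise expression in \<open>f z\<close>, which is what the pointwise minimization
  works with.\<close>

lemma interact_phase:
  assumes f: "f \<in> energy_space j" and \<sigma>: "good_density r \<sigma>" and d: "\<delta> \<ge> 0" "\<kappa> \<ge> 0"
  shows "integrable lborel (\<lambda>z. pot \<delta> \<kappa> \<sigma> (fst z) * f z)"
    and "(LINT z|lborel. pot \<delta> \<kappa> \<sigma> (fst z) * f z) = interact \<delta> \<kappa> (density f) \<sigma>"
proof -
  note g = good_density_density[OF f]
  note E = energy_spaceD[OF f]
  note [measurable] = E(1) good_densityD(1)[OF \<sigma>]
  have pn: "pot \<delta> \<kappa> \<sigma> x \<ge> 0" for x using pot_nonneg[OF d] good_densityD(2)[OF \<sigma>] by blast
  have ae: "AE x in lborel. integrable lborel (\<lambda>v. f (x, v))"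
    using lborel_pair.AE_integrable_fst'[of f] E(3) unfolding lborel_prod by auto
  have [measurable]: "f \<in> borel_measurable (borel \<Otimes>\<^sub>M borel)" by (simp add: borel_prod)
  have "(\<integral>\<^sup>+z. ennreal (pot \<delta> \<kappa> \<sigma> (fst z) * f z) \<partial>lborel) = (\<integral>\<^sup>+x. \<integral>\<^sup>+v. ennreal (pot \<delta> \<kappa> \<sigma> x * f (x, v)) \<partial>lborel \<partial>lborel)"
    by (subst lborel_prod[symmetric], subst lborel.nn_integral_fst[symmetric]) auto
  also have "\<dots> = (\<integral>\<^sup>+x. ennreal (density f x * pot \<delta> \<kappa> \<sigma> x) \<partial>lborel)"
  proof (rule nn_integral_cong_AE)
    show "AE x in lborel. (\<integral>\<^sup>+v. ennreal (pot \<delta> \<kappa> \<sigma> x * f (x, v)) \<partial>lborel) = ennreal (density f x * pot \<delta> \<kappa> \<sigma> x)"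
      using ae
    proof eventually_elim
      case (elim x)
      have "(\<integral>\<^sup>+v. ennreal (pot \<delta> \<kappa> \<sigma> x * f (x, v)) \<partial>lborel) = ennreal (LINT v|lborel. pot \<delta> \<kappa> \<sigma> x * f (x, v))"
        using elim pn E(2) by (intro nn_integral_eq_integral) auto
      then show ?case by (simp add: density_def mult.commute)
    qed
  qed
  also have "\<dots> < \<infinity>"
    by (rule integrable_nn_less_top[OF interact_pot(2)[OF g \<sigma> r_bounds]]) (simp add: pn density_nonneg[OF f])
  finally show i: "integrable lborel (\<lambda>z. pot \<delta> \<kappa> \<sigma> (fst z) * f z)"
    by (intro integrableI_nonneg) (auto simp: pn E(2))
  have "(LINT z|lborel. pot \<delta> \<kappa> \<sigma> (fst z) * f z) = (LINT x|lborel. LINT v|lborel. pot \<delta> \<kappa> \<sigma> x * f (x, v))"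
    using lborel_pair.integral_fst'[of "\<lambda>z. pot \<delta> \<kappa> \<sigma> (fst z) * f z"] i unfolding lborel_prod by simp
  also have "\<dots> = (LINT x|lborel. density f x * pot \<delta> \<kappa> \<sigma> x)"
    by (simp add: density_def mult.commute)
  also have "\<dots> = interact \<delta> \<kappa> (density f) \<sigma>"
    by (rule interact_pot(1)[OF g \<sigma> r_bounds, symmetric])
  finally show "(LINT z|lborel. pot \<delta> \<kappa> \<sigma> (fst z) * f z) = interact \<delta> \<kappa> (density f) \<sigma>" .
qed

end

section \<open>Scalings and the relaxed constraint\<close>

context casimir begin

lemma energy_spaceI:
  assumes "f \<in> borel_measurable borel" "\<And>z. f z \<ge> 0" "integrable lborel f" "integrable lborel (\<lambda>z. j (f z))"
    "integrable lborel (\<lambda>z. (norm (snd z))\<^sup>2 * f z)"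
  shows "f \<in> energy_space j"
proof -
  have "(\<lambda>(x, v). (norm v)\<^sup>2 * f (x, v)) = (\<lambda>z. (norm (snd z))\<^sup>2 * f z)" by auto
  with assms show ?thesis unfolding energy_space_def mem_Collect_eq by metis
qed

lemma j_mult_le: "0 \<le> a \<Longrightarrow> 0 \<le> t \<Longrightarrow> j (a * t) \<le> max 1 (a powr q) * j t"
proof (cases "a \<ge> 1")
  case True
  assume "0 \<le> t"
  have "a powr 0 \<le> a powr q" using True q_gt by (intro powr_mono) auto
  then show ?thesis using j_growth(2)[OF True \<open>0 \<le> t\<close>] True by simp
next
  case False
  assume a: "0 \<le> a" and t: "0 \<le> t"
  have "j (a * t) \<le> a * j t" using j_convex[of 0 t a] a t False by simp
  also have "\<dots> \<le> 1 * j t" using False j_nonneg[OF t] by (intro mult_right_mono) auto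
  also have "\<dots> \<le> max 1 (a powr q) * j t" using j_nonneg[OF t] by (intro mult_right_mono) auto
  finally show ?thesis .
qed

lemma integrable_j_mult:
  assumes "f \<in> energy_space j" "0 \<le> a"
  shows "integrable lborel (\<lambda>z. j (a * f z))"
proof (rule Bochner_Integration.integrable_bound)
  note E = energy_spaceD[OF assms(1)]
  show "integrable lborel (\<lambda>z. max 1 (a powr q) * j (f z))" using E(4) by simp
  show "(\<lambda>z. j (a * f z)) \<in> borel_measurable lborel"
    using E(1,2) assms(2) by (intro j_comp_measurable) auto
  show "AE z in lborel. norm (j (a * f z)) \<le> norm (max 1 (a powr q) * j (f z))"
    using order_trans[OF j_mult_le[OF assms(2) E(2)] abs_ge_self] j_nonneg[OF mult_nonneg_nonneg[OF assms(2) E(2)]]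
    by (intro AE_I2) simp
qed

text \<open>Two instances matter: spatial concentration with \<open>c ^ 3 = \<alpha>\<close> and
  \<open>d = 1\<close>, which relaxes the Casimir constraint, and the measure preserving exchange of
  scales with \<open>\<alpha> = 1\<close> and \<open>c * d = 1\<close>, which normalizes
  multipliers.\<close>

definition rescale :: "real \<Rightarrow> R3 \<Rightarrow> real \<Rightarrow> real \<Rightarrow> (phase \<Rightarrow> real) \<Rightarrow> phase \<Rightarrow> real" where
  "rescale \<alpha> a c d f z = \<alpha> * f (a + c *\<^sub>R fst z, d *\<^sub>R snd z)"

lemma rescale_facts:
  assumes f: "f \<in> energy_space j" and pos: "\<alpha> > 0" "c > 0" "d > 0"
  shows "rescale \<alpha> a c d f \<in> energy_space j"
    and "(LINT z|lborel. rescale \<alpha> a c d f z) = \<alpha> / (c ^ 3 * d ^ 3) * (LINT z|lborel. f z)"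
    and "(LINT z|lborel. j (rescale \<alpha> a c d f z)) = (LINT z|lborel. j (\<alpha> * f z)) / (c ^ 3 * d ^ 3)"
    and "kinetic (rescale \<alpha> a c d f) = \<alpha> / (c ^ 3 * d ^ 5) * kinetic f"
proof -
  note E = energy_spaceD[OF f]
  define k where "k = c ^ 3 * d ^ 3"
  have k: "k > 0" using pos by (simp add: k_def)
  have S: "scales_lborel (\<lambda>z::phase. (a + c *\<^sub>R fst z, d *\<^sub>R snd z)) k"
    unfolding k_def by (rule scales_phase_affine[OF pos(2,3)])
  have [measurable]: "f \<in> borel_measurable borel" by (rule E(1))
  have [measurable]: "(\<lambda>z::phase. (a + c *\<^sub>R fst z, d *\<^sub>R snd z)) \<in> borel_measurable borel"
    using S by (rule scales_measurable)
  have i: "integrable lborel (rescale \<alpha> a c d f)"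
    using scales_integrable_iff[OF S, of "\<lambda>z. \<alpha> * f z"] E(3) by (simp add: rescale_def[abs_def])
  have jm: "(\<lambda>z. j (\<alpha> * f z)) \<in> borel_measurable borel"
    using E(2) pos by (intro j_comp_measurable) auto
  have ij: "integrable lborel (\<lambda>z. j (rescale \<alpha> a c d f z))"
    using scales_integrable_iff[OF S jm] integrable_j_mult[OF f, of \<alpha>] pos by (simp add: rescale_def[abs_def])
  have nd: "(norm (d *\<^sub>R v))\<^sup>2 = d\<^sup>2 * (norm v)\<^sup>2" for v :: R3
    using pos by (simp add: power_mult_distrib)
  have kin: "(\<lambda>z. (norm (snd z))\<^sup>2 * rescale \<alpha> a c d f z)
     = (\<lambda>z. (\<lambda>z. \<alpha> / d\<^sup>2 * ((norm (snd z))\<^sup>2 * f z)) (a + c *\<^sub>R fst z, d *\<^sub>R snd z))"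
    using pos by (auto simp: fun_eq_iff rescale_def power_mult_distrib)
  have ik: "integrable lborel (\<lambda>z. (norm (snd z))\<^sup>2 * rescale \<alpha> a c d f z)"
    unfolding kin by (subst scales_integrable_iff[OF S]) (use E(5) in auto)
  show e: "rescale \<alpha> a c d f \<in> energy_space j"
    by (rule energy_spaceI[OF _ _ i ij ik]) (use E(2) pos in \<open>auto simp: rescale_def[abs_def]\<close>)
  show "(LINT z|lborel. rescale \<alpha> a c d f z) = \<alpha> / (c ^ 3 * d ^ 3) * (LINT z|lborel. f z)"
  proof -
    have "(LINT z|lborel. f z) = k * (LINT z|lborel. f (a + c *\<^sub>R fst z, d *\<^sub>R snd z))"
      by (rule scales_integral[OF S]) simp
    then show ?thesis unfolding k_def[symmetric] rescale_def using k by simp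
  qed
  show "(LINT z|lborel. j (rescale \<alpha> a c d f z)) = (LINT z|lborel. j (\<alpha> * f z)) / (c ^ 3 * d ^ 3)"
    using scales_integral[OF S jm] k unfolding k_def[symmetric] rescale_def by simp
  have "(LINT z|lborel. (norm (snd z))\<^sup>2 * rescale \<alpha> a c d f z) = (LINT z|lborel. \<alpha> / d\<^sup>2 * ((norm (snd z))\<^sup>2 * f z)) / k"
    unfolding kin using k
    by (subst scales_integral[OF S, of "\<lambda>z. \<alpha> / d\<^sup>2 * ((norm (snd z))\<^sup>2 * f z)"]) auto
  then show "kinetic (rescale \<alpha> a c d f) = \<alpha> / (c ^ 3 * d ^ 5) * kinetic f"
    by (simp add: kinetic_eq[OF e] kinetic_eq[OF f] k_def power_add[symmetric] field_simps)
qed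

lemma density_rescale:
  assumes [measurable]: "f \<in> borel_measurable borel" and "d > 0"
  shows "density (rescale \<alpha> a c d f) x = \<alpha> / d ^ 3 * density f (a + c *\<^sub>R x)"
proof -
  have [measurable]: "f \<in> borel_measurable (borel \<Otimes>\<^sub>M borel)" by (simp add: borel_prod)
  have "(LINT v|lborel. f (a + c *\<^sub>R x, v)) = d ^ 3 * (LINT v|lborel. f (a + c *\<^sub>R x, d *\<^sub>R v))"
    using scales_integral[OF scales_affine[OF \<open>d > 0\<close>, of "0::R3"], of "\<lambda>v. f (a + c *\<^sub>R x, v)"] by simp
  then show ?thesis using \<open>d > 0\<close> by (simp add: density_def rescale_def)
qed

text \<open>The map on pairs has Jacobian \<open>c ^ 6\<close>; the Poisson and Manev kernels are
  homogeneous of degrees -1 and -2, which leaves \<open>c ^ 5\<close> and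
  \<open>c ^ 4\<close>.\<close>

lemma interact_affine:
  fixes \<rho> :: "R3 \<Rightarrow> real"
  assumes [measurable]: "\<rho> \<in> borel_measurable borel" and "c > 0"
  shows "interact 1 0 (\<lambda>x. k * \<rho> (a + c *\<^sub>R x)) (\<lambda>x. k * \<rho> (a + c *\<^sub>R x)) = k\<^sup>2 / c ^ 5 * interact 1 0 \<rho> \<rho>"
    and "interact 0 1 (\<lambda>x. k * \<rho> (a + c *\<^sub>R x)) (\<lambda>x. k * \<rho> (a + c *\<^sub>R x)) = k\<^sup>2 / c ^ 4 * interact 0 1 \<rho> \<rho>"
proof -
  have S: "scales_lborel (\<lambda>z::R3 \<times> R3. (a + c *\<^sub>R fst z, a + c *\<^sub>R snd z)) (c ^ 6)"
    using scales_compose[OF scales_map_fst[OF scales_affine[OF assms(2), of a]]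
      scales_map_snd[OF scales_affine[OF assms(2), of a]]] by (simp add: power_add[symmetric])
  have n: "norm (a + c *\<^sub>R x - (a + c *\<^sub>R y)) = c * norm (x - y)" for x y :: R3
    using assms(2) by (simp add: scaleR_diff_right[symmetric])
  have main: "interact \<delta> \<kappa> (\<lambda>x. k * \<rho> (a + c *\<^sub>R x)) (\<lambda>x. k * \<rho> (a + c *\<^sub>R x)) = k\<^sup>2 * m / c ^ 6 * interact \<delta> \<kappa> \<rho> \<rho>"
    if m: "\<And>x y. ker \<delta> \<kappa> x y = m * ker \<delta> \<kappa> (a + c *\<^sub>R x) (a + c *\<^sub>R y)" for \<delta> \<kappa> m
  proof -
    have "interact \<delta> \<kappa> (\<lambda>x. k * \<rho> (a + c *\<^sub>R x)) (\<lambda>x. k * \<rho> (a + c *\<^sub>R x))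
       = (LINT z|lborel. (k\<^sup>2 * m) * (\<rho> (a + c *\<^sub>R fst z) * \<rho> (a + c *\<^sub>R snd z) * ker \<delta> \<kappa> (a + c *\<^sub>R fst z) (a + c *\<^sub>R snd z)))"
      unfolding interact_def
      by (rule Bochner_Integration.integral_cong) (auto simp: m[of "fst _"] power2_eq_square)
    also have "\<dots> = (k\<^sup>2 * m) * (interact \<delta> \<kappa> \<rho> \<rho> / c ^ 6)"
      using scales_integral[OF S, of "\<lambda>z. \<rho> (fst z) * \<rho> (snd z) * ker \<delta> \<kappa> (fst z) (snd z)"] assms(2)
      unfolding interact_def by simp
    finally show ?thesis by simp
  qed
  have "ker 1 0 x y = c * ker 1 0 (a + c *\<^sub>R x) (a + c *\<^sub>R y)" for x y
    unfolding ker_def n using assms(2) by simp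
  from main[OF this] show "interact 1 0 (\<lambda>x. k * \<rho> (a + c *\<^sub>R x)) (\<lambda>x. k * \<rho> (a + c *\<^sub>R x)) = k\<^sup>2 / c ^ 5 * interact 1 0 \<rho> \<rho>"
    using assms(2) by (simp add: eval_nat_numeral)
  have "ker 0 1 x y = c\<^sup>2 * ker 0 1 (a + c *\<^sub>R x) (a + c *\<^sub>R y)" for x y
    unfolding ker_def n using assms(2) by (simp add: power_mult_distrib)
  from main[OF this] show "interact 0 1 (\<lambda>x. k * \<rho> (a + c *\<^sub>R x)) (\<lambda>x. k * \<rho> (a + c *\<^sub>R x)) = k\<^sup>2 / c ^ 4 * interact 0 1 \<rho> \<rho>"
    using assms(2) by (simp add: eval_nat_numeral)
qed

lemma Epot_rescale:
  assumes f: "f \<in> energy_space j" and pos: "\<alpha> > 0" "c > 0" "d > 0"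
  shows "EpotP (rescale \<alpha> a c d f) = (\<alpha> / d ^ 3)\<^sup>2 / c ^ 5 * EpotP f"
    and "EpotM (rescale \<alpha> a c d f) = (\<alpha> / d ^ 3)\<^sup>2 / c ^ 4 * EpotM f"
proof -
  note e = rescale_facts(1)[OF f pos, of a]
  have deq: "density (rescale \<alpha> a c d f) = (\<lambda>x. \<alpha> / d ^ 3 * density f (a + c *\<^sub>R x))"
    using density_rescale[OF energy_spaceD(1)[OF f] pos(3)] by auto
  show "EpotP (rescale \<alpha> a c d f) = (\<alpha> / d ^ 3)\<^sup>2 / c ^ 5 * EpotP f"
    "EpotM (rescale \<alpha> a c d f) = (\<alpha> / d ^ 3)\<^sup>2 / c ^ 4 * EpotM f"
    unfolding Epot_eq(1,2)[OF e] Epot_eq(1,2)[OF f] deq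
    by (rule interact_affine[OF density_measurable[OF energy_spaceD(1)[OF f]] pos(2)])+
qed

lemma EpotP_nonneg: "f \<in> energy_space j \<Longrightarrow> EpotP f \<ge> 0"
  and EpotM_nonneg: "f \<in> energy_space j \<Longrightarrow> EpotM f \<ge> 0"
  by (simp_all add: Epot_eq interact_nonneg density_nonneg)

lemma EpotP_pos: "f \<in> energy_space j \<Longrightarrow> (LINT z|lborel. f z) > 0 \<Longrightarrow> EpotP f > 0"
  and EpotM_pos: "f \<in> energy_space j \<Longrightarrow> (LINT z|lborel. f z) > 0 \<Longrightarrow> EpotM f > 0"
  using interact_pos[OF good_density_density r_bounds] by (simp_all add: Epot_eq mass_density)

lemma kinetic_pos:
  assumes f: "f \<in> energy_space j" and m: "(LINT z|lborel. f z) > 0"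
  shows "kinetic f > 0"
proof (rule ccontr)
  note E = energy_spaceD[OF f]
  assume "\<not> ?thesis"
  moreover have "kinetic f \<ge> 0" unfolding kinetic_eq[OF f] using E(2) by (intro integral_nonneg_AE) auto
  ultimately have "(LINT z|lborel. (norm (snd z))\<^sup>2 * f z) = 0" using kinetic_eq[OF f] by simp
  then have "AE z in lborel. (norm (snd z))\<^sup>2 * f z = 0"
    using integral_nonneg_eq_0_iff_AE[OF E(5)] E(2) by (auto intro!: AE_I2)
  moreover have "AE z in lborel :: phase measure. snd z \<noteq> 0" by (intro AE_lborel_snd AE_lborel_singleton)
  ultimately have "AE z in lborel. f z = 0" by eventually_elim auto
  then have "(LINT z|lborel. f z) = 0" by (rule integral_eq_zero_AE)
  then show False using m by simp
qed

text \<open>The common form of both variational problems: the constraint values are those of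
  \<open>f\<close> itself, and a minimizer of the quotient fits in with \<open>\<delta> = 0\<close>
  and a suitable \<open>\<kappa>\<close>.\<close>

definition is_min :: "real \<Rightarrow> real \<Rightarrow> (phase \<Rightarrow> real) \<Rightarrow> bool" where
  "is_min \<delta> \<kappa> f \<longleftrightarrow> \<delta> \<ge> 0 \<and> \<kappa> \<ge> 0 \<and> \<delta> + \<kappa> > 0 \<and> f \<in> energy_space j \<and> (LINT z|lborel. f z) > 0 \<and>
     (\<forall>g\<in>energy_space j. (LINT z|lborel. g z) = (LINT z|lborel. f z) \<and>
        (LINT z|lborel. j (g z)) = (LINT z|lborel. j (f z)) \<longrightarrow> Hamiltonian \<delta> \<kappa> f \<le> Hamiltonian \<delta> \<kappa> g)"

lemma is_min_I:
  assumes "minimizes_I \<delta> \<kappa> j M1 Mj f" "M1 > 0" "\<delta> \<ge> 0" "\<kappa> \<ge> 0" "\<delta> + \<kappa> > 0"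
  shows "is_min \<delta> \<kappa> f"
proof -
  have c: "f \<in> constraint_set j M1 Mj" and eq: "ereal (Hamiltonian \<delta> \<kappa> f) = I_inf \<delta> \<kappa> j M1 Mj"
    using assms(1) by (auto simp: minimizes_I_def)
  have f: "f \<in> energy_space j" "(LINT z|lborel. f z) = M1" "(LINT z|lborel. j (f z)) = Mj"
    using c L1norm_eq L1norm_j_eq by (auto simp: constraint_set_def)
  have "Hamiltonian \<delta> \<kappa> f \<le> Hamiltonian \<delta> \<kappa> g"
    if "g \<in> energy_space j" "(LINT z|lborel. g z) = M1" "(LINT z|lborel. j (g z)) = Mj" for g
  proof -
    have "g \<in> constraint_set j M1 Mj" using that L1norm_eq L1norm_j_eq by (auto simp: constraint_set_def)
    then have "ereal (Hamiltonian \<delta> \<kappa> f) \<le> ereal (Hamiltonian \<delta> \<kappa> g)"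
      unfolding eq I_inf_def by (rule INF_lower)
    then show ?thesis by simp
  qed
  then show ?thesis using f assms by (simp add: is_min_def)
qed

text \<open>If \<open>m\<close> is the minimal ratio, then kinetic energy minus \<open>m\<close>
  times the Manev energy is nonnegative on the constraint set and vanishes at
  \<open>f\<close>.\<close>

lemma is_min_J:
  assumes "minimizes_J j M1 Mj f" "M1 > 0"
  shows "is_min 0 (kinetic f / EpotM f) f" and "ereal (kinetic f / EpotM f) = J_inf j M1 Mj"
proof -
  have c: "f \<in> constraint_set j M1 Mj" and eq: "ereal (kinetic f / EpotM f) = J_inf j M1 Mj"
    using assms(1) by (auto simp: minimizes_J_def)
  have f: "f \<in> energy_space j" "(LINT z|lborel. f z) = M1" "(LINT z|lborel. j (f z)) = Mj"
    using c L1norm_eq L1norm_j_eq by (auto simp: constraint_set_def)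
  have pos: "kinetic f > 0" "EpotM f > 0" using kinetic_pos EpotM_pos f assms(2) by auto
  define m where "m = kinetic f / EpotM f"
  have H0: "Hamiltonian 0 m f = 0" using pos by (simp add: Hamiltonian_def Epot_def m_def)
  have "0 \<le> Hamiltonian 0 m g"
    if g: "g \<in> energy_space j" "(LINT z|lborel. g z) = M1" "(LINT z|lborel. j (g z)) = Mj" for g
  proof -
    have "g \<in> constraint_set j M1 Mj" using that L1norm_eq L1norm_j_eq by (auto simp: constraint_set_def)
    then have "ereal m \<le> ereal (kinetic g / EpotM g)"
      unfolding eq m_def J_inf_def by (rule INF_lower)
    then have "m * EpotM g \<le> kinetic g" using EpotM_pos[of g] g assms(2) by (simp add: field_simps)
    then show ?thesis by (simp add: Hamiltonian_def Epot_def)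
  qed
  then show "is_min 0 (kinetic f / EpotM f) f"
    using f assms pos H0 by (simp add: is_min_def m_def)
  show "ereal (kinetic f / EpotM f) = J_inf j M1 Mj" by (rule eq)
qed

lemma energy_space_convex:
  assumes f: "f \<in> energy_space j" and g: "g \<in> energy_space j" and t: "0 \<le> t" "t \<le> 1"
  shows "(\<lambda>z. (1 - t) * f z + t * g z) \<in> energy_space j"
    and "(LINT z|lborel. j ((1 - t) * f z + t * g z)) \<le> (1 - t) * (LINT z|lborel. j (f z)) + t * (LINT z|lborel. j (g z))"
    and "AE x in lborel. density (\<lambda>z. (1 - t) * f z + t * g z) x = (1 - t) * density f x + t * density g x"
    and "kinetic (\<lambda>z. (1 - t) * f z + t * g z) = (1 - t) * kinetic f + t * kinetic g"
proof -
  note F = energy_spaceD[OF f] and G = energy_spaceD[OF g]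
  define h where "h z = (1 - t) * f z + t * g z" for z
  have hn: "h z \<ge> 0" for z using F(2) G(2) t by (simp add: h_def)
  have hm: "h \<in> borel_measurable borel" using F(1) G(1) unfolding h_def[abs_def] by measurable
  have jle: "j (h z) \<le> (1 - t) * j (f z) + t * j (g z)" for z
    unfolding h_def using F(2) G(2) t by (intro j_convex) auto
  have jm: "(\<lambda>z. j (h z)) \<in> borel_measurable borel" using hm hn by (rule j_comp_measurable)
  have ij: "integrable lborel (\<lambda>z. j (h z))"
  proof (rule Bochner_Integration.integrable_bound)
    show "integrable lborel (\<lambda>z. (1 - t) * j (f z) + t * j (g z))" using F(4) G(4) by simp
    show "AE z in lborel. norm (j (h z)) \<le> norm ((1 - t) * j (f z) + t * j (g z))"
      using jle j_nonneg[OF hn] by (intro AE_I2) (simp add: order_trans[OF jle abs_ge_self])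
  qed (use jm in simp)
  have kin: "(\<lambda>z. (norm (snd z))\<^sup>2 * h z) = (\<lambda>z. (1 - t) * ((norm (snd z))\<^sup>2 * f z) + t * ((norm (snd z))\<^sup>2 * g z))"
    by (simp add: h_def fun_eq_iff algebra_simps)
  have h: "h \<in> energy_space j"
  proof (rule energy_spaceI[OF hm hn _ ij])
    show "integrable lborel h" unfolding h_def[abs_def] using F(3) G(3) by simp
    show "integrable lborel (\<lambda>z. (norm (snd z))\<^sup>2 * h z)" unfolding kin using F(5) G(5) by simp
  qed
  then show "(\<lambda>z. (1 - t) * f z + t * g z) \<in> energy_space j" by (simp add: h_def[abs_def])
  have "(LINT z|lborel. j (h z)) \<le> (LINT z|lborel. (1 - t) * j (f z) + t * j (g z))"
    using ij F(4) G(4) by (intro integral_mono jle) auto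
  then show "(LINT z|lborel. j ((1 - t) * f z + t * g z)) \<le> (1 - t) * (LINT z|lborel. j (f z)) + t * (LINT z|lborel. j (g z))"
    using F(4) G(4) by (simp add: h_def)
  \<comment> \<open>Velocity integrals may diverge for a null set of positions, and there the
    default value 0 breaks additivity; hence the identity of densities is only almost
    everywhere.\<close>
  have "AE x in lborel. integrable lborel (\<lambda>v. f (x, v))" "AE x in lborel. integrable lborel (\<lambda>v. g (x, v))"
    using lborel_pair.AE_integrable_fst'[of f] lborel_pair.AE_integrable_fst'[of g] F(3) G(3) unfolding lborel_prod by auto
  then show "AE x in lborel. density (\<lambda>z. (1 - t) * f z + t * g z) x = (1 - t) * density f x + t * density g x"
    by eventually_elim (simp add: density_def)
  have "kinetic h = (1 - t) * kinetic f + t * kinetic g"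
    unfolding kinetic_eq[OF h] kinetic_eq[OF f] kinetic_eq[OF g] kin using F(5) G(5) by simp
  then show "kinetic (\<lambda>z. (1 - t) * f z + t * g z) = (1 - t) * kinetic f + t * kinetic g"
    by (simp add: h_def[abs_def])
qed

lemma casimir_pos:
  assumes f: "f \<in> energy_space j" and m: "(LINT z|lborel. f z) > 0"
  shows "(LINT z|lborel. j (f z)) > 0"
proof (rule ccontr)
  note E = energy_spaceD[OF f]
  assume "\<not> ?thesis"
  moreover have "(LINT z|lborel. j (f z)) \<ge> 0" using j_nonneg[OF E(2)] by (intro integral_nonneg_AE) auto
  ultimately have "(LINT z|lborel. j (f z)) = 0" by simp
  then have "AE z in lborel. j (f z) = 0"
    using integral_nonneg_eq_0_iff_AE[OF E(4)] j_nonneg[OF E(2)] by auto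
  then have "AE z in lborel. f z = 0"
  proof eventually_elim
    case (elim z)
    then show ?case using E(2)[of z] j_pos[of "f z"] by (cases "f z = 0") auto
  qed
  then have "(LINT z|lborel. f z) = 0" by (rule integral_eq_zero_AE)
  then show False using m by simp
qed

text \<open>
  Concentrating the mass in space by a factor \<open>\<alpha> \<ge> 1\<close> raises the Casimir functional from
  \<open>\<integral> j(g)\<close> to \<open>\<integral> j(\<alpha> g) / \<alpha>\<close>, keeps the kinetic energy and raises
  the potential energy; hence the constraint on \<open>j\<close> may be relaxed to an inequality.
\<close>

lemma is_min_relaxed:
  assumes min: "is_min \<delta> \<kappa> f" and g: "g \<in> energy_space j"
    and m: "(LINT z|lborel. g z) = (LINT z|lborel. f z)"
    and le: "(LINT z|lborel. j (g z)) \<le> (LINT z|lborel. j (f z))"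
  shows "Hamiltonian \<delta> \<kappa> f \<le> Hamiltonian \<delta> \<kappa> g"
proof -
  note G = energy_spaceD[OF g]
  have d: "\<delta> \<ge> 0" "\<kappa> \<ge> 0" using min by (auto simp: is_min_def)
  define N where "N a = (LINT z|lborel. j (a * g z))" for a
  define Mj where "Mj = (LINT z|lborel. j (f z))"
  have mg: "(LINT z|lborel. g z) > 0" using min m by (simp add: is_min_def)
  then have N1: "N 1 > 0" "N 1 \<le> Mj" using casimir_pos[OF g] le by (auto simp: N_def Mj_def)
  \<comment> \<open>Convexity on an open interval is the source of the continuity of
    \<open>N\<close>, which the intermediate value theorem below requires.\<close>
  have "convex_on {0<..} N"
  proof (rule convex_onI)
    fix t x y :: real assume A: "0 < t" "t < 1" "x \<in> {0<..}" "y \<in> {0<..}"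
    have "N ((1 - t) *\<^sub>R x + t *\<^sub>R y) \<le> (LINT z|lborel. (1 - t) * j (x * g z) + t * j (y * g z))"
      unfolding N_def
    proof (rule integral_mono)
      show "integrable lborel (\<lambda>z. j (((1 - t) *\<^sub>R x + t *\<^sub>R y) * g z))"
        using A by (intro integrable_j_mult[OF g]) auto
      show "integrable lborel (\<lambda>z. (1 - t) * j (x * g z) + t * j (y * g z))"
        using A integrable_j_mult[OF g, of x] integrable_j_mult[OF g, of y] by auto
      show "j (((1 - t) *\<^sub>R x + t *\<^sub>R y) * g z) \<le> (1 - t) * j (x * g z) + t * j (y * g z)" for z
        using j_convex[of "x * g z" "y * g z" t] A G(2)[of z] by (simp add: algebra_simps)
    qed
    also have "\<dots> = (1 - t) * N x + t * N y"
      using A integrable_j_mult[OF g, of x] integrable_j_mult[OF g, of y] by (simp add: N_def)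
    finally show "N ((1 - t) *\<^sub>R x + t *\<^sub>R y) \<le> (1 - t) * N x + t * N y" .
  qed (simp add: convex_real_interval)
  then have cont: "continuous_on {0<..} N" by (intro convex_on_continuous) auto
  have low: "N a \<ge> a powr p * N 1" if "a \<ge> 1" for a
  proof -
    have "a powr p * N 1 = (LINT z|lborel. a powr p * j (g z))" by (simp add: N_def)
    also have "\<dots> \<le> N a" unfolding N_def
      using G(4) integrable_j_mult[OF g, of a] j_growth(1)[OF that G(2)] that by (intro integral_mono) auto
    finally show ?thesis .
  qed
  \<comment> \<open>By \<open>low\<close> and \<open>p > 2\<close>, \<open>N b / b\<close> is at
    least \<open>b * N 1\<close>, and this \<open>b\<close> pushes that up to
    \<open>Mj\<close>.\<close>
  define b where "b = max 1 (Mj / N 1)"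
  have b: "b \<ge> 1" by (simp add: b_def)
  have "b powr 2 \<le> b powr p" using b p_gt by (intro powr_mono) auto
  then have "b * b * N 1 \<le> b powr p * N 1" using b N1 by (simp add: power2_eq_square mult_right_mono)
  also have "\<dots> \<le> N b" by (rule low[OF b])
  finally have "b * N 1 \<le> N b / b" using b by (simp add: field_simps)
  moreover have "Mj \<le> b * N 1"
  proof -
    have "Mj / N 1 \<le> b" by (simp add: b_def)
    then show ?thesis using N1 by (simp add: field_simps)
  qed
  ultimately have "N 1 / 1 \<le> Mj" "Mj \<le> N b / b" using N1 by auto
  moreover have "continuous_on {1..b} (\<lambda>a. N a / a)"
    by (intro continuous_intros continuous_on_subset[OF cont]) auto
  ultimately obtain \<alpha> where \<alpha>: "1 \<le> \<alpha>" "\<alpha> \<le> b" "N \<alpha> / \<alpha> = Mj"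
    using IVT'[of "\<lambda>a. N a / a" 1 Mj b] b by auto
  \<comment> \<open>With \<open>c ^ 3 = \<alpha>\<close> the mass is unchanged and the Casimir
    integral becomes \<open>N \<alpha> / \<alpha> = Mj\<close>. The potential energies get the
    factors \<alpha>^2 / c^5 = c and \<alpha>^2 / c^4 = c^2, both at least 1.\<close>
  define c where "c = \<alpha> powr (1 / 3)"
  have c: "c \<ge> 1" "c > 0" using \<alpha> by (auto simp: c_def ge_one_powr_ge_zero)
  have c3: "c ^ 3 = \<alpha>" using \<alpha> by (simp add: c_def powr_realpow[symmetric] powr_powr)
  define h where "h = rescale \<alpha> 0 c 1 g"
  have \<alpha>0: "\<alpha> > 0" using \<alpha> by simp
  note S = rescale_facts[OF g \<alpha>0 c(2) zero_less_one, of 0, folded h_def]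
  have h: "(LINT z|lborel. h z) = (LINT z|lborel. f z)" "(LINT z|lborel. j (h z)) = (LINT z|lborel. j (f z))"
    "kinetic h = kinetic g"
    using S(2-4) \<alpha> c3 \<alpha>0 m by (auto simp: N_def Mj_def)
  have "EpotP h = c * EpotP g" "EpotM h = c\<^sup>2 * EpotM g"
    using Epot_rescale[OF g \<alpha>0 c(2) zero_less_one, of 0, folded h_def] c c3[symmetric] 
    by (simp_all add: power_mult[symmetric] eval_nat_numeral)
  then have "EpotP g \<le> EpotP h" "EpotM g \<le> EpotM h"
    using c EpotP_nonneg[OF g] EpotM_nonneg[OF g] one_le_power[OF c(1), of 2]
      mult_right_mono[of 1 c "EpotP g"] mult_right_mono[of 1 "c\<^sup>2" "EpotM g"] by auto
  then have "Epot \<delta> \<kappa> g \<le> Epot \<delta> \<kappa> h"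
    unfolding Epot_def using d by (intro add_mono mult_left_mono) auto
  then have "Hamiltonian \<delta> \<kappa> h \<le> Hamiltonian \<delta> \<kappa> g" using h by (simp add: Hamiltonian_def)
  moreover have "Hamiltonian \<delta> \<kappa> f \<le> Hamiltonian \<delta> \<kappa> h"
    using min S(1) h by (simp add: is_min_def)
  ultimately show ?thesis by simp
qed

end

section \<open>The Euler-Lagrange equation\<close>

lemma AE_norm_sq_neq: "AE v::R3 in lborel. (norm v)\<^sup>2 \<noteq> k"
proof -
  have "negligible (sphere (0::R3) (sqrt k))" by (rule negligible_sphere)
  then have "sphere (0::R3) (sqrt k) \<in> null_sets lborel"
    by (simp add: negligible_iff_null_sets null_sets_completion_iff)
  then have "AE v::R3 in lborel. v \<notin> sphere 0 (sqrt k)" by (rule AE_not_in)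
  then show ?thesis by eventually_elim (metis mem_sphere_0 norm_ge_zero real_sqrt_unique)
qed

lemma nonneg_if_ge_small_multiples:
  fixes A B :: real
  assumes "\<And>t. 0 < t \<Longrightarrow> t \<le> 1 \<Longrightarrow> t * B \<le> A"
  shows "A \<ge> 0"
proof (rule ccontr)
  assume "\<not> A \<ge> 0"
  then have A: "A < 0" by simp
  define t where "t = min 1 (- A / (\<bar>B\<bar> + 1))"
  have t: "0 < t" "t \<le> 1" "t \<le> - A / (\<bar>B\<bar> + 1)" using A by (auto simp: t_def divide_neg_pos)
  have "t * (\<bar>B\<bar> + 1) \<le> - A" using t(3) by (simp add: field_simps)
  moreover have "- (t * \<bar>B\<bar>) \<le> t * B" using t mult_left_mono[of "- \<bar>B\<bar>" B t] by (simp add: abs_le_iff)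
  moreover have "t * (\<bar>B\<bar> + 1) = t * \<bar>B\<bar> + t" by (simp add: algebra_simps)
  ultimately show False using assms[OF t(1,2)] t(1) by linarith
qed

lemma interact_lincomb_right:
  assumes \<rho>: "good_density r \<rho>" and \<sigma>: "good_density r \<sigma>" and \<tau>: "good_density r \<tau>" and r: "3 / 2 < r" "r \<le> 2"
  shows "interact \<delta> \<kappa> \<rho> (\<lambda>x. (1 - t) * \<sigma> x + t * \<tau> x) = (1 - t) * interact \<delta> \<kappa> \<rho> \<sigma> + t * interact \<delta> \<kappa> \<rho> \<tau>"
proof -
  have "interact \<delta> \<kappa> \<rho> (\<lambda>x. (1 - t) * \<sigma> x + t * \<tau> x)
    = (LINT z|lborel. (1 - t) * (\<rho> (fst z) * \<sigma> (snd z) * ker \<delta> \<kappa> (fst z) (snd z))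
        + t * (\<rho> (fst z) * \<tau> (snd z) * ker \<delta> \<kappa> (fst z) (snd z)))"
    unfolding interact_def by (intro Bochner_Integration.integral_cong) (auto simp: algebra_simps)
  then show ?thesis
    unfolding interact_def using good_pair_integrable[OF \<rho> \<sigma> r, of \<delta> \<kappa>] good_pair_integrable[OF \<rho> \<tau> r, of \<delta> \<kappa>] by simp
qed

context casimir begin

text \<open>Linearization of the Hamiltonian at \<open>f\<close>: the derivative along the segment
  from \<open>f\<close> to \<open>g\<close> is
  \<open>lin \<delta> \<kappa> f g - lin \<delta> \<kappa> f f\<close>.\<close>

definition lin :: "real \<Rightarrow> real \<Rightarrow> (phase \<Rightarrow> real) \<Rightarrow> (phase \<Rightarrow> real) \<Rightarrow> real" where
  "lin \<delta> \<kappa> f g = kinetic g - 2 * interact \<delta> \<kappa> (density f) (density g)"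

lemma lin_convex:
  assumes f: "f \<in> energy_space j" and g: "g \<in> energy_space j" "g' \<in> energy_space j" and t: "0 \<le> t" "t \<le> 1"
  shows "lin \<delta> \<kappa> f (\<lambda>z. (1 - t) * g z + t * g' z) = (1 - t) * lin \<delta> \<kappa> f g + t * lin \<delta> \<kappa> f g'"
proof -
  note C = energy_space_convex[OF g t]
  note G = good_density_density[OF f] good_density_density[OF g(1)] good_density_density[OF g(2)]
  have "interact \<delta> \<kappa> (density f) (density (\<lambda>z. (1 - t) * g z + t * g' z))
     = interact \<delta> \<kappa> (density f) (\<lambda>x. (1 - t) * density g x + t * density g' x)"
    using G[THEN good_densityD(1)] good_densityD(1)[OF good_density_density[OF C(1)]]
    by (intro interact_AE_cong C(3)) auto
  then show ?thesis
    unfolding lin_def C(4) interact_lincomb_right[OF G r_bounds] by (simp add: algebra_simps)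
qed

text \<open>
  The first variation of the Hamiltonian is taken along segments of the relaxed constraint set,
  which is convex.
\<close>

lemma is_min_lin:
  assumes min: "is_min \<delta> \<kappa> f" and g: "g \<in> energy_space j"
    and m: "(LINT z|lborel. g z) = (LINT z|lborel. f z)"
    and le: "(LINT z|lborel. j (g z)) \<le> (LINT z|lborel. j (f z))"
  shows "lin \<delta> \<kappa> f f \<le> lin \<delta> \<kappa> f g"
proof -
  have f: "f \<in> energy_space j" using min by (simp add: is_min_def)
  note F = energy_spaceD[OF f] and E = energy_spaceD[OF g]
  define Iff Ifg Igg where "Iff = interact \<delta> \<kappa> (density f) (density f)"
    and "Ifg = interact \<delta> \<kappa> (density f) (density g)" and "Igg = interact \<delta> \<kappa> (density g) (density g)"
  note G = good_density_density[OF f] good_density_density[OF g]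
  \<comment> \<open>On the segment the Hamiltonian is quadratic in \<open>t\<close>; its increment
    is divided by \<open>t\<close> and the second-order coefficient is moved to the left.\<close>
  have "t * (Iff - 2 * Ifg + Igg) \<le> lin \<delta> \<kappa> f g - lin \<delta> \<kappa> f f" if t: "0 < t" "t \<le> 1" for t
  proof -
    have t': "0 \<le> t" "t \<le> 1" using t by auto
    note C = energy_space_convex[OF f g t']
    let ?h = "\<lambda>z. (1 - t) * f z + t * g z"
    have 1: "(LINT z|lborel. ?h z) = (LINT z|lborel. f z)" using F(3) E(3) m by (simp add: algebra_simps)
    have "(1 - t) * (LINT z|lborel. j (f z)) + t * (LINT z|lborel. j (g z)) \<le> (1 - t) * (LINT z|lborel. j (f z)) + t * (LINT z|lborel. j (f z))"
      using le t by (intro add_left_mono mult_left_mono) auto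
    then have 2: "(LINT z|lborel. j (?h z)) \<le> (LINT z|lborel. j (f z))" using C(2) by (simp add: algebra_simps)
    have "interact \<delta> \<kappa> (density ?h) (density ?h)
       = interact \<delta> \<kappa> (\<lambda>x. (1 - t) * density f x + t * density g x) (\<lambda>x. (1 - t) * density f x + t * density g x)"
      using G[THEN good_densityD(1)] good_densityD(1)[OF good_density_density[OF C(1)]]
      by (intro interact_AE_cong C(3)) auto
    also have "\<dots> = (1 - t)\<^sup>2 * Iff + 2 * t * (1 - t) * Ifg + t\<^sup>2 * Igg"
      unfolding Iff_def Ifg_def Igg_def by (rule interact_lincomb[OF G r_bounds])
    finally have "Hamiltonian \<delta> \<kappa> ?h = (1 - t) * kinetic f + t * kinetic g - ((1 - t)\<^sup>2 * Iff + 2 * t * (1 - t) * Ifg + t\<^sup>2 * Igg)"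
      unfolding Hamiltonian_def Epot_eq(3)[OF C(1)] C(4) by simp
    moreover have "Hamiltonian \<delta> \<kappa> f = kinetic f - Iff" unfolding Hamiltonian_def Epot_eq(3)[OF f] Iff_def by simp
    moreover have "Hamiltonian \<delta> \<kappa> f \<le> Hamiltonian \<delta> \<kappa> ?h" by (rule is_min_relaxed[OF min C(1) 1 2])
    ultimately have "kinetic f - Iff \<le> (1 - t) * kinetic f + t * kinetic g - ((1 - t)\<^sup>2 * Iff + 2 * t * (1 - t) * Ifg + t\<^sup>2 * Igg)"
      by simp
    then have "0 \<le> t * (kinetic g - 2 * Ifg - (kinetic f - 2 * Iff) - t * (Iff - 2 * Ifg + Igg))"
      by (simp add: algebra_simps power2_eq_square)
    then have "0 \<le> kinetic g - 2 * Ifg - (kinetic f - 2 * Iff) - t * (Iff - 2 * Ifg + Igg)"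
      using t by (simp add: zero_le_mult_iff)
    then show ?thesis by (simp add: lin_def Iff_def Ifg_def)
  qed
  from nonneg_if_ge_small_multiples[OF this] show ?thesis by simp
qed

text \<open>Each competitor is recorded by its mass, an upper bound for its Casimir integral and an
  upper bound for its linearized energy. These triples form a convex set, disjoint by
  \<open>is_min_lin\<close> from the triples that would improve on \<open>f\<close>; a separating
  hyperplane has the multipliers as coefficients.\<close>

lemma lagrange_multipliers:
  assumes min: "is_min \<delta> \<kappa> f"
  obtains l m n :: real where "l \<noteq> 0 \<or> m \<noteq> 0 \<or> n \<noteq> 0" "m \<ge> 0" "n \<ge> 0"
    "\<And>g. g \<in> energy_space j \<Longrightarrow>
       l * (LINT z|lborel. f z) + m * (LINT z|lborel. j (f z)) + n * lin \<delta> \<kappa> f f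
       \<le> l * (LINT z|lborel. g z) + m * (LINT z|lborel. j (g z)) + n * lin \<delta> \<kappa> f g"
proof -
  have f: "f \<in> energy_space j" using min by (simp add: is_min_def)
  define M where "M = (LINT z|lborel. f z)"
  define J where "J = (LINT z|lborel. j (f z))"
  define L where "L = lin \<delta> \<kappa> f f"
  define S where "S = {x :: real \<times> real \<times> real. \<exists>g\<in>energy_space j. fst x = (LINT z|lborel. g z) \<and>
     (LINT z|lborel. j (g z)) \<le> fst (snd x) \<and> lin \<delta> \<kappa> f g \<le> snd (snd x)}"
  define T where "T = {x :: real \<times> real \<times> real. fst x = M \<and> fst (snd x) \<le> J \<and> snd (snd x) < L}"
  have "convex S"
    unfolding convex_alt
  proof (intro ballI allI impI)
    fix x y :: "real \<times> real \<times> real" and t :: real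
    assume xy: "x \<in> S" "y \<in> S" and "0 \<le> t \<and> t \<le> 1"
    then have t: "0 \<le> t" "t \<le> 1" by auto
    obtain g where g: "g \<in> energy_space j" "fst x = (LINT z|lborel. g z)" "(LINT z|lborel. j (g z)) \<le> fst (snd x)"
      "lin \<delta> \<kappa> f g \<le> snd (snd x)" using xy(1) by (auto simp: S_def)
    obtain h where h: "h \<in> energy_space j" "fst y = (LINT z|lborel. h z)" "(LINT z|lborel. j (h z)) \<le> fst (snd y)"
      "lin \<delta> \<kappa> f h \<le> snd (snd y)" using xy(2) by (auto simp: S_def)
    note C = energy_space_convex[OF g(1) h(1) t]
    show "(1 - t) *\<^sub>R x + t *\<^sub>R y \<in> S"
      unfolding S_def mem_Collect_eq
    proof (intro bexI[OF _ C(1)] conjI)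
      show "fst ((1 - t) *\<^sub>R x + t *\<^sub>R y) = (LINT z|lborel. (1 - t) * g z + t * h z)"
        using energy_spaceD(3)[OF g(1)] energy_spaceD(3)[OF h(1)] g h by simp
      have "(1 - t) * (LINT z|lborel. j (g z)) + t * (LINT z|lborel. j (h z)) \<le> (1 - t) * fst (snd x) + t * fst (snd y)"
        using g h t by (intro add_mono mult_left_mono) auto
      then show "(LINT z|lborel. j ((1 - t) * g z + t * h z)) \<le> fst (snd ((1 - t) *\<^sub>R x + t *\<^sub>R y))"
        using C(2) by simp
      have "(1 - t) * lin \<delta> \<kappa> f g + t * lin \<delta> \<kappa> f h \<le> (1 - t) * snd (snd x) + t * snd (snd y)"
        using g h t by (intro add_mono mult_left_mono) auto
      then show "lin \<delta> \<kappa> f (\<lambda>z. (1 - t) * g z + t * h z) \<le> snd (snd ((1 - t) *\<^sub>R x + t *\<^sub>R y))"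
        using lin_convex[OF f g(1) h(1) t] by simp
    qed
  qed
  moreover have "convex T"
  proof -
    have "T = {M} \<times> ({..J} \<times> {..<L})" by (auto simp: T_def)
    then show ?thesis by (auto intro!: convex_Times convex_real_interval)
  qed
  moreover have "S \<noteq> {}" 
  proof -
    have "(M, J, L) \<in> S" using f by (auto simp: S_def M_def J_def L_def)
    then show ?thesis by blast
  qed
  moreover have "T \<noteq> {}"
  proof -
    have "(M, J, L - 1) \<in> T" by (simp add: T_def)
    then show ?thesis by blast
  qed
  moreover have "T \<inter> S = {}"
    using is_min_lin[OF min] by (fastforce simp: S_def T_def M_def J_def L_def)
  ultimately obtain a b where ab: "a \<noteq> 0" "\<forall>x\<in>T. a \<bullet> x \<le> b" "\<forall>x\<in>S. a \<bullet> x \<ge> b"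
    using separating_hyperplane_sets[of T S] by blast
  define l m n where "l = fst a" and "m = fst (snd a)" and "n = snd (snd a)"
  have a: "a = (l, m, n)" by (simp add: l_def m_def n_def)
  have T: "l * M + m * (J - u) + n * (L - w) \<le> b" if "u \<ge> 0" "w > 0" for u w
    using ab(2)[rule_format, of "(M, J - u, L - w)"] that by (simp add: T_def a inner_prod_def)
  \<comment> \<open>\<open>T\<close> extends downwards without bound in its last two coordinates;
    with a negative coefficient the functional would exceed \<open>b\<close> on it, and
    \<open>u\<close> is a distance at which that happens.\<close>
  have m0: "m \<ge> 0"
  proof (rule ccontr)
    assume "\<not> m \<ge> 0"
    then have m: "m < 0" by simp
    define u where "u = max 0 ((b - (l * M + m * J + n * (L - 1)) + 1) / (- m))"
    have "(b - (l * M + m * J + n * (L - 1)) + 1) / (- m) \<le> u" by (simp add: u_def)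
    then have "b - (l * M + m * J + n * (L - 1)) + 1 \<le> u * (- m)" using m by (simp add: field_simps)
    moreover have "l * M + m * (J - u) + n * (L - 1) \<le> b" by (rule T) (auto simp: u_def)
    ultimately show False by (simp add: algebra_simps)
  qed
  have n0: "n \<ge> 0"
  proof (rule ccontr)
    assume "\<not> n \<ge> 0"
    then have n: "n < 0" by simp
    define u where "u = max 1 ((b - (l * M + m * J + n * L) + 1) / (- n))"
    have "(b - (l * M + m * J + n * L) + 1) / (- n) \<le> u" by (simp add: u_def)
    then have "b - (l * M + m * J + n * L) + 1 \<le> u * (- n)" using n by (simp add: field_simps)
    moreover have "l * M + m * (J - 0) + n * (L - u) \<le> b" by (rule T) (auto simp: u_def)
    ultimately show False by (simp add: algebra_simps)
  qed
  \<comment> \<open>The strict inequality in \<open>T\<close> excludes the point of \<open>f\<close>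
    itself, which is reached by letting the gap \<open>t\<close> shrink to 0.\<close>
  have "t * (- n) \<le> b - (l * M + m * J + n * L)" if "0 < t" "t \<le> 1" for t
    using T[of 0 t] that by (simp add: algebra_simps)
  then have "0 \<le> b - (l * M + m * J + n * L)" by (rule nonneg_if_ge_small_multiples)
  then have lim: "l * M + m * J + n * L \<le> b" by simp
  show ?thesis
  proof (rule that[of l m n])
    show "l \<noteq> 0 \<or> m \<noteq> 0 \<or> n \<noteq> 0" using ab(1) a by (auto simp: zero_prod_def)
    fix g assume g: "g \<in> energy_space j"
    have "(LINT z|lborel. g z, LINT z|lborel. j (g z), lin \<delta> \<kappa> f g) \<in> S" using g by (auto simp: S_def)
    then have "b \<le> l * (LINT z|lborel. g z) + m * (LINT z|lborel. j (g z)) + n * lin \<delta> \<kappa> f g"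
      using ab(3)[rule_format, of "(LINT z|lborel. g z, LINT z|lborel. j (g z), lin \<delta> \<kappa> f g)"] by (simp add: a inner_prod_def)
    then show "l * (LINT z|lborel. f z) + m * (LINT z|lborel. j (f z)) + n * lin \<delta> \<kappa> f f
       \<le> l * (LINT z|lborel. g z) + m * (LINT z|lborel. j (g z)) + n * lin \<delta> \<kappa> f g"
      using lim by (simp add: M_def J_def L_def)
  qed (use m0 n0 in auto)
qed

lemma energy_space_modify:
  assumes f: "f \<in> energy_space j" and A: "A \<in> sets borel" "A \<subseteq> ball 0 (real k)" and t: "t \<ge> 0"
  shows "(\<lambda>z. if z \<in> A then t else f z) \<in> energy_space j"
proof -
  note F = energy_spaceD[OF f]
  have [measurable]: "A \<in> sets borel" "f \<in> borel_measurable borel" by (auto simp: A F)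
  define g where "g z = (if z \<in> A then t else f z)" for z
  have gn: "g z \<ge> 0" for z using F(2) t by (simp add: g_def)
  have gm [measurable]: "g \<in> borel_measurable borel" unfolding g_def[abs_def] by measurable
  have ib: "integrable lborel (indicator (ball (0::phase) (real k)) :: phase \<Rightarrow> real)"
    by (rule integrable_real_indicator) (auto simp: emeasure_ball)
  have bd: "integrable lborel (\<lambda>z. w (g z) z)"
    if w: "\<And>z s. s \<ge> 0 \<Longrightarrow> 0 \<le> w s z" and wf: "integrable lborel (\<lambda>z. w (f z) z)"
      and wt: "\<And>z. z \<in> ball 0 (real k) \<Longrightarrow> w t z \<le> C" and wm: "(\<lambda>z. w (g z) z) \<in> borel_measurable borel" for w :: "real \<Rightarrow> phase \<Rightarrow> real" and C
  proof (rule Bochner_Integration.integrable_bound)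
    show "integrable lborel (\<lambda>z. w (f z) z + C * indicator (ball 0 (real k)) z)" using wf ib by simp
    have "w (g z) z \<le> w (f z) z + C * indicator (ball 0 (real k)) z" for z
    proof (cases "z \<in> A")
      case True
      then have "z \<in> ball 0 (real k)" using A(2) by blast
      then show ?thesis using True wt[of z] w[OF F(2)[of z], of z] by (simp add: g_def)
    next
      case False
      have "C * indicator (ball 0 (real k)) z \<ge> 0"
        using wt[of z] w[OF t, of z] by (auto simp: indicator_def)
      then show ?thesis using False by (simp add: g_def)
    qed
    then show "AE z in lborel. norm (w (g z) z) \<le> norm (w (f z) z + C * indicator (ball 0 (real k)) z)"
      using w[OF gn] by (intro AE_I2) (smt (verit) real_norm_def)
  qed (use wm in simp)
  have "(norm (snd z))\<^sup>2 * t \<le> (real k)\<^sup>2 * t" if "z \<in> ball 0 (real k)" for z :: phase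
    using that t norm_snd_le[of "snd z" "fst z"] by (intro mult_right_mono power_mono) auto
  then have "g \<in> energy_space j"
    using bd[of "\<lambda>s z. s" t] bd[of "\<lambda>s z. j s" "j t"] bd[of "\<lambda>s z. (norm (snd z))\<^sup>2 * s" "(real k)\<^sup>2 * t"]
      F(3-5) j_nonneg j_comp_measurable[OF gm gn]
    by (intro energy_spaceI gm gn) auto
  then show ?thesis by (simp add: g_def[abs_def])
qed

text \<open>With multipliers, all of the energy space competes and the functional is the integral of
  \<open>W z (g z)\<close>. Replacing \<open>f\<close> by the constant \<open>t\<close> on the
  bounded part of the set where this lowers \<open>W\<close> strictly must not gain anything, so
  that set is null.\<close>

lemma pointwise_min:
  assumes d: "\<delta> \<ge> 0" "\<kappa> \<ge> 0" and f: "f \<in> energy_space j"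
    and min: "\<And>g. g \<in> energy_space j \<Longrightarrow>
       l * (LINT z|lborel. f z) + m * (LINT z|lborel. j (f z)) + n * lin \<delta> \<kappa> f f
       \<le> l * (LINT z|lborel. g z) + m * (LINT z|lborel. j (g z)) + n * lin \<delta> \<kappa> f g"
  defines "W \<equiv> \<lambda>z t. (l + n * ((norm (snd z))\<^sup>2 - 2 * pot \<delta> \<kappa> (density f) (fst z))) * t + m * j t"
  assumes t: "t \<ge> 0"
  shows "AE z in lborel. W z (f z) \<le> W z t"
proof -
  note F = energy_spaceD[OF f]
  have [measurable]: "f \<in> borel_measurable borel" "density f \<in> borel_measurable borel"
    using F(1) density_measurable[OF F(1)] by auto
  have jm [measurable]: "(\<lambda>z. j (f z)) \<in> borel_measurable borel" using F(1,2) by (rule j_comp_measurable)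
  have Weq: "integrable lborel (\<lambda>z. W z (g z))" "(LINT z|lborel. W z (g z)) =
     l * (LINT z|lborel. g z) + m * (LINT z|lborel. j (g z)) + n * lin \<delta> \<kappa> f g" if g: "g \<in> energy_space j" for g
  proof -
    note G = energy_spaceD[OF g]
    note P = interact_phase[OF g good_density_density[OF f] d]
    have e: "W z (g z) = l * g z + (n * ((norm (snd z))\<^sup>2 * g z) - 2 * n * (pot \<delta> \<kappa> (density f) (fst z) * g z)) + m * j (g z)" for z
      by (simp add: W_def algebra_simps)
    show "integrable lborel (\<lambda>z. W z (g z))" unfolding e using G P by simp
    have s: "interact \<delta> \<kappa> (density g) (density f) = interact \<delta> \<kappa> (density f) (density g)"
      by (intro interact_sym density_measurable F G)
    show "(LINT z|lborel. W z (g z)) = l * (LINT z|lborel. g z) + m * (LINT z|lborel. j (g z)) + n * lin \<delta> \<kappa> f g"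
    proof -
      have "(LINT z|lborel. W z (g z)) = l * (LINT z|lborel. g z) + (n * (LINT z|lborel. (norm (snd z))\<^sup>2 * g z)
          - 2 * n * (LINT z|lborel. pot \<delta> \<kappa> (density f) (fst z) * g z)) + m * (LINT z|lborel. j (g z))"
        unfolding e using G P(1) by simp
      then show ?thesis unfolding P(2) s lin_def kinetic_eq[OF g] by (simp add: algebra_simps)
    qed
  qed
  have "AE z in lborel. z \<in> ball 0 (real k) \<longrightarrow> W z (f z) \<le> W z t" for k
  proof -
    define A where "A = {z \<in> ball 0 (real k). W z t < W z (f z)}"
    have [measurable]: "ball (0::phase) (real k) \<in> sets borel" by simp
    have A [measurable]: "A \<in> sets borel" "A \<subseteq> ball 0 (real k)" unfolding A_def W_def by measurable auto
    define g where "g z = (if z \<in> A then t else f z)" for z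
    have g: "g \<in> energy_space j" unfolding g_def[abs_def] by (rule energy_space_modify[OF f A t])
    have "(LINT z|lborel. W z (f z)) \<le> (LINT z|lborel. W z (g z))"
      using min[OF g] Weq(2)[OF f] Weq(2)[OF g] by simp
    then have "(LINT z|lborel. W z (f z) - W z (g z)) \<le> 0" using Weq(1)[OF f] Weq(1)[OF g] by simp
    moreover have nn: "W z (f z) - W z (g z) \<ge> 0" for z by (auto simp: g_def A_def)
    ultimately have "(LINT z|lborel. W z (f z) - W z (g z)) = 0"
      by (metis (no_types, lifting) antisym integral_nonneg_AE AE_I2)
    then have "AE z in lborel. W z (f z) - W z (g z) = 0"
      using Weq(1)[OF f] Weq(1)[OF g] nn by (subst (asm) integral_nonneg_eq_0_iff_AE) auto
    then show ?thesis by eventually_elim (auto simp: g_def A_def split: if_splits)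
  qed
  then have "AE z in lborel. \<forall>k. z \<in> ball 0 (real k) \<longrightarrow> W z (f z) \<le> W z t"
    by (subst AE_all_countable) blast
  then show ?thesis
  proof eventually_elim
    case (elim z)
    obtain k where "norm z < real k" using reals_Archimedean2 by blast
    then show ?case using elim by auto
  qed
qed

text \<open>Only rational \<open>t\<close> are compared because the exceptional null set of
  \<open>pointwise_min\<close> depends on \<open>t\<close>; density of the rationals still yields
  the first-order conditions at an interior point and at the endpoint 0.\<close>

lemma scalar_min:
  assumes m: "m \<ge> 0" and \<tau>: "\<tau> \<ge> 0" and min: "\<And>t. t \<in> \<rat> \<Longrightarrow> t \<ge> 0 \<Longrightarrow> c * \<tau> + m * j \<tau> \<le> c * t + m * j t"
  shows "\<tau> > 0 \<Longrightarrow> c + m * dj \<tau> = 0" and "\<tau> = 0 \<Longrightarrow> c \<ge> 0"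
proof -
  assume p: "\<tau> > 0"
  have D: "((\<lambda>t. c * t + m * j t) has_real_derivative (c + m * dj \<tau>)) (at \<tau>)"
    using dj_DERIV[OF p] by (auto intro!: derivative_eq_intros)
  show "c + m * dj \<tau> = 0"
  proof (rule ccontr)
    assume "c + m * dj \<tau> \<noteq> 0"
    then consider "c + m * dj \<tau> > 0" | "c + m * dj \<tau> < 0" by linarith
    then show False
    proof cases
      case 1
      obtain e where e: "e > 0" "\<And>h. h > 0 \<Longrightarrow> h < e \<Longrightarrow> c * (\<tau> - h) + m * j (\<tau> - h) < c * \<tau> + m * j \<tau>"
        using DERIV_pos_inc_left[OF D 1] by blast
      obtain t where t: "t \<in> \<rat>" "max 0 (\<tau> - e) < t" "t < \<tau>" using Rats_dense_in_real[of "max 0 (\<tau> - e)" \<tau>] e p by auto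
      show False using e(2)[of "\<tau> - t"] min[of t] t by simp
    next
      case 2
      obtain e where e: "e > 0" "\<And>h. h > 0 \<Longrightarrow> h < e \<Longrightarrow> c * (\<tau> + h) + m * j (\<tau> + h) < c * \<tau> + m * j \<tau>"
        using DERIV_neg_dec_right[OF D 2] by blast
      obtain t where t: "t \<in> \<rat>" "\<tau> < t" "t < \<tau> + e" using Rats_dense_in_real[of \<tau> "\<tau> + e"] e by auto
      show False using e(2)[of "t - \<tau>"] min[of t] t p by simp
    qed
  qed
next
  assume z: "\<tau> = 0"
  show "c \<ge> 0"
  proof (rule ccontr)
    assume "\<not> c \<ge> 0"
    then have c: "c < 0" by simp
    \<comment> \<open>Chosen so that \<open>m * y < - c\<close>, with \<open>+ 1\<close> covering
      \<open>m = 0\<close>: as long as \<open>dj t\<close> stays below \<open>y\<close>, the slope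
      \<open>c + m * dj t\<close> is negative and a small \<open>t\<close> beats 0.\<close>
    define y where "y = - c / (m + 1)"
    have y: "y > 0" using c m by (simp add: y_def divide_neg_pos)
    obtain s where s: "s \<ge> 0" "dj s = y" using dj_surj[of y] y by auto
    then have "s > 0" using y by (cases "s = 0") auto
    then obtain t where t: "t \<in> \<rat>" "0 < t" "t < s" using Rats_dense_in_real by blast
    have "dj t < y" using dj_less[of t s] t s by simp
    then have "m * dj t \<le> m * y" using m by (intro mult_left_mono) auto
    also have "m * y < - c" using m c by (simp add: y_def field_simps)
    finally have "t * (c + m * dj t) < 0" using t by (simp add: mult_less_0_iff)
    moreover have "j t \<le> t * dj t" using j_tangent[of t 0] t by (simp add: mult.commute)
    then have "m * j t \<le> m * (t * dj t)" using m by (rule mult_left_mono)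
    ultimately have "c * t + m * j t < 0" by (simp add: algebra_simps)
    then show False using min[of t] t z by simp
  qed
qed

text \<open>The pointwise conditions are \<open>c z + m * dj (f z) = 0\<close> where
  \<open>f\<close> is positive and \<open>c z \<ge> 0\<close> where it vanishes. Once
  \<open>m\<close> and \<open>n\<close> are known to be positive, dividing by \<open>m\<close> gives
  the formula.\<close>

lemma euler_lagrange:
  assumes min: "is_min \<delta> \<kappa> f"
  obtains A B \<mu> :: real where "A > 0" "\<mu> > 0"
    "AE z in lborel. dj (f z) = max 0 (A * pot \<delta> \<kappa> (density f) (fst z) + B - (norm (snd z))\<^sup>2 / (2 * \<mu>))"
proof -
  have d: "\<delta> \<ge> 0" "\<kappa> \<ge> 0" and f: "f \<in> energy_space j" and mass: "(LINT z|lborel. f z) > 0"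
    using min by (auto simp: is_min_def)
  note F = energy_spaceD[OF f]
  have [measurable]: "f \<in> borel_measurable borel" "density f \<in> borel_measurable borel"
    using F(1) density_measurable[OF F(1)] by auto
  obtain l m n :: real where lmn: "l \<noteq> 0 \<or> m \<noteq> 0 \<or> n \<noteq> 0" and m: "m \<ge> 0" and n: "n \<ge> 0" and
    mini: "\<And>g. g \<in> energy_space j \<Longrightarrow>
       l * (LINT z|lborel. f z) + m * (LINT z|lborel. j (f z)) + n * lin \<delta> \<kappa> f f
       \<le> l * (LINT z|lborel. g z) + m * (LINT z|lborel. j (g z)) + n * lin \<delta> \<kappa> f g"
    using lagrange_multipliers[OF min] by blast
  define c where "c = (\<lambda>z::phase. l + n * ((norm (snd z))\<^sup>2 - 2 * pot \<delta> \<kappa> (density f) (fst z)))"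
  have "AE z in lborel. \<forall>t\<in>{t\<in>\<rat>. t \<ge> 0}. c z * f z + m * j (f z) \<le> c z * t + m * j t"
    unfolding c_def
    by (intro AE_ball_countable[THEN iffD2] ballI pointwise_min[OF d f mini]) (auto intro: countable_subset[OF _ countable_rat])
  then have el: "AE z in lborel. (f z > 0 \<longrightarrow> c z + m * dj (f z) = 0) \<and> (f z = 0 \<longrightarrow> c z \<ge> 0)"
  proof eventually_elim
    case (elim z)
    show ?case using scalar_min[OF m F(2)[of z], of "c z"] elim by blast
  qed
  have not0: "\<not> (AE z in lborel. f z = 0)"
  proof
    assume "AE z in lborel. f z = 0"
    then have "(LINT z|lborel. f z) = 0" by (rule integral_eq_zero_AE)
    then show False using mass by simp
  qed
  \<comment> \<open>For \<open>n = 0\<close> the function \<open>c\<close> is the constant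
    \<open>l\<close>. If \<open>l \<ge> 0\<close> then \<open>f\<close> vanishes almost everywhere;
    if \<open>l < 0\<close> then \<open>f\<close> is a positive constant and not integrable.\<close>
  have "n \<noteq> 0"
  proof
    assume n0: "n = 0"
    then have cl: "c z = l" for z by (simp add: c_def)
    show False
    proof (cases "l \<ge> 0")
      case True
      have "AE z in lborel. f z = 0"
        using el
      proof eventually_elim
        case (elim z)
        show ?case
        proof (rule ccontr)
          assume "f z \<noteq> 0"
          then have fz: "f z > 0" using F(2)[of z] by simp
          then have "l + m * dj (f z) = 0" using elim cl by simp
          moreover have "m * dj (f z) \<ge> 0" using m dj_pos[OF fz] by simp
          ultimately have "l = 0" "m * dj (f z) = 0" using True by linarith+
          then show False using lmn n0 dj_pos[OF fz] by auto
        qed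
      qed
      then show False using not0 by simp
    next
      case False
      have p: "AE z in lborel. f z > 0 \<and> m * dj (f z) = - l"
        using el
      proof eventually_elim
        case (elim z)
        have "f z \<noteq> 0" using elim cl False by auto
        then have "f z > 0" using F(2)[of z] by simp
        then show ?case using elim cl by auto
      qed
      have "m \<noteq> 0"
      proof
        assume "m = 0"
        then have "AE z in lborel. f z = 0" using p False by (auto elim: eventually_mono)
        then show False using not0 by simp
      qed
      then have mp: "m > 0" using m by simp
      obtain \<tau> where \<tau>: "\<tau> \<ge> 0" "dj \<tau> = - l / m" using dj_surj[OF divide_nonneg_pos[of "- l" m]] False mp by auto
      have \<tau>0: "\<tau> \<noteq> 0" using \<tau> False mp by auto
      have "AE z in lborel. f z = \<tau>"
        using p
      proof eventually_elim
        case (elim z)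
        then have "dj (f z) = - l / m" using mp by (metis nonzero_mult_div_cancel_left less_irrefl)
        then have "dj (f z) = dj \<tau>" using \<tau> by simp
        then show ?case using dj_inj F(2) \<tau> by blast
      qed
      then have "integrable lborel (\<lambda>z::phase. \<tau>)" using F(3) by (subst integrable_cong_AE[of _ _ f]) (auto elim: eventually_mono)
      then have "integral\<^sup>N lborel (\<lambda>z::phase. ennreal \<tau>) < \<infinity>"
        by (rule integrable_nn_less_top) (rule \<tau>(1))
      then show False using \<tau> \<tau>0 by (simp add: emeasure_lborel_UNIV ennreal_mult_top)
    qed
  qed
  then have np: "n > 0" using n by simp
  \<comment> \<open>For \<open>m = 0\<close> the function \<open>f\<close> could be positive only
    where \<open>c\<close> vanishes, and for each position that is a null set of velocities (a
    sphere, a point or nothing).\<close>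
  have "m \<noteq> 0"
  proof
    assume m0: "m = 0"
    have "AE z::phase in lborel. (norm (snd z))\<^sup>2 \<noteq> 2 * pot \<delta> \<kappa> (density f) (fst z) - l / n"
    proof (rule AE_lborel_pairI[where P="\<lambda>x (v::R3). (norm v)\<^sup>2 \<noteq> 2 * pot \<delta> \<kappa> (density f) x - l / n"])
      have "(\<lambda>z::phase. (norm (snd z))\<^sup>2) \<in> borel_measurable borel"
        "(\<lambda>z::phase. 2 * pot \<delta> \<kappa> (density f) (fst z) - l / n) \<in> borel_measurable borel"
        by measurable
      from borel_measurable_neq[OF this]
      show "{z::phase. (norm (snd z))\<^sup>2 \<noteq> 2 * pot \<delta> \<kappa> (density f) (fst z) - l / n} \<in> sets borel" by simp
    qed (rule AE_norm_sq_neq)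
    with el have "AE z in lborel. f z = 0"
    proof eventually_elim
      case (elim z)
      have "c z \<noteq> 0" using elim(2) np by (auto simp: c_def field_simps)
      then show ?case using elim(1) m0 F(2)[of z] by (cases "f z = 0") auto
    qed
    then show False using not0 by simp
  qed
  then have mp: "m > 0" using m by simp
  show ?thesis
  proof (rule that[of "2 * n / m" "m / (2 * n)" "- l / m"])
    show "2 * n / m > 0" "m / (2 * n) > 0" using np mp by auto
    show "AE z in lborel. dj (f z) = max 0 (2 * n / m * pot \<delta> \<kappa> (density f) (fst z) + - l / m - (norm (snd z))\<^sup>2 / (2 * (m / (2 * n))))"
      using el
    proof eventually_elim
      case (elim z)
      have eq: "2 * n / m * pot \<delta> \<kappa> (density f) (fst z) + - l / m - (norm (snd z))\<^sup>2 / (2 * (m / (2 * n))) = - c z / m"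
        using np mp by (simp add: c_def field_simps)
      show ?case
      proof (cases "f z = 0")
        case True
        then show ?thesis unfolding eq using elim mp by (simp add: divide_nonpos_pos)
      next
        case False
        then have fz: "f z > 0" using F(2)[of z] by simp
        then have "dj (f z) = - c z / m" using elim mp by (simp add: field_simps)
        then show ?thesis unfolding eq using dj_pos[OF fz] by simp
      qed
    qed
  qed
qed

end

section \<open>Polarization\<close>

text \<open>Since \<open>S\<close> is invariant, the preimage of \<open>A\<close> splits into the
  \<open>T\<close>-preimage of \<open>S \<inter> A\<close>, which stays inside \<open>S\<close>, and
  the untouched part \<open>A - S\<close>.\<close>

lemma scales_swap_on:
  assumes T: "scales_lborel T 1" and S: "S \<in> sets borel" and inv: "\<And>x. T x \<in> S \<longleftrightarrow> x \<in> S"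
  shows "scales_lborel (\<lambda>x. if x \<in> S then T x else x) 1"
proof (rule scales_lborelI)
  have Tm [measurable]: "T \<in> borel_measurable borel" using T by (rule scales_measurable)
  have [measurable]: "S \<in> sets borel" by (rule S)
  show "(\<lambda>x. if x \<in> S then T x else x) \<in> borel_measurable borel" by measurable
  fix A :: "'a set" assume A [measurable]: "A \<in> sets borel"
  have SA [measurable]: "S \<inter> A \<in> sets borel" by simp
  have v: "(\<lambda>x. if x \<in> S then T x else x) -` A = T -` (S \<inter> A) \<union> (A - S)"
    using inv by (auto split: if_splits)
  have "emeasure lborel (T -` (S \<inter> A) \<union> (A - S)) = emeasure lborel (T -` (S \<inter> A)) + emeasure lborel (A - S)"
    using inv measurable_vimage_borel[OF Tm SA] by (intro plus_emeasure[symmetric]) auto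
  also have "emeasure lborel (T -` (S \<inter> A)) = emeasure lborel (S \<inter> A)"
    using scales_emeasure[OF T SA] by simp
  also have "emeasure lborel (S \<inter> A) + emeasure lborel (A - S) = emeasure lborel ((S \<inter> A) \<union> (A - S))"
    by (intro plus_emeasure) auto
  also have "(S \<inter> A) \<union> (A - S) = A" by auto
  finally show "emeasure lborel A = ennreal 1 * emeasure lborel ((\<lambda>x. if x \<in> S then T x else x) -` A)"
    unfolding v by simp
qed simp

lemma AE_inner_neq: "norm e = 1 \<Longrightarrow> AE x::R3 in lborel. x \<bullet> e \<noteq> c"
proof -
  assume e: "norm e = 1"
  have "negligible {x::R3. e \<bullet> x = c}" using e by (intro negligible_hyperplane) auto
  moreover have "closed {x::R3. e \<bullet> x = c}" by (rule closed_hyperplane)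
  ultimately have "{x::R3. e \<bullet> x = c} \<in> null_sets lborel"
    by (simp add: negligible_iff_null_sets null_sets_completion_iff borel_closed)
  then have "AE x::R3 in lborel. x \<notin> {x. e \<bullet> x = c}" by (rule AE_not_in)
  then show ?thesis by eventually_elim (simp add: inner_commute)
qed

text \<open>Reflecting one of two points moves it away from the other if both lie on the same side
  of the plane, and towards it if they lie on opposite sides. The kernel comparison rests on this
  sign.\<close>

lemma norm_mirror_cross:
  assumes "norm e = 1"
  shows "(norm (x - mirror e c y))\<^sup>2 = (norm (x - y))\<^sup>2 + 4 * ((x \<bullet> e - c) * (y \<bullet> e - c))"
proof -
  define s where "s = y \<bullet> e - c"
  define w where "w = x - y"
  have eq: "x - mirror e c y = w + (2 * s) *\<^sub>R e" by (simp add: mirror_def s_def w_def)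
  have "(norm (x - mirror e c y))\<^sup>2 = (norm w)\<^sup>2 + 4 * s * (w \<bullet> e) + 4 * s\<^sup>2"
    using assms unfolding eq power2_norm_eq_inner norm_eq_1
    by (simp add: inner_add_left inner_add_right inner_commute power2_eq_square algebra_simps)
  then show ?thesis by (simp add: w_def s_def inner_diff_left power2_eq_square algebra_simps)
qed

lemma mirror_fix: "x \<bullet> e = c \<Longrightarrow> mirror e c x = x"
  by (simp add: mirror_def)

lemma sgn_mirror: "norm e = 1 \<Longrightarrow> sgn (mirror e c x \<bullet> e - c) = - sgn (x \<bullet> e - c)"
proof -
  assume "norm e = 1"
  then have "mirror e c x \<bullet> e - c = - (x \<bullet> e - c)" by (simp add: mirror_inner)
  then show ?thesis by (metis sgn_minus)
qed

lemma ker_mirror_mirror: "norm e = 1 \<Longrightarrow> ker \<delta> \<kappa> (mirror e c x) (mirror e c y) = ker \<delta> \<kappa> x y"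
  by (rule ker_cong) (rule norm_mirror_diff)

lemma ker_mirror_left: "norm e = 1 \<Longrightarrow> ker \<delta> \<kappa> (mirror e c x) y = ker \<delta> \<kappa> x (mirror e c y)"
  using ker_mirror_mirror[of e \<delta> \<kappa> c x "mirror e c y"] by simp

lemma ker_mirror_cmp:
  assumes e: "norm e = 1" and d: "\<delta> \<ge> 0" "\<kappa> \<ge> 0" "\<delta> + \<kappa> > 0" and ne: "x \<noteq> y" "x \<noteq> mirror e c y"
    and off: "x \<bullet> e \<noteq> c" "y \<bullet> e \<noteq> c"
  shows "sgn (x \<bullet> e - c) * sgn (y \<bullet> e - c) * (ker \<delta> \<kappa> x y - ker \<delta> \<kappa> x (mirror e c y)) > 0"
proof -
  have pos: "0 < norm (x - y)" "0 < norm (x - mirror e c y)" using ne by auto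
  have sg: "sgn (x \<bullet> e - c) * sgn (y \<bullet> e - c) = sgn ((x \<bullet> e - c) * (y \<bullet> e - c))" by (simp add: sgn_mult)
  consider "(x \<bullet> e - c) * (y \<bullet> e - c) > 0" | "(x \<bullet> e - c) * (y \<bullet> e - c) < 0"
    using off by (cases "(x \<bullet> e - c) * (y \<bullet> e - c)" "0::real" rule: linorder_cases) auto
  then show ?thesis
  proof cases
    case 1
    then have "(norm (x - y))\<^sup>2 < (norm (x - mirror e c y))\<^sup>2" using norm_mirror_cross[OF e, of x c y] by simp
    then have "norm (x - y) < norm (x - mirror e c y)" by (rule power_less_imp_less_base) simp
    from ker_strict[OF d pos(1) this] show ?thesis unfolding sg using 1 by simp
  next
    case 2
    then have "(norm (x - mirror e c y))\<^sup>2 < (norm (x - y))\<^sup>2" using norm_mirror_cross[OF e, of x c y] by simp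
    then have "norm (x - mirror e c y) < norm (x - y)" by (rule power_less_imp_less_base) simp
    from ker_strict[OF d pos(2) this] show ?thesis unfolding sg using 2 by simp
  qed
qed

text \<open>By how much the value on the side where \<open>x \<bullet> e > c\<close> exceeds the one
  at the mirror point. It is invariant under the reflection, so its sign belongs to the pair of
  mirror points.\<close>

definition skew :: "(R3 \<Rightarrow> real) \<Rightarrow> R3 \<Rightarrow> real \<Rightarrow> R3 \<Rightarrow> real" where
  "skew \<rho> e c x = (\<rho> x - \<rho> (mirror e c x)) * sgn (x \<bullet> e - c)"

lemma skew_measurable [measurable (raw)]:
  assumes [measurable]: "\<rho> \<in> borel_measurable borel"
  shows "skew \<rho> e c \<in> borel_measurable borel"
  unfolding skew_def[abs_def] sgn_if by measurable

text \<open>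
  Averaging over the four reflected copies of a pair of points splits the interaction into a part
  that only sees the even part of the density and a part that only sees its odd part.
\<close>

lemma interact_symmetrized:
  fixes \<delta> \<kappa> c :: real
  assumes u: "good_density r u" and r: "3 / 2 < r" "r \<le> 2" and e: "norm e = 1"
  defines "\<Psi> \<equiv> \<lambda>z. (u (fst z) + u (mirror e c (fst z))) * (u (snd z) + u (mirror e c (snd z)))
        * (ker \<delta> \<kappa> (fst z) (snd z) + ker \<delta> \<kappa> (fst z) (mirror e c (snd z)))
      + (u (fst z) - u (mirror e c (fst z))) * (u (snd z) - u (mirror e c (snd z)))
        * (ker \<delta> \<kappa> (fst z) (snd z) - ker \<delta> \<kappa> (fst z) (mirror e c (snd z)))"
  shows "integrable lborel \<Psi>" and "(LINT z|lborel. \<Psi> z) = 8 * interact \<delta> \<kappa> u u"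
proof -
  note [measurable] = good_densityD(1)[OF u]
  define \<Phi> where "\<Phi> z = u (fst z) * u (snd z) * ker \<delta> \<kappa> (fst z) (snd z)" for z
  have \<Phi>m: "\<Phi> \<in> borel_measurable borel" unfolding \<Phi>_def[abs_def] by measurable
  have \<Phi>: "integrable lborel \<Phi>" unfolding \<Phi>_def[abs_def] by (rule good_pair_integrable[OF u u r])
  note s = scales_mirror[OF e, of c]
  note s1 = scales_map_fst[OF s, where 'b=R3] and s2 = scales_map_snd[OF s]
  have s12: "scales_lborel (\<lambda>z::R3 \<times> R3. (mirror e c (fst z), mirror e c (snd z))) 1"
    using scales_compose[OF s1 s2] by simp
  note i = \<Phi> scales_integrable_iff[OF s1 \<Phi>m, THEN iffD2, OF \<Phi>] scales_integrable_iff[OF s2 \<Phi>m, THEN iffD2, OF \<Phi>]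
    scales_integrable_iff[OF s12 \<Phi>m, THEN iffD2, OF \<Phi>]
  \<comment> \<open>Expanding the products leaves each of the four reflected copies of
    \<open>\<Phi>\<close> twice; all four have the same integral, whence the factor 8.\<close>
  have \<Psi>: "\<Psi> z = 2 * (\<Phi> z + \<Phi> (mirror e c (fst z), snd z) + \<Phi> (fst z, mirror e c (snd z)) + \<Phi> (mirror e c (fst z), mirror e c (snd z)))" for z
    by (simp add: \<Psi>_def \<Phi>_def ker_mirror_mirror[OF e] ker_mirror_left[OF e] e algebra_simps)
  show "integrable lborel \<Psi>" unfolding \<Psi> using i by simp
  show "(LINT z|lborel. \<Psi> z) = 8 * interact \<delta> \<kappa> u u"
    unfolding \<Psi> using i scales_integral[OF s1 \<Phi>m] scales_integral[OF s2 \<Phi>m] scales_integral[OF s12 \<Phi>m]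
    by (simp add: interact_def \<Phi>_def[symmetric])
qed

text \<open>\<open>\<tau>\<close> exchanges the values at those mirror pairs whose larger value is
  on the negative side. The even part of \<open>\<rho>\<close> is unchanged and the odd part
  \<open>a\<close> becomes its absolute value with the sign of the side, so eight times the gain in
  interaction is the integral of \<open>\<bar>w\<bar> - w\<close>. No gain forces
  \<open>skew\<close> to have almost everywhere the same sign at two points, hence one sign
  altogether.\<close>

lemma polarization_equality:
  assumes \<rho>: "good_density r \<rho>" and r: "3 / 2 < r" "r \<le> 2" and d: "\<delta> \<ge> 0" "\<kappa> \<ge> 0" "\<delta> + \<kappa> > 0" and e: "norm e = 1"
    and S: "S = {x. skew \<rho> e c x < 0}"
    and \<tau>: "\<tau> = (\<lambda>x. if x \<in> S then mirror e c x else x)"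
    and good: "good_density r (\<lambda>x. \<rho> (\<tau> x))"
    and le: "interact \<delta> \<kappa> (\<lambda>x. \<rho> (\<tau> x)) (\<lambda>x. \<rho> (\<tau> x)) \<le> interact \<delta> \<kappa> \<rho> \<rho>"
  shows "(AE x in lborel. skew \<rho> e c x \<ge> 0) \<or> (AE x in lborel. skew \<rho> e c x \<le> 0)"
proof -
  note [measurable] = good_densityD(1)[OF \<rho>]
  define a where "a x = \<rho> x - \<rho> (mirror e c x)" for x
  define k where "k z = ker \<delta> \<kappa> (fst z) (snd z) - ker \<delta> \<kappa> (fst z) (mirror e c (snd z))" for z
  define w where "w z = a (fst z) * a (snd z) * k z" for z
  have skew_inv: "skew \<rho> e c (mirror e c x) = skew \<rho> e c x" for x
    unfolding skew_def sgn_mirror[OF e] by (simp add: e algebra_simps)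
  have Sinv: "mirror e c x \<in> S \<longleftrightarrow> x \<in> S" for x by (simp add: S skew_inv)
  have even: "\<rho> (\<tau> x) + \<rho> (\<tau> (mirror e c x)) = \<rho> x + \<rho> (mirror e c x)" for x
    by (simp add: \<tau> Sinv e)
  have odd: "\<rho> (\<tau> x) - \<rho> (\<tau> (mirror e c x)) = \<bar>a x\<bar> * sgn (x \<bullet> e - c)" for x
  proof -
    have 1: "\<rho> (\<tau> x) - \<rho> (\<tau> (mirror e c x)) = (if x \<in> S then - a x else a x)"
      by (simp add: \<tau> Sinv e a_def)
    have 2: "x \<in> S \<longleftrightarrow> a x * sgn (x \<bullet> e - c) < 0" by (simp add: S skew_def a_def)
    consider "x \<bullet> e = c" | "x \<bullet> e > c" | "x \<bullet> e < c" by linarith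
    then show ?thesis
    proof cases
      case 1
      then have "a x = 0" by (simp add: a_def mirror_fix)
      then show ?thesis unfolding \<open>\<rho> (\<tau> x) - \<rho> (\<tau> (mirror e c x)) = _\<close> by simp
    qed (auto simp: 1 2)
  qed
  define \<Psi> where "\<Psi> z = (\<rho> (fst z) + \<rho> (mirror e c (fst z))) * (\<rho> (snd z) + \<rho> (mirror e c (snd z)))
        * (ker \<delta> \<kappa> (fst z) (snd z) + ker \<delta> \<kappa> (fst z) (mirror e c (snd z)))" for z
  note I0 = interact_symmetrized[OF \<rho> r e, of c \<delta> \<kappa>]
  note I1 = interact_symmetrized[OF good r e, of c \<delta> \<kappa>, unfolded even odd]
  have i0: "integrable lborel (\<lambda>z. \<Psi> z + w z)" "(LINT z|lborel. \<Psi> z + w z) = 8 * interact \<delta> \<kappa> \<rho> \<rho>"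
    using I0 by (simp_all add: \<Psi>_def w_def a_def k_def)
  define w' where "w' z = (\<bar>a (fst z)\<bar> * sgn (fst z \<bullet> e - c)) * (\<bar>a (snd z)\<bar> * sgn (snd z \<bullet> e - c)) * k z" for z
  have i1: "integrable lborel (\<lambda>z. \<Psi> z + w' z)"
    "(LINT z|lborel. \<Psi> z + w' z) = 8 * interact \<delta> \<kappa> (\<lambda>x. \<rho> (\<tau> x)) (\<lambda>x. \<rho> (\<tau> x))"
    using I1 by (simp_all add: \<Psi>_def w'_def a_def k_def)
  have ne: "AE z in lborel. fst z \<noteq> mirror e c (snd z :: R3)"
    using scales_AE[OF scales_map_snd[OF scales_mirror[OF e, of c]] AE_fst_neq_snd] by simp
  have cmp: "AE z in lborel. sgn (fst z \<bullet> e - c) * sgn (snd z \<bullet> e - c) * k z > 0"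
    using AE_fst_neq_snd[where 'a=R3] ne AE_lborel_fst[OF AE_inner_neq[OF e, of c], where 'b=R3] AE_lborel_snd[OF AE_inner_neq[OF e, of c]]
    by eventually_elim (auto simp: k_def intro!: ker_mirror_cmp[OF e d])
  \<comment> \<open>The product of the two side signs is almost everywhere the sign of
    \<open>k\<close>, so it turns \<open>k\<close> into its absolute value.\<close>
  have w': "AE z in lborel. w' z = \<bar>w z\<bar>"
    using cmp
  proof eventually_elim
    case (elim z)
    define t where "t = sgn (fst z \<bullet> e - c) * sgn (snd z \<bullet> e - c)"
    have "t * k z > 0" using elim by (simp add: t_def)
    moreover have "\<bar>t\<bar> \<le> 1" "t = 1 \<or> t = - 1 \<or> t = 0" by (auto simp: t_def sgn_if)
    ultimately have "t * k z = \<bar>k z\<bar>" by auto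
    moreover have "w' z = \<bar>a (fst z)\<bar> * \<bar>a (snd z)\<bar> * (t * k z)" by (simp add: w'_def t_def mult_ac)
    ultimately show ?case by (simp add: w_def abs_mult)
  qed
  have iw: "integrable lborel (\<lambda>z. w' z - w z)" "(LINT z|lborel. w' z - w z) \<le> 0"
  proof -
    have eq: "w' z - w z = (\<Psi> z + w' z) - (\<Psi> z + w z)" for z by simp
    show "integrable lborel (\<lambda>z. w' z - w z)" unfolding eq using i0(1) i1(1) by (rule Bochner_Integration.integrable_diff[rotated])
    have "(LINT z|lborel. w' z - w z) = (LINT z|lborel. \<Psi> z + w' z) - (LINT z|lborel. \<Psi> z + w z)"
      unfolding eq by (rule Bochner_Integration.integral_diff[OF i1(1) i0(1)])
    then show "(LINT z|lborel. w' z - w z) \<le> 0" using i0(2) i1(2) le by simp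
  qed
  have nn: "AE z in lborel. 0 \<le> w' z - w z" using w' by eventually_elim simp
  have "(LINT z|lborel. w' z - w z) = 0" using integral_nonneg_AE[OF nn] iw(2) by simp
  then have "AE z in lborel. w' z - w z = 0" using integral_nonneg_eq_0_iff_AE[OF iw(1) nn] by simp
  \<comment> \<open>Multiplying \<open>w z\<close>, which equals its absolute value, by the positive
    quantity from \<open>cmp\<close> gives the product of the two skews times the square of
    \<open>k z\<close>.\<close>
  with w' cmp have pos: "AE z in lborel. skew \<rho> e c (fst z) * skew \<rho> e c (snd z) \<ge> 0"
  proof eventually_elim
    case (elim z)
    then have "a (fst z) * a (snd z) * k z \<ge> 0" by (simp add: w_def)
    then have "(a (fst z) * a (snd z) * k z) * (sgn (fst z \<bullet> e - c) * sgn (snd z \<bullet> e - c) * k z) \<ge> 0"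
      by (rule mult_nonneg_nonneg[OF _ less_imp_le[OF elim(2)]])
    then have "(skew \<rho> e c (fst z) * skew \<rho> e c (snd z)) * (k z * k z) \<ge> 0"
      by (simp add: skew_def a_def mult_ac)
    moreover have "k z * k z > 0" using elim(2) by (cases "k z = 0") (auto simp: zero_less_mult_iff)
    ultimately show ?case by (simp add: zero_le_mult_iff)
  qed
  \<comment> \<open>The product of \<open>P\<close> and \<open>N\<close> is a null set, so one of
    its two factors is.\<close>
  define P where "P = {x. skew \<rho> e c x > 0}"
  define N where "N = {x. skew \<rho> e c x < 0}"
  have PN: "P \<in> sets lborel" "N \<in> sets lborel" by (auto simp: P_def N_def)
  have "AE z in lborel. z \<notin> P \<times> N" using pos by eventually_elim (auto simp: P_def N_def mult_pos_neg not_less[symmetric])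
  moreover have PNs: "P \<times> N \<in> sets (lborel \<Otimes>\<^sub>M lborel)" using PN by (rule pair_measureI)
  ultimately have "emeasure (lborel \<Otimes>\<^sub>M lborel) (P \<times> N) = 0"
    unfolding lborel_prod by (subst (asm) AE_iff_measurable[OF _ refl]) auto
  then have "emeasure lborel P * emeasure lborel N = 0"
    using lborel.emeasure_pair_measure_Times[OF PN] by simp
  then consider "emeasure lborel P = 0" | "emeasure lborel N = 0" by auto
  then show ?thesis
  proof cases
    case 1
    then have "AE x in lborel. x \<notin> P" using PN by (intro AE_not_in null_setsI) auto
    then show ?thesis by (auto simp: P_def not_less)
  next
    case 2
    then have "AE x in lborel. x \<notin> N" using PN by (intro AE_not_in null_setsI) auto
    then show ?thesis by (auto simp: N_def not_less)
  qed
qed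

section \<open>Rearranged competitors for a minimizer\<close>

context casimir begin

lemma rearranged:
  assumes f: "f \<in> energy_space j" and T: "scales_lborel T 1"
  defines "g \<equiv> \<lambda>z. f (T (fst z), snd z)"
  shows "g \<in> energy_space j" "(LINT z|lborel. g z) = (LINT z|lborel. f z)"
    "(LINT z|lborel. j (g z)) = (LINT z|lborel. j (f z))" "kinetic g = kinetic f"
    "density g x = density f (T x)"
proof -
  note F = energy_spaceD[OF f]
  note [measurable] = F(1) scales_measurable[OF T]
  note s = scales_map_fst[OF T, where 'b=R3]
  note sm = scales_measurable[OF s]
  have jm: "(\<lambda>z. j (f z)) \<in> borel_measurable borel" using F(1,2) by (rule j_comp_measurable)
  have km: "(\<lambda>z. (norm (snd z))\<^sup>2 * f z) \<in> borel_measurable borel" by measurable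
  have gm: "g \<in> borel_measurable borel" unfolding g_def using measurable_compose[OF sm F(1)] .
  show g: "g \<in> energy_space j"
    by (rule energy_spaceI[OF gm])
      (use F(2) scales_integrable_iff[OF s F(1)] scales_integrable_iff[OF s jm] scales_integrable_iff[OF s km] F(3-5) in \<open>simp_all add: g_def\<close>)
  show "(LINT z|lborel. g z) = (LINT z|lborel. f z)" using scales_integral[OF s F(1)] by (simp add: g_def)
  show "(LINT z|lborel. j (g z)) = (LINT z|lborel. j (f z))" using scales_integral[OF s jm] by (simp add: g_def)
  show "kinetic g = kinetic f"
    unfolding kinetic_eq[OF g] kinetic_eq[OF f] using scales_integral[OF s km] by (simp add: g_def)
  show "density g x = density f (T x)" by (simp add: density_def g_def)
qed

text \<open>The swap acts on positions only, so it preserves both constraints and the kinetic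
  energy. Minimality then says that the interaction energy does not grow, as
  \<open>polarization_equality\<close> requires.\<close>

lemma polarization_dichotomy:
  assumes min: "is_min \<delta> \<kappa> f" and e: "norm e = 1"
  shows "(AE x in lborel. skew (density f) e c x \<ge> 0) \<or> (AE x in lborel. skew (density f) e c x \<le> 0)"
proof -
  have d: "\<delta> \<ge> 0" "\<kappa> \<ge> 0" "\<delta> + \<kappa> > 0" and f: "f \<in> energy_space j" using min by (auto simp: is_min_def)
  define \<rho> where "\<rho> = density f"
  have \<rho>: "good_density r \<rho>" unfolding \<rho>_def by (rule good_density_density[OF f])
  note [measurable] = good_densityD(1)[OF \<rho>]
  define S where "S = {x. skew \<rho> e c x < 0}"
  define \<tau> where "\<tau> = (\<lambda>x. if x \<in> S then mirror e c x else x)"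
  have Sinv: "mirror e c x \<in> S \<longleftrightarrow> x \<in> S" for x
    unfolding S_def skew_def mem_Collect_eq sgn_mirror[OF e] by (simp add: e algebra_simps)
  have \<tau>s: "scales_lborel \<tau> 1"
    unfolding \<tau>_def by (rule scales_swap_on[OF scales_mirror[OF e] _ Sinv]) (simp add: S_def)
  define g where "g z = f (\<tau> (fst z), snd z)" for z
  note R = rearranged[OF f \<tau>s, folded g_def]
  have dg: "density g = (\<lambda>x. \<rho> (\<tau> x))" using R(5) by (auto simp: \<rho>_def)
  have "Hamiltonian \<delta> \<kappa> f \<le> Hamiltonian \<delta> \<kappa> g" using min R by (simp add: is_min_def)
  then have "interact \<delta> \<kappa> (\<lambda>x. \<rho> (\<tau> x)) (\<lambda>x. \<rho> (\<tau> x)) \<le> interact \<delta> \<kappa> \<rho> \<rho>"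
    unfolding Hamiltonian_def Epot_eq(3)[OF f] Epot_eq(3)[OF R(1)] R(4) dg \<rho>_def by simp
  moreover have "good_density r (\<lambda>x. \<rho> (\<tau> x))" using good_density_density[OF R(1)] dg by simp
  ultimately show ?thesis
    using polarization_equality[OF \<rho> r_bounds d e S_def \<tau>_def] by (simp add: \<rho>_def)
qed

end

section \<open>Radial symmetry of the potential\<close>

text \<open>Mass on the positive side of the plane minus mass on the negative side; its zeros are
  the median planes.\<close>

definition tilt :: "(R3 \<Rightarrow> real) \<Rightarrow> R3 \<Rightarrow> real \<Rightarrow> real" where
  "tilt \<rho> e c = (LINT x|lborel. \<rho> x * sgn (x \<bullet> e - c))"

lemma sgn_borel_measurable [measurable (raw)]:
  fixes f :: "'a \<Rightarrow> real"
  assumes [measurable]: "f \<in> borel_measurable M"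
  shows "(\<lambda>x. sgn (f x)) \<in> borel_measurable M"
  unfolding sgn_if by measurable

lemma abs_sgn_le_1: "\<bar>sgn (t::real)\<bar> \<le> 1"
  by (simp add: sgn_if)

lemma integrable_mult_sgn:
  fixes \<rho> :: "'a \<Rightarrow> real"
  assumes "integrable M \<rho>" "s \<in> borel_measurable M"
  shows "integrable M (\<lambda>x. \<rho> x * sgn (s x :: real))"
proof (rule Bochner_Integration.integrable_bound[OF assms(1)])
  have [measurable]: "\<rho> \<in> borel_measurable M" "s \<in> borel_measurable M" using assms by auto
  show "(\<lambda>x. \<rho> x * sgn (s x)) \<in> borel_measurable M" by measurable
  show "AE x in M. norm (\<rho> x * sgn (s x)) \<le> norm (\<rho> x)"
    using mult_left_mono[OF abs_sgn_le_1 abs_ge_zero] by (intro AE_I2) (simp add: abs_mult)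
qed

lemma tilt_tendsto:
  assumes \<rho>: "integrable lborel \<rho>" and lim: "AE x in lborel. (\<lambda>n. sgn (x \<bullet> e - c n)) \<longlonglongrightarrow> s x"
    and s: "s \<in> borel_measurable borel"
  shows "(\<lambda>n. tilt \<rho> e (c n)) \<longlonglongrightarrow> (LINT x|lborel. \<rho> x * s x)"
  unfolding tilt_def
proof (rule integral_dominated_convergence[where w="\<lambda>x. \<bar>\<rho> x\<bar>"])
  have [measurable]: "\<rho> \<in> borel_measurable borel" "s \<in> borel_measurable borel" using \<rho> s by auto
  show "(\<lambda>x. \<rho> x * s x) \<in> borel_measurable lborel" by measurable
  show "(\<lambda>x. \<rho> x * sgn (x \<bullet> e - c n)) \<in> borel_measurable lborel" for n by measurable
  show "integrable lborel (\<lambda>x. \<bar>\<rho> x\<bar>)" using \<rho> by simp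
  show "AE x in lborel. (\<lambda>n. \<rho> x * sgn (x \<bullet> e - c n)) \<longlonglongrightarrow> \<rho> x * s x"
    using lim by eventually_elim (intro tendsto_intros)
  show "AE x in lborel. norm (\<rho> x * sgn (x \<bullet> e - c n)) \<le> \<bar>\<rho> x\<bar>" for n
    using mult_left_mono[OF abs_sgn_le_1 abs_ge_zero] by (intro AE_I2) (simp add: abs_mult)
qed

text \<open>Planes are null sets, so the imbalance is continuous in \<open>c\<close>; it tends to
  the total mass and to its negative as the plane moves to either end.\<close>

lemma median_exists:
  assumes \<rho>: "integrable lborel \<rho>" and pos: "(LINT x|lborel. \<rho> x) > 0" and e: "norm e = 1"
  obtains c where "tilt \<rho> e c = 0"
proof -
  have "continuous_on UNIV (tilt \<rho> e)"
    unfolding continuous_on_sequentially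
  proof (intro allI ballI impI)
    fix c :: "nat \<Rightarrow> real" and c0 assume "(\<forall>n. c n \<in> UNIV) \<and> c \<longlonglongrightarrow> c0"
    then have c: "c \<longlonglongrightarrow> c0" by simp
    have "AE x in lborel. (\<lambda>n. sgn (x \<bullet> e - c n)) \<longlonglongrightarrow> sgn (x \<bullet> e - c0)"
      using AE_inner_neq[OF e, of c0]
      by eventually_elim (intro tendsto_sgn tendsto_diff tendsto_const c, simp)
    from tilt_tendsto[OF \<rho> this] show "(tilt \<rho> e \<circ> c) \<longlonglongrightarrow> tilt \<rho> e c0"
      by (simp add: tilt_def[of \<rho> e c0] o_def)
  qed
  moreover have "(\<lambda>n. tilt \<rho> e (real n)) \<longlonglongrightarrow> (LINT x|lborel. \<rho> x * (- 1))"
  proof (rule tilt_tendsto[OF \<rho>])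
    have "(\<lambda>n. sgn (x \<bullet> e - real n)) \<longlonglongrightarrow> - 1" for x :: R3
    proof (rule tendsto_eventually)
      obtain N where "x \<bullet> e < real N" using reals_Archimedean2 by blast
      then have "sgn (x \<bullet> e - real n) = - 1" if "n \<ge> N" for n using that by simp
      then show "\<forall>\<^sub>F n in sequentially. sgn (x \<bullet> e - real n) = - 1" unfolding eventually_sequentially by blast
    qed
    then show "AE x in lborel. (\<lambda>n. sgn (x \<bullet> e - real n)) \<longlonglongrightarrow> - 1" by simp
  qed simp
  then have "\<forall>\<^sub>F n in sequentially. tilt \<rho> e (real n) < 0" by (rule order_tendstoD) (use pos in simp)
  then obtain n where n: "tilt \<rho> e (real n) < 0" by (auto simp: eventually_sequentially)
  have "(\<lambda>n. tilt \<rho> e (- real n)) \<longlonglongrightarrow> (LINT x|lborel. \<rho> x * 1)"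
  proof (rule tilt_tendsto[OF \<rho>])
    have "(\<lambda>n. sgn (x \<bullet> e - (- real n))) \<longlonglongrightarrow> 1" for x :: R3
    proof (rule tendsto_eventually)
      obtain N where "- (x \<bullet> e) < real N" using reals_Archimedean2 by blast
      then have "sgn (x \<bullet> e - (- real n)) = 1" if "n \<ge> N" for n using that by simp
      then show "\<forall>\<^sub>F n in sequentially. sgn (x \<bullet> e - (- real n)) = 1" unfolding eventually_sequentially by blast
    qed
    then show "AE x in lborel. (\<lambda>n. sgn (x \<bullet> e - (- real n))) \<longlonglongrightarrow> 1" by simp
  qed simp
  then have "\<forall>\<^sub>F n in sequentially. tilt \<rho> e (- real n) > 0" by (rule order_tendstoD) (use pos in simp)
  then obtain m where m: "tilt \<rho> e (- real m) > 0" by (auto simp: eventually_sequentially)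
  ultimately show ?thesis
    using IVT2'[of "tilt \<rho> e" "real n" 0 "- real m"] n m that continuous_on_subset[of UNIV "tilt \<rho> e" "{- real m..real n}"] by auto
qed

lemma tilt_skew:
  assumes \<rho>: "integrable lborel \<rho>" and e: "norm e = 1"
  shows "integrable lborel (skew \<rho> e c)" "(LINT x|lborel. skew \<rho> e c x) = 2 * tilt \<rho> e c"
proof -
  have [measurable]: "\<rho> \<in> borel_measurable borel" using \<rho> by auto
  have i: "integrable lborel (\<lambda>x. \<rho> x * sgn (x \<bullet> e - c))" by (rule integrable_mult_sgn[OF \<rho>]) simp
  have eq: "skew \<rho> e c x = \<rho> x * sgn (x \<bullet> e - c) + \<rho> (mirror e c x) * sgn (mirror e c x \<bullet> e - c)" for x
    unfolding skew_def sgn_mirror[OF e] by (simp add: algebra_simps)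
  have i': "integrable lborel (\<lambda>x. \<rho> (mirror e c x) * sgn (mirror e c x \<bullet> e - c))"
    by (subst scales_integrable_iff[OF scales_mirror[OF e], of "\<lambda>x. \<rho> x * sgn (x \<bullet> e - c)"]) (use i in auto)
  have "(LINT x|lborel. \<rho> x * sgn (x \<bullet> e - c)) = (LINT x|lborel. \<rho> (mirror e c x) * sgn (mirror e c x \<bullet> e - c))"
    using scales_integral[OF scales_mirror[OF e], of "\<lambda>x. \<rho> x * sgn (x \<bullet> e - c)"] by simp
  then show "integrable lborel (skew \<rho> e c)" "(LINT x|lborel. skew \<rho> e c x) = 2 * tilt \<rho> e c"
    unfolding eq using i i' by (simp_all add: tilt_def)
qed

text \<open>The integral of \<open>skew\<close> is twice the imbalance, and \<open>skew\<close> has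
  one sign. A zero integral forces it to vanish, and a nonpositive integral settles which sign it
  has.\<close>

lemma mirror_symmetric_if_balanced:
  assumes \<rho>: "integrable lborel \<rho>" and e: "norm e = 1"
    and dich: "(AE x in lborel. skew \<rho> e c x \<ge> 0) \<or> (AE x in lborel. skew \<rho> e c x \<le> 0)"
  shows "tilt \<rho> e c = 0 \<Longrightarrow> AE x in lborel. \<rho> (mirror e c x) = \<rho> x"
    and "tilt \<rho> e c \<le> 0 \<Longrightarrow> AE x in lborel. skew \<rho> e c x \<le> 0"
proof -
  note T = tilt_skew[OF \<rho> e, of c]
  have z: "AE x in lborel. skew \<rho> e c x = 0" if "tilt \<rho> e c = 0"
    using dich
  proof
    assume nn: "AE x in lborel. skew \<rho> e c x \<ge> 0"
    show ?thesis using integral_nonneg_eq_0_iff_AE[OF T(1) nn] T(2) that by simp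
  next
    assume "AE x in lborel. skew \<rho> e c x \<le> 0"
    then have nn: "AE x in lborel. - skew \<rho> e c x \<ge> 0" by simp
    have "AE x in lborel. - skew \<rho> e c x = 0"
      using integral_nonneg_eq_0_iff_AE[OF integrable_minus[OF T(1)] nn] T(2) that by simp
    then show ?thesis by simp
  qed
  show "AE x in lborel. \<rho> (mirror e c x) = \<rho> x" if "tilt \<rho> e c = 0"
    using z[OF that] AE_inner_neq[OF e, of c] by eventually_elim (auto simp: skew_def sgn_if split: if_splits)
  show "AE x in lborel. skew \<rho> e c x \<le> 0" if "tilt \<rho> e c \<le> 0"
    using dich
  proof
    assume nn: "AE x in lborel. skew \<rho> e c x \<ge> 0"
    have "tilt \<rho> e c \<ge> 0" using integral_nonneg_AE[OF nn] T(2) by simp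
    then show ?thesis using z that by (auto elim: eventually_mono)
  qed
qed

lemma tilt_antimono:
  assumes \<rho>: "integrable lborel \<rho>" "\<And>x. \<rho> x \<ge> 0" and "c \<le> c'"
  shows "tilt \<rho> e c' \<le> tilt \<rho> e c"
  unfolding tilt_def
proof (rule integral_mono)
  show "integrable lborel (\<lambda>x. \<rho> x * sgn (x \<bullet> e - c'))" "integrable lborel (\<lambda>x. \<rho> x * sgn (x \<bullet> e - c))"
    by (intro integrable_mult_sgn \<rho>; simp)+
  show "\<rho> x * sgn (x \<bullet> e - c') \<le> \<rho> x * sgn (x \<bullet> e - c)" for x
    using assms by (intro mult_left_mono) (auto simp: sgn_if)
qed

lemma mirror_axis: "mirror (axis k 1 :: R3) c x $ i = (if i = k then 2 * c - x $ k else x $ i)"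
  unfolding mirror_def inner_axis by (simp add: axis_def)

lemma mirror_axes:
  fixes a x :: R3
  shows "mirror (axis 1 1) (a $ 1) (mirror (axis 2 1) (a $ 2) (mirror (axis 3 1) (a $ 3) x)) = 2 *\<^sub>R a - x"
  by (simp add: vec_eq_iff forall_3 mirror_axis)

text \<open>Averaging over \<open>y\<close> and its mirror image, the integrands at \<open>x\<close>
  and at the mirror image of \<open>x\<close> differ by the odd part of \<open>\<rho>\<close> times
  a kernel difference. Both signs are known: mass dominates on the negative side, and
  \<open>x\<close> is on the positive one.\<close>

lemma upot_mirror_le:
  assumes \<rho>: "good_density r \<rho>" and d: "\<delta> \<ge> 0" "\<kappa> \<ge> 0" "\<delta> + \<kappa> > 0" and e: "norm e = 1"
    and skew: "AE y in lborel. skew \<rho> e c y \<le> 0" and x: "x \<bullet> e \<ge> c"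
  shows "upot \<delta> \<kappa> \<rho> x \<le> upot \<delta> \<kappa> \<rho> (mirror e c x)"
proof (cases "x \<bullet> e = c")
  case True
  then show ?thesis by (simp add: mirror_fix)
next
  case False
  note [measurable] = good_densityD(1)[OF \<rho>]
  note nn = good_densityD(2)[OF \<rho>]
  note kn = ker_nonneg[OF d(1,2)]
  have dbl: "2 * upot \<delta> \<kappa> \<rho> u = (\<integral>\<^sup>+y. ennreal (\<rho> y * ker \<delta> \<kappa> u y + \<rho> (mirror e c y) * ker \<delta> \<kappa> u (mirror e c y)) \<partial>lborel)" for u
  proof -
    have "(\<integral>\<^sup>+y. ennreal (\<rho> y * ker \<delta> \<kappa> u y) \<partial>lborel) = (\<integral>\<^sup>+y. ennreal (\<rho> (mirror e c y) * ker \<delta> \<kappa> u (mirror e c y)) \<partial>lborel)"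
      using scales_nn_integral[OF scales_mirror[OF e], of "\<lambda>y. ennreal (\<rho> y * ker \<delta> \<kappa> u y)" c] by simp
    then have "2 * upot \<delta> \<kappa> \<rho> u = (\<integral>\<^sup>+y. ennreal (\<rho> y * ker \<delta> \<kappa> u y) \<partial>lborel)
       + (\<integral>\<^sup>+y. ennreal (\<rho> (mirror e c y) * ker \<delta> \<kappa> u (mirror e c y)) \<partial>lborel)"
      unfolding upot_def by (simp add: mult_2)
    also have "\<dots> = (\<integral>\<^sup>+y. ennreal (\<rho> y * ker \<delta> \<kappa> u y + \<rho> (mirror e c y) * ker \<delta> \<kappa> u (mirror e c y)) \<partial>lborel)"
      using nn kn by (subst nn_integral_add[symmetric]) (auto simp: ennreal_plus[symmetric] simp del: ennreal_plus)
    finally show ?thesis .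
  qed
  have ae: "AE y in lborel. y \<noteq> x" "AE y in lborel. y \<noteq> mirror e c x" by (rule AE_lborel_singleton)+
  have "2 * upot \<delta> \<kappa> \<rho> x \<le> 2 * upot \<delta> \<kappa> \<rho> (mirror e c x)"
    unfolding dbl
  proof (rule nn_integral_mono_AE)
    show "AE y in lborel. ennreal (\<rho> y * ker \<delta> \<kappa> x y + \<rho> (mirror e c y) * ker \<delta> \<kappa> x (mirror e c y))
       \<le> ennreal (\<rho> y * ker \<delta> \<kappa> (mirror e c x) y + \<rho> (mirror e c y) * ker \<delta> \<kappa> (mirror e c x) (mirror e c y))"
      using skew ae AE_inner_neq[OF e, of c]
    proof eventually_elim
      case (elim y)
      define s where "s = sgn (y \<bullet> e - c)"
      define k where "k = ker \<delta> \<kappa> x y - ker \<delta> \<kappa> x (mirror e c y)"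
      have "x \<noteq> mirror e c y" using elim(3) e by auto
      from ker_mirror_cmp[OF e d not_sym[OF elim(2)] this False elim(4)]
      have sk: "s * k > 0" using x False by (simp add: s_def k_def)
      have "(\<rho> y - \<rho> (mirror e c y)) * s \<le> 0" using elim(1) by (simp add: skew_def s_def)
      then have "((\<rho> y - \<rho> (mirror e c y)) * s) * (s * k) \<le> 0" using sk by (simp add: mult_nonpos_nonneg)
      moreover have "s * s = 1" using elim(4) by (simp add: s_def sgn_if)
      then have "((\<rho> y - \<rho> (mirror e c y)) * s) * (s * k) = (\<rho> y - \<rho> (mirror e c y)) * k"
        by (metis (no_types, opaque_lifting) mult.assoc mult.left_neutral mult.left_commute)
      ultimately have "(\<rho> y - \<rho> (mirror e c y)) * k \<le> 0" by simp
      then have "\<rho> y * ker \<delta> \<kappa> x y + \<rho> (mirror e c y) * ker \<delta> \<kappa> x (mirror e c y)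
        \<le> \<rho> y * ker \<delta> \<kappa> x (mirror e c y) + \<rho> (mirror e c y) * ker \<delta> \<kappa> x y"
        by (simp add: k_def algebra_simps)
      then show ?case unfolding ker_mirror_mirror[OF e] ker_mirror_left[OF e] mirror_mirror[OF e] by (rule ennreal_leI)
    qed
  qed
  then show ?thesis by (subst (asm) ennreal_mult_le_mult_iff) auto
qed

section \<open>The centre of symmetry\<close>

context casimir begin

text \<open>The medians in the coordinate directions define \<open>a\<close>. For two points,
  consider their perpendicular bisecting plane: the centre lies on the side of the nearer point or
  on the plane, so the density dominates on that side and the potential is larger at the nearer
  point.\<close>

lemma potential_radial:
  assumes min: "is_min \<delta> \<kappa> f"
  obtains a where "radially_decreasing (\<lambda>x. pot \<delta> \<kappa> (density f) (a + x))"
proof -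
  have d: "\<delta> \<ge> 0" "\<kappa> \<ge> 0" "\<delta> + \<kappa> > 0" and f: "f \<in> energy_space j" and mass: "(LINT z|lborel. f z) > 0"
    using min by (auto simp: is_min_def)
  define \<rho> where "\<rho> = density f"
  have \<rho>: "good_density r \<rho>" unfolding \<rho>_def by (rule good_density_density[OF f])
  note i = good_densityD(3)[OF \<rho>]
  note nn = good_densityD(2)[OF \<rho>]
  note [measurable] = good_densityD(1)[OF \<rho>]
  have pos: "(LINT x|lborel. \<rho> x) > 0" unfolding \<rho>_def mass_density[OF f] by (rule mass)
  have dich: "(AE x in lborel. skew \<rho> e c x \<ge> 0) \<or> (AE x in lborel. skew \<rho> e c x \<le> 0)" if "norm e = 1" for e c
    unfolding \<rho>_def by (rule polarization_dichotomy[OF min that])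
  have "\<exists>c. AE x in lborel. \<rho> (mirror e c x) = \<rho> x" if e: "norm e = 1" for e
    using median_exists[OF i pos e] mirror_symmetric_if_balanced(1)[OF i e dich[OF e]] by metis
  then obtain C where C: "\<And>e. norm e = 1 \<Longrightarrow> AE x in lborel. \<rho> (mirror e (C e) x) = \<rho> x" by metis
  define a :: R3 where "a = (\<chi> k. C (axis k 1))"
  have ax: "AE x in lborel. \<rho> (mirror (axis k 1) (a $ k) x) = \<rho> x" for k
    unfolding a_def by simp (rule C, simp)
  have s: "scales_lborel (mirror (axis k 1 :: R3) c) 1" for k :: 3 and c by (rule scales_mirror) simp
  have sR: "scales_lborel (\<lambda>x. 2 *\<^sub>R a - x) 1"
    using scales_compose[OF s[of 1 "a $ 1"] scales_compose[OF s[of 2 "a $ 2"] s[of 3 "a $ 3"]]] unfolding mirror_axes by simp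
  \<comment> \<open>The three coordinate reflections compose to the point reflection in
    \<open>a\<close>. This makes every plane through \<open>a\<close> balanced, whatever its
    normal.\<close>
  have even: "AE x in lborel. \<rho> (2 *\<^sub>R a - x) = \<rho> x"
    unfolding mirror_axes[symmetric]
    using ax[of 3] scales_AE[OF s[of 3 "a $ 3"] ax[of 2]]
      scales_AE[OF scales_compose[OF s[of 2 "a $ 2"] s[of 3 "a $ 3"], simplified] ax[of 1]]
    by eventually_elim simp
  have tilt0: "tilt \<rho> e (a \<bullet> e) = 0" for e
  proof -
    have "tilt \<rho> e (a \<bullet> e) = (LINT x|lborel. \<rho> (2 *\<^sub>R a - x) * sgn ((2 *\<^sub>R a - x) \<bullet> e - a \<bullet> e))"
      unfolding tilt_def using scales_integral[OF sR, of "\<lambda>x. \<rho> x * sgn (x \<bullet> e - a \<bullet> e)"] by simp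
    also have "\<dots> = (LINT x|lborel. - (\<rho> x * sgn (x \<bullet> e - a \<bullet> e)))"
    proof (rule integral_cong_AE)
      have [measurable]: "(\<lambda>x. 2 *\<^sub>R a - x) \<in> borel_measurable borel" by measurable
      show "(\<lambda>x. \<rho> (2 *\<^sub>R a - x) * sgn ((2 *\<^sub>R a - x) \<bullet> e - a \<bullet> e)) \<in> borel_measurable lborel" by measurable
      show "AE x in lborel. \<rho> (2 *\<^sub>R a - x) * sgn ((2 *\<^sub>R a - x) \<bullet> e - a \<bullet> e) = - (\<rho> x * sgn (x \<bullet> e - a \<bullet> e))"
        using even
      proof eventually_elim
        case (elim x)
        have "(2 *\<^sub>R a - x) \<bullet> e - a \<bullet> e = - (x \<bullet> e - a \<bullet> e)" by (simp add: inner_diff_left)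
        then show ?case by (metis elim mult_minus_right sgn_minus)
      qed
    qed measurable
    finally show ?thesis by (simp add: tilt_def)
  qed
  have key: "upot \<delta> \<kappa> \<rho> y \<le> upot \<delta> \<kappa> \<rho> x" if le: "norm (x - a) \<le> norm (y - a)" for x y
  proof (cases "x = y")
    case False
    define n where "n = norm (y - x)"
    have n: "n > 0" using False by (simp add: n_def)
    \<comment> \<open>\<open>e\<close> and \<open>c\<close> describe the perpendicular bisecting
      plane of \<open>x\<close> and \<open>y\<close>, with \<open>y\<close> on the positive
      side.\<close>
    define e where "e = (1 / n) *\<^sub>R (y - x)"
    have e: "norm e = 1" using n by (simp add: e_def n_def)
    define c where "c = ((1 / 2) *\<^sub>R (x + y)) \<bullet> e"
    have nn2: "(y - x) \<bullet> (y - x) = n * n" by (simp add: n_def dot_square_norm power2_eq_square)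
    have yc: "y \<bullet> e - c = n / 2"
    proof -
      have "y \<bullet> e - c = (1 / (2 * n)) * ((y - x) \<bullet> (y - x))"
        using n by (simp add: c_def e_def inner_diff_left inner_diff_right inner_add_left inner_add_right inner_commute field_simps)
      then show ?thesis using nn2 n by simp
    qed
    have m: "mirror e c y = x"
      unfolding mirror_def yc using n by (simp add: e_def)
    have ca: "c - a \<bullet> e = (1 / (2 * n)) * ((norm (y - a))\<^sup>2 - (norm (x - a))\<^sup>2)"
      using n by (simp add: c_def e_def power2_norm_eq_inner inner_diff_left inner_diff_right inner_add_left inner_add_right inner_commute field_simps)
    have "(norm (x - a))\<^sup>2 \<le> (norm (y - a))\<^sup>2" using le by (intro power_mono) auto
    then have "a \<bullet> e \<le> c" using ca n by (smt (verit) mult_nonneg_nonneg zero_le_divide_1_iff)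
    then have "tilt \<rho> e c \<le> 0" using tilt_antimono[OF i nn] tilt0 by metis
    then have "AE x in lborel. skew \<rho> e c x \<le> 0" by (rule mirror_symmetric_if_balanced(2)[OF i e dich[OF e]])
    from upot_mirror_le[OF \<rho> d e this, of y] show ?thesis using yc n m by simp
  qed simp
  \<comment> \<open>An infinite value away from \<open>a\<close> would spread by \<open>key\<close>
    to a whole ball around \<open>a\<close>, against finiteness almost everywhere.\<close>
  have fin: "upot \<delta> \<kappa> \<rho> x < \<infinity>" if "x \<noteq> a" for x
  proof (rule ccontr)
    assume "\<not> ?thesis"
    then have inf: "upot \<delta> \<kappa> \<rho> x = \<infinity>" by (simp add: less_top[symmetric])
    have "upot \<delta> \<kappa> \<rho> y = \<infinity>" if "y \<in> ball a (norm (x - a))" for y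
    proof -
      have "norm (y - a) \<le> norm (x - a)" using that by (simp add: dist_norm norm_minus_commute)
      from key[OF this] show ?thesis using inf by (simp add: top_unique)
    qed
    then have "AE y in lborel. y \<notin> ball a (norm (x - a))"
      using upot_finite_AE[OF \<rho> r_bounds d(1,2)] by (auto elim!: eventually_mono)
    then have "ball a (norm (x - a)) \<in> null_sets lborel"
      by (subst AE_iff_null_sets) auto
    then have "emeasure lborel (ball a (norm (x - a))) = 0" by auto
    then show False using that unit_ball_vol_pos[of 3] by (simp add: emeasure_ball del: unit_ball_vol_pos)
  qed
  have "radially_decreasing (\<lambda>x. pot \<delta> \<kappa> \<rho> (a + x))"
    unfolding radially_decreasing_def
  proof (intro allI impI)
    fix x y :: R3 assume xy: "x \<noteq> 0 \<and> norm x \<le> norm y"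
    have "upot \<delta> \<kappa> \<rho> (a + y) \<le> upot \<delta> \<kappa> \<rho> (a + x)" using key[of "a + x" "a + y"] xy by simp
    then show "pot \<delta> \<kappa> \<rho> (a + y) \<le> pot \<delta> \<kappa> \<rho> (a + x)"
      unfolding pot_eq_upot[OF d(1,2) nn good_densityD(1)[OF \<rho>]]
      using fin[of "a + x"] xy by (intro enn2real_mono) auto
  qed
  then show ?thesis using that by (simp add: \<rho>_def)
qed

end

section \<open>Equality of equimeasurable minimizers\<close>

lemma continuous_AE_eq:
  fixes f g :: "'a::euclidean_space \<Rightarrow> real"
  assumes "continuous_on UNIV f" "continuous_on UNIV g" and ae: "AE x in lborel. f x = g x"
  shows "f x = g x"
proof (rule ccontr)
  assume ne: "f x \<noteq> g x"
  have o: "open {x. f x \<noteq> g x}" using assms(1,2) by (rule open_Collect_neq)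
  then obtain e where e: "e > 0" "ball x e \<subseteq> {x. f x \<noteq> g x}" using ne by (auto simp: open_contains_ball)
  have "AE y in lborel. y \<notin> ball x e" using ae e(2) by (auto elim!: eventually_mono)
  then have "ball x e \<in> null_sets lborel" by (subst AE_iff_null_sets) auto
  then have "emeasure lborel (ball x e) = 0" by auto
  then show False using e(1) unit_ball_vol_pos[of "real DIM('a)"] by (simp add: emeasure_ball del: unit_ball_vol_pos)
qed

text \<open>The levels \<open>F (- s)\<close> translate superlevel sets of the profiles into those
  of \<open>- \<psi> - |v|^2 / 2\<close>, so Abel inversion applies to \<open>- \<psi>\<close>. It
  determines only the positive part of \<open>- \<psi>\<close>, which suffices because
  \<open>F\<close> vanishes on the positive half-line; continuity removes the null set.\<close>

lemma equimeasurable_profiles_equal: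
  fixes F :: "real \<Rightarrow> real" and \<psi>0 \<psi>1 :: "R3 \<Rightarrow> real"
  assumes anti: "strict_antimono_on {..0} F" and F0: "F ` {0..} = {0}"
    and cont: "continuous_on UNIV \<psi>0" "continuous_on UNIV \<psi>1"
    and mono: "\<And>x y. norm x \<le> norm y \<Longrightarrow> \<psi>0 x \<le> \<psi>0 y" "\<And>x y. norm x \<le> norm y \<Longrightarrow> \<psi>1 x \<le> \<psi>1 y"
    and bdd: "bounded {x. \<psi>0 x < 0}"
    and eq: "equimeasurable (\<lambda>(x, v). F ((norm v)\<^sup>2 / 2 + \<psi>0 x)) (\<lambda>(x, v). F ((norm v)\<^sup>2 / 2 + \<psi>1 x))"
  shows "(\<lambda>(x, v). F ((norm (v :: R3))\<^sup>2 / 2 + \<psi>0 x)) = (\<lambda>(x, v). F ((norm v)\<^sup>2 / 2 + \<psi>1 x))"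
proof -
  have m [measurable]: "\<psi>0 \<in> borel_measurable borel" "\<psi>1 \<in> borel_measurable borel"
    using cont by (auto intro: borel_measurable_continuous_onI)
  have Fp: "F u = 0" if "u \<ge> 0" for u using F0 that by auto
  have level: "F u > F (- s) \<longleftrightarrow> u < - s" and Fs: "F (- s) > 0" if s: "s > 0" for s u
  proof -
    have st: "F y < F x" if "x < y" "y \<le> 0" for x y
      using anti that by (auto simp: monotone_on_def)
    show "F (- s) > 0" using st[of "- s" 0] Fp[of 0] s by simp
    then show "F u > F (- s) \<longleftrightarrow> u < - s"
      using st[of u "- s"] st[of "- s" u] Fp[of u] s by (cases u "- s" rule: linorder_cases) (cases "u \<le> 0"; auto)+
  qed
  have set: "{z :: phase. - \<psi> (fst z) - (norm (snd z))\<^sup>2 / 2 > s} = {z. (\<lambda>(x, v). F ((norm v)\<^sup>2 / 2 + \<psi> x)) z > F (- s)}"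
    if "s > 0" for s and \<psi> :: "R3 \<Rightarrow> real"
  proof -
    have "- \<psi> x - (norm v)\<^sup>2 / 2 > s \<longleftrightarrow> F ((norm v)\<^sup>2 / 2 + \<psi> x) > F (- s)" for x v :: R3
      unfolding level[OF that] by auto
    then show ?thesis by (auto simp: case_prod_beta)
  qed
  have eq': "emeasure lborel {z :: phase. - \<psi>0 (fst z) - (norm (snd z))\<^sup>2 / 2 > s}
     = emeasure lborel {z :: phase. - \<psi>1 (fst z) - (norm (snd z))\<^sup>2 / 2 > s}" if "s > 0" for s
    unfolding set[OF that] using eq Fs[OF that] unfolding equimeasurable_def by blast
  have fin: "(\<integral>\<^sup>+x. ennreal ((max 0 (- \<psi>0 x - s))\<^sup>2) \<partial>lborel) < \<infinity>" if s: "s > 0" for s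
  proof -
    have "(\<integral>\<^sup>+x. ennreal ((max 0 (- \<psi>0 x - s))\<^sup>2) \<partial>lborel)
        \<le> (\<integral>\<^sup>+x. ennreal ((max 0 (- \<psi>0 0))\<^sup>2) * indicator {x. \<psi>0 x < 0} x \<partial>lborel)"
    proof (intro nn_integral_mono)
      fix x
      show "ennreal ((max 0 (- \<psi>0 x - s))\<^sup>2) \<le> ennreal ((max 0 (- \<psi>0 0))\<^sup>2) * indicator {x. \<psi>0 x < 0} x"
      proof (cases "\<psi>0 x < 0")
        case True
        have "max 0 (- \<psi>0 x - s) \<le> max 0 (- \<psi>0 0)" using mono(1)[of 0 x] s by simp
        then have "(max 0 (- \<psi>0 x - s))\<^sup>2 \<le> (max 0 (- \<psi>0 0))\<^sup>2" by (intro power_mono) auto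
        then show ?thesis using True by (simp add: ennreal_leI)
      next
        case False
        then have "max 0 (- \<psi>0 x - s) = 0" using s by simp
        then show ?thesis by simp
      qed
    qed
    also have "\<dots> = ennreal ((max 0 (- \<psi>0 0))\<^sup>2) * emeasure lborel {x. \<psi>0 x < 0}"
      by (rule nn_integral_cmult_indicator) simp
    also have "\<dots> < \<infinity>" using emeasure_bounded_finite[OF bdd] by (simp add: ennreal_mult_less_top)
    finally show ?thesis .
  qed
  have lev: "emeasure lborel {x. - \<psi>0 x > s} = emeasure lborel {x. - \<psi>1 x > s}" "emeasure lborel {x. - \<psi>0 x > s} < \<infinity>"
    if "s > 0" for s
    using superlevel_measures_eq[of "\<lambda>x. - \<psi>0 x" "\<lambda>x. - \<psi>1 x" s] eq' fin that by auto
  have "AE x in lborel. max 0 (- \<psi>0 x) = max 0 (- \<psi>1 x)"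
    by (rule radially_decreasing_unique) (use mono lev in \<open>auto simp: radially_decreasing_def\<close>)
  then have pt: "max 0 (- \<psi>0 x) = max 0 (- \<psi>1 x)" for x
    by (rule continuous_AE_eq[rotated 2]) (use cont in \<open>auto intro!: continuous_intros\<close>)
  have "F ((norm v)\<^sup>2 / 2 + \<psi>0 x) = F ((norm v)\<^sup>2 / 2 + \<psi>1 x)" for x v :: R3
  proof (cases "\<psi>0 x < 0")
    case True
    then have "\<psi>1 x = \<psi>0 x" using pt[of x] by (auto simp: max_def split: if_splits)
    then show ?thesis by simp
  next
    case False
    then have "\<psi>1 x \<ge> 0" using pt[of x] by (auto simp: max_def split: if_splits)
    then show ?thesis using False by (simp add: Fp)
  qed
  then show ?thesis by auto
qed

section \<open>Profiles of minimizers\<close>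

context casimir begin

text \<open>This supplies the finiteness that Abel inversion needs. For fixed \<open>z\<close> the
  admissible \<open>w\<close> form an interval of length 2 sqrt(2y) \<le> 1 + 2y, where y is the
  excess of \<open>dj (F z)\<close> over \<open>dj t\<close>. On that set 1 is at most
  \<open>F z / t\<close> and y at most \<open>q / t * j (F z)\<close>, both integrable.\<close>

lemma superlevel_fiber_bound:
  assumes F: "F \<in> energy_space j" and t: "t > 0"
  shows "(\<integral>\<^sup>+w. emeasure lborel {z. dj (F z) > dj t + w\<^sup>2 / 2} \<partial>lborel) < \<infinity>"
proof -
  note E = energy_spaceD[OF F]
  have djm [measurable]: "(\<lambda>z. dj (F z)) \<in> borel_measurable borel" using E(1,2) by (rule dj_comp_measurable)
  have [measurable]: "(\<lambda>z. dj (F z)) \<in> borel_measurable (borel \<Otimes>\<^sub>M borel)" using djm by (simp add: borel_prod)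
  define G where "G w z = (if dj (F z) > dj t + w\<^sup>2 / 2 then 1 else 0 :: ennreal)" for w :: real and z
  have 1: "emeasure lborel {z. dj (F z) > dj t + w\<^sup>2 / 2} = (\<integral>\<^sup>+z. G w z \<partial>lborel)" for w
  proof -
    have "{z. dj (F z) > dj t + w\<^sup>2 / 2} \<in> sets lborel" by measurable
    then have "emeasure lborel {z. dj (F z) > dj t + w\<^sup>2 / 2} = (\<integral>\<^sup>+z. indicator {z. dj (F z) > dj t + w\<^sup>2 / 2} z \<partial>lborel)"
      by simp
    also have "\<dots> = (\<integral>\<^sup>+z. G w z \<partial>lborel)" by (rule nn_integral_cong) (simp add: G_def indicator_def)
    finally show ?thesis .
  qed
  have 2: "(\<integral>\<^sup>+w. G w z \<partial>lborel) \<le> ennreal (F z / t + 2 * q / t * j (F z))" for z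
  proof (cases "dj (F z) > dj t")
    case True
    define y where "y = dj (F z) - dj t"
    have y: "y > 0" using True by (simp add: y_def)
    have Ft: "F z > t" using True dj_less_iff[of t "F z"] t E(2)[of z] by simp
    have b: "{w. w\<^sup>2 / 2 < y} = ball (0::real) (sqrt (2 * y))"
    proof (rule set_eqI)
      fix w :: real
      have "sqrt (w\<^sup>2) < sqrt (2 * y) \<longleftrightarrow> w\<^sup>2 < 2 * y" by (rule real_sqrt_less_iff)
      then show "w \<in> {w. w\<^sup>2 / 2 < y} \<longleftrightarrow> w \<in> ball 0 (sqrt (2 * y))"
        unfolding real_sqrt_abs by (simp add: dist_real_def) linarith
    qed
    have "(\<integral>\<^sup>+w. G w z \<partial>lborel) = (\<integral>\<^sup>+w. indicator {w. w\<^sup>2 / 2 < y} w \<partial>lborel)"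
      by (rule nn_integral_cong) (auto simp: G_def indicator_def y_def)
    also have "\<dots> = ennreal (2 * sqrt (2 * y))"
      unfolding b using y by (simp add: emeasure_ball)
    also have "\<dots> \<le> ennreal (F z / t + 2 * q / t * j (F z))"
    proof (rule ennreal_leI)
      have "2 * sqrt (2 * y) \<le> 1 + 2 * y"
        using sum_squares_bound[of 1 "sqrt (2 * y)"] y by simp
      moreover have "1 \<le> F z / t" using Ft t by simp
      moreover have "y \<le> q / t * j (F z)"
      proof -
        have "t * y \<le> t * dj (F z)" using t dj_nonneg[of t] by (simp add: y_def)
        also have "\<dots> \<le> F z * dj (F z)" using Ft dj_nonneg[OF E(2)] by (intro mult_right_mono) auto
        also have "\<dots> \<le> q * j (F z)" by (rule j_dj(2)[OF E(2)])
        finally show ?thesis using t by (simp add: field_simps)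
      qed
      ultimately show "2 * sqrt (2 * y) \<le> F z / t + 2 * q / t * j (F z)" by simp
    qed
    finally show ?thesis .
  next
    case False
    have "\<not> dj (F z) > dj t + w\<^sup>2 / 2" for w :: real using False zero_le_power2[of w] by linarith
    then have "G w z = 0" for w by (simp add: G_def)
    then show ?thesis by simp
  qed
  have "(\<integral>\<^sup>+w. emeasure lborel {z. dj (F z) > dj t + w\<^sup>2 / 2} \<partial>lborel) = (\<integral>\<^sup>+w. \<integral>\<^sup>+z. G w z \<partial>lborel \<partial>lborel)"
    by (simp only: 1)
  also have "\<dots> = (\<integral>\<^sup>+z. \<integral>\<^sup>+w. G w z \<partial>lborel \<partial>lborel)"
    by (rule lborel_pair.Fubini') (unfold G_def, measurable)
  also have "\<dots> \<le> (\<integral>\<^sup>+z. ennreal (F z / t + 2 * q / t * j (F z)) \<partial>lborel)"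
    by (intro nn_integral_mono 2)
  also have "\<dots> < \<infinity>"
  proof (rule integrable_nn_less_top)
    show "integrable lborel (\<lambda>z. F z / t + 2 * q / t * j (F z))" using E(3,4) by simp
    show "0 \<le> F z / t + 2 * q / t * j (F z)" for z using E(2) j_nonneg[OF E(2)] t q_gt by simp
  qed
  finally show ?thesis .
qed

text \<open>\<open>dj\<close> is an increasing bijection of the half-line, so equimeasurability
  passes from the functions to \<open>dj\<close> of them, whose superlevel sets are those of the
  Abel problem. The positive parts of \<open>h0\<close> and \<open>h1\<close> then agree, and they
  determine the functions since only nonnegative amounts are subtracted from them.\<close>

lemma profile_unique:
  assumes F: "F0 \<in> energy_space j" "F1 \<in> energy_space j"
    and m [measurable]: "h0 \<in> borel_measurable borel" "h1 \<in> borel_measurable borel"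
    and rad: "radially_decreasing h0" "radially_decreasing h1"
    and prof: "AE z in lborel. dj (F0 z) = max 0 (h0 (fst z) - (norm (snd z))\<^sup>2 / 2)"
      "AE z in lborel. dj (F1 z) = max 0 (h1 (fst z) - (norm (snd z))\<^sup>2 / 2)"
    and equi: "equimeasurable F0 F1"
  shows "AE z in lborel. F0 z = F1 z"
proof -
  have lev: "emeasure lborel {z :: phase. h (fst z) - (norm (snd z))\<^sup>2 / 2 > s} = emeasure lborel {z. dj (F z) > s}"
    if s: "s > 0" and F: "F \<in> energy_space j" and [measurable]: "h \<in> borel_measurable borel"
      and prof: "AE z in lborel. dj (F z) = max 0 (h (fst z) - (norm (snd z))\<^sup>2 / 2)" for s F and h :: "R3 \<Rightarrow> real"
  proof (rule emeasure_eq_AE)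
    have [measurable]: "(\<lambda>z. dj (F z)) \<in> borel_measurable borel"
      using energy_spaceD(1,2)[OF F] by (rule dj_comp_measurable)
    show "AE z in lborel. z \<in> {z :: phase. h (fst z) - (norm (snd z))\<^sup>2 / 2 > s} \<longleftrightarrow> z \<in> {z. dj (F z) > s}"
      using prof by eventually_elim (use s in \<open>auto simp: less_max_iff_disj\<close>)
    have "{z :: phase. h (fst z) - (norm (snd z))\<^sup>2 / 2 > s} \<in> sets borel" by measurable
    then show "{z :: phase. h (fst z) - (norm (snd z))\<^sup>2 / 2 > s} \<in> sets lborel" by simp
    have "{z. dj (F z) > s} \<in> sets borel" by measurable
    then show "{z. dj (F z) > s} \<in> sets lborel" by simp
  qed
  have eq: "emeasure lborel {z :: phase. h0 (fst z) - (norm (snd z))\<^sup>2 / 2 > s} = emeasure lborel {z :: phase. h1 (fst z) - (norm (snd z))\<^sup>2 / 2 > s}"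
    if s: "s > 0" for s
  proof -
    obtain t where t: "t \<ge> 0" "dj t = s" using dj_surj[of s] s by auto
    then have t0: "t > 0" using s by (cases "t = 0") auto
    have "{z. dj (F z) > s} = {z. F z > t}" if "F \<in> energy_space j" for F
      using dj_less_iff[OF t(1) energy_spaceD(2)[OF that]] t by auto
    then show ?thesis
      using equi t0 F unfolding lev[OF s F(1) m(1) prof(1)] lev[OF s F(2) m(2) prof(2)] equimeasurable_def by simp
  qed
  have fin: "(\<integral>\<^sup>+x. ennreal ((max 0 (h0 x - s))\<^sup>2) \<partial>lborel) < \<infinity>" if s: "s > 0" for s
  proof -
    obtain t where t: "t \<ge> 0" "dj t = s" using dj_surj[of s] s by auto
    then have t0: "t > 0" using s by (cases "t = 0") auto
    have p: "dj t + w\<^sup>2 / 2 > 0" for w :: real using s t by (simp add: add_pos_nonneg)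
    have "ennreal (4 * unit_ball_vol 4) * (\<integral>\<^sup>+x. ennreal ((max 0 (h0 x - s))\<^sup>2) \<partial>lborel)
       = (\<integral>\<^sup>+w. emeasure lborel {z. dj (F0 z) > dj t + w\<^sup>2 / 2} \<partial>lborel)"
      unfolding nn_integral_emeasure_superlevel[OF m(1), symmetric] t(2)[symmetric]
      by (simp only: lev[OF p F(1) m(1) prof(1)])
    also have "\<dots> < \<infinity>" by (rule superlevel_fiber_bound[OF F(1) t0])
    finally show ?thesis using unit_ball_vol_pos[of 4] by (auto simp: ennreal_mult_less_top simp del: unit_ball_vol_pos)
  qed
  have "AE x in lborel. max 0 (h0 x) = max 0 (h1 x)"
    by (rule radially_decreasing_unique[OF m rad superlevel_measures_eq[OF m eq fin]])
  from AE_lborel_fst[OF this, where 'b=R3] prof show ?thesis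
  proof eventually_elim
    case (elim z)
    have "max 0 (h0 (fst z) - c) = max 0 (h1 (fst z) - c)" if "c \<ge> 0" for c
      using elim(1) that by (auto simp: max_def split: if_splits)
    then have "dj (F0 z) = dj (F1 z)" using elim(2,3) by simp
    then show ?case using dj_inj energy_spaceD(2)[OF F(1)] energy_spaceD(2)[OF F(2)] by blast
  qed
qed

text \<open>With \<open>c\<^sup>2 = \<mu>\<close>, stretching velocities by \<open>c\<close> and
  positions by \<open>1 / c\<close> preserves measure and brings the multiplier in front of the
  kinetic term to 1; the translation puts the centre at the origin.\<close>

lemma minimizer_profile:
  assumes min: "is_min \<delta> \<kappa> f"
  obtains a :: R3 and c :: real and h where "c > 0" "h \<in> borel_measurable borel" "radially_decreasing h"
    "AE z in lborel. dj (rescale 1 a (1 / c) c f z) = max 0 (h (fst z) - (norm (snd z))\<^sup>2 / 2)"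
proof -
  have f: "f \<in> energy_space j" using min by (simp add: is_min_def)
  obtain A B \<mu> where AB: "A > 0" "\<mu> > 0" and el:
    "AE z in lborel. dj (f z) = max 0 (A * pot \<delta> \<kappa> (density f) (fst z) + B - (norm (snd z))\<^sup>2 / (2 * \<mu>))"
    using euler_lagrange[OF min] by blast
  obtain a where a: "radially_decreasing (\<lambda>x. pot \<delta> \<kappa> (density f) (a + x))"
    using potential_radial[OF min] by blast
  have [measurable]: "density f \<in> borel_measurable borel" by (rule density_measurable[OF energy_spaceD(1)[OF f]])
  define c where "c = sqrt \<mu>"
  have c: "c > 0" "c\<^sup>2 = \<mu>" using AB by (auto simp: c_def)
  define h where "h x = A * pot \<delta> \<kappa> (density f) (a + (1 / c) *\<^sub>R x) + B" for x
  have hm: "h \<in> borel_measurable borel" unfolding h_def[abs_def] by measurable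
  have "radially_decreasing h"
    unfolding radially_decreasing_def
  proof (intro allI impI)
    fix x y :: R3 assume xy: "x \<noteq> 0 \<and> norm x \<le> norm y"
    have "norm ((1 / c) *\<^sub>R x) \<le> norm ((1 / c) *\<^sub>R y)" "(1 / c) *\<^sub>R x \<noteq> 0"
      using xy c by (auto simp: divide_right_mono)
    then show "h y \<le> h x" using a AB unfolding h_def radially_decreasing_def by auto
  qed
  moreover have "AE z in lborel. dj (rescale 1 a (1 / c) c f z) = max 0 (h (fst z) - (norm (snd z))\<^sup>2 / 2)"
  proof -
    have "AE z in lborel. dj (f (a + (1 / c) *\<^sub>R fst z, c *\<^sub>R snd z))
       = max 0 (A * pot \<delta> \<kappa> (density f) (a + (1 / c) *\<^sub>R fst z) + B - (norm (c *\<^sub>R snd z))\<^sup>2 / (2 * \<mu>))"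
      using scales_AE[OF scales_phase_affine[of "1 / c" c a] el] c by simp
    then show ?thesis
    proof eventually_elim
      case (elim z)
      have "(norm (c *\<^sub>R snd z))\<^sup>2 / (2 * \<mu>) = (norm (snd z))\<^sup>2 / 2"
        using c AB by (simp add: power_mult_distrib)
      then show ?case using elim by (simp add: rescale_def h_def)
    qed
  qed
  ultimately show ?thesis using that c hm by blast
qed

lemma emeasure_superlevel_rescale:
  assumes f: "f \<in> borel_measurable borel" and c: "c > 0"
  shows "emeasure lborel {z. rescale 1 a (1 / c) c f z > t} = emeasure lborel {z. f z > t}"
proof -
  have m: "{z. f z > t} \<in> sets borel" using f by measurable
  have "(\<lambda>z::phase. (a + (1 / c) *\<^sub>R fst z, c *\<^sub>R snd z)) -` {z. f z > t} = {z. rescale 1 a (1 / c) c f z > t}"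
    by (auto simp: rescale_def)
  then show ?thesis
    using scales_emeasure[OF scales_phase_affine[of "1 / c" c a] m] c by (simp add: power_divide)
qed

text \<open>The normalized minimizers coincide by \<open>profile_unique\<close>. Undoing the
  normalization of the second leaves a translation and the scale \<open>b = c1 / c0\<close>, the
  square root of the ratio of the two multipliers.\<close>

lemma minimizers_equal_up_to_scaling:
  assumes min: "is_min \<delta> \<kappa> f0" "is_min \<delta> \<kappa> f1" and equi: "equimeasurable f0 f1"
  obtains y b where "b > 0" "AE z in lborel. f1 z = rescale 1 y b (1 / b) f0 z"
proof -
  have f: "f0 \<in> energy_space j" "f1 \<in> energy_space j" using min by (auto simp: is_min_def)
  obtain a0 c0 h0 where p0: "c0 > 0" "h0 \<in> borel_measurable borel" "radially_decreasing h0"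
    "AE z in lborel. dj (rescale 1 a0 (1 / c0) c0 f0 z) = max 0 (h0 (fst z) - (norm (snd z))\<^sup>2 / 2)"
    using minimizer_profile[OF min(1)] by blast
  obtain a1 c1 h1 where p1: "c1 > 0" "h1 \<in> borel_measurable borel" "radially_decreasing h1"
    "AE z in lborel. dj (rescale 1 a1 (1 / c1) c1 f1 z) = max 0 (h1 (fst z) - (norm (snd z))\<^sup>2 / 2)"
    using minimizer_profile[OF min(2)] by blast
  have c: "1 / c0 > 0" "1 / c1 > 0" using p0(1) p1(1) by auto
  have eq: "equimeasurable (rescale 1 a0 (1 / c0) c0 f0) (rescale 1 a1 (1 / c1) c1 f1)"
    using equi emeasure_superlevel_rescale[OF energy_spaceD(1)[OF f(1)] p0(1)] emeasure_superlevel_rescale[OF energy_spaceD(1)[OF f(2)] p1(1)]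
    unfolding equimeasurable_def by simp
  have "AE z in lborel. rescale 1 a0 (1 / c0) c0 f0 z = rescale 1 a1 (1 / c1) c1 f1 z"
    by (rule profile_unique[OF rescale_facts(1)[OF f(1) zero_less_one c(1) p0(1)] rescale_facts(1)[OF f(2) zero_less_one c(2) p1(1)]
          p0(2) p1(2) p0(3) p1(3) p0(4) p1(4) eq])
  from scales_AE[OF scales_phase_affine[of c1 "1 / c1" "- c1 *\<^sub>R a1"] this]
  have "AE z in lborel. rescale 1 a0 (1 / c0) c0 f0 (- c1 *\<^sub>R a1 + c1 *\<^sub>R fst z, (1 / c1) *\<^sub>R snd z)
     = rescale 1 a1 (1 / c1) c1 f1 (- c1 *\<^sub>R a1 + c1 *\<^sub>R fst z, (1 / c1) *\<^sub>R snd z)"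
    using p1(1) by simp
  then have "AE z in lborel. f1 z = rescale 1 (a0 - (c1 / c0) *\<^sub>R a1) (c1 / c0) (1 / (c1 / c0)) f0 z"
  proof eventually_elim
    case (elim z)
    have "rescale 1 a1 (1 / c1) c1 f1 (- c1 *\<^sub>R a1 + c1 *\<^sub>R fst z, (1 / c1) *\<^sub>R snd z) = f1 z"
      using p1(1) by (simp add: rescale_def scaleR_add_right scaleR_diff_right)
    moreover have "rescale 1 a0 (1 / c0) c0 f0 (- c1 *\<^sub>R a1 + c1 *\<^sub>R fst z, (1 / c1) *\<^sub>R snd z)
       = rescale 1 (a0 - (c1 / c0) *\<^sub>R a1) (c1 / c0) (1 / (c1 / c0)) f0 z"
      by (simp add: rescale_def scaleR_add_right scaleR_diff_right algebra_simps)
    ultimately show ?case using elim by simp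
  qed
  moreover have "c1 / c0 > 0" using p0 p1 by simp
  ultimately show ?thesis using that by blast
qed

section \<open>Energies along the scaling and the two cases of the theorem\<close>

lemma energies_AE_cong:
  assumes f: "f \<in> energy_space j" and g: "g \<in> energy_space j" and ae: "AE z in lborel. f z = g z"
  shows "kinetic f = kinetic g" "EpotP f = EpotP g" "EpotM f = EpotM g"
proof -
  note [measurable] = energy_spaceD(1)[OF f] energy_spaceD(1)[OF g]
  show "kinetic f = kinetic g"
    unfolding kinetic_eq[OF f] kinetic_eq[OF g]
    by (rule integral_cong_AE) (measurable, use ae in \<open>auto elim: eventually_mono\<close>)
  have [measurable]: "f \<in> borel_measurable (borel \<Otimes>\<^sub>M borel)" "g \<in> borel_measurable (borel \<Otimes>\<^sub>M borel)"
    by (simp_all add: borel_prod)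
  have "AE x in lborel. AE v in lborel. f (x, v) = g (x, v)"
    by (rule lborel_pair.AE_pair) (unfold lborel_prod, rule ae)
  then have "AE x in lborel. density f x = density g x"
  proof eventually_elim
    case (elim x)
    then show ?case unfolding density_def by (intro integral_cong_AE) auto
  qed
  then show "EpotP f = EpotP g" "EpotM f = EpotM g"
    unfolding Epot_eq(1,2)[OF f] Epot_eq(1,2)[OF g]
    by (intro interact_AE_cong density_measurable; simp)+
qed

lemma scaled_energies:
  assumes f: "f \<in> energy_space j" and b: "b > 0"
  shows "kinetic (rescale 1 y b (1 / b) f) = b\<^sup>2 * kinetic f" "EpotP (rescale 1 y b (1 / b) f) = b * EpotP f"
    "EpotM (rescale 1 y b (1 / b) f) = b\<^sup>2 * EpotM f"
  using rescale_facts(4)[OF f zero_less_one b, of "1 / b" y] Epot_rescale[OF f zero_less_one b, of "1 / b" y] b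
  by (simp_all add: field_simps eval_nat_numeral)

lemma scaled_Hamiltonian:
  assumes "f \<in> energy_space j" "b > 0"
  shows "Hamiltonian \<delta> \<kappa> (rescale 1 y b (1 / b) f) = b\<^sup>2 * (kinetic f - \<kappa> * EpotM f) - b * (\<delta> * EpotP f)"
  by (simp add: Hamiltonian_def Epot_def scaled_energies[OF assms] algebra_simps)

lemma translation_if_unscaled:
  assumes "AE z in lborel. f1 z = rescale 1 y 1 (1 / 1) f0 z"
  shows "equal_up_to_translation f0 f1"
  unfolding equal_up_to_translation_def
proof
  show "AE (x, v) in lborel. f1 (x, v) = f0 (x - (- y), v)"
    using assms by eventually_elim (auto simp: rescale_def add.commute)
qed

text \<open>
  Along the scaling \<open>b \<mapsto> f (b x, v / b)\<close> the Hamiltonian is quadratic in \<open>b\<close>; having two minimum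
  points it would be constant, whereas its linear coefficient does not vanish.
\<close>

lemma poisson_manev_case:
  assumes "\<delta> > 0" "\<kappa> \<ge> 0" "M1 > 0"
    and min: "minimizes_I \<delta> \<kappa> j M1 Mj f0" "minimizes_I \<delta> \<kappa> j M1 Mj f1" and equi: "equimeasurable f0 f1"
  shows "equal_up_to_translation f0 f1"
proof -
  have im: "is_min \<delta> \<kappa> f0" "is_min \<delta> \<kappa> f1" using is_min_I min assms by auto
  have f: "f0 \<in> energy_space j" "f1 \<in> energy_space j" using im by (auto simp: is_min_def)
  obtain y b where b: "b > 0" and ae: "AE z in lborel. f1 z = rescale 1 y b (1 / b) f0 z"
    using minimizers_equal_up_to_scaling[OF im equi] by blast
  have bp: "1 / b > 0" using b by simp
  define A where "A = kinetic f0 - \<kappa> * EpotM f0"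
  define D where "D = \<delta> * EpotP f0"
  have D: "D > 0" using EpotP_pos[OF f(1)] im assms by (simp add: is_min_def D_def)
  have H: "Hamiltonian \<delta> \<kappa> (rescale 1 y \<beta> (1 / \<beta>) f0) = \<beta>\<^sup>2 * A - \<beta> * D" if "\<beta> > 0" for \<beta>
    unfolding A_def D_def by (rule scaled_Hamiltonian[OF f(1) that])
  have H0: "Hamiltonian \<delta> \<kappa> f0 = A - D" by (simp add: Hamiltonian_def Epot_def A_def D_def)
  have Hle: "Hamiltonian \<delta> \<kappa> f0 \<le> Hamiltonian \<delta> \<kappa> (rescale 1 y \<beta> (1 / \<beta>) f0)" if \<beta>: "\<beta> > 0" for \<beta>
  proof -
    have \<beta>': "1 / \<beta> > 0" using \<beta> by simp
    note S = rescale_facts[OF f(1) zero_less_one \<beta> \<beta>', of y]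
    have "(LINT z|lborel. rescale 1 y \<beta> (1 / \<beta>) f0 z) = (LINT z|lborel. f0 z)"
      "(LINT z|lborel. j (rescale 1 y \<beta> (1 / \<beta>) f0 z)) = (LINT z|lborel. j (f0 z))"
      using S(2,3) \<beta> by (simp_all add: power_divide)
    then show ?thesis using im(1) S(1) by (simp add: is_min_def)
  qed
  have low: "A - D \<le> \<beta>\<^sup>2 * A - \<beta> * D" if "\<beta> > 0" for \<beta>
    using Hle[OF that] unfolding H[OF that] H0 .
  have "Hamiltonian \<delta> \<kappa> f1 = Hamiltonian \<delta> \<kappa> (rescale 1 y b (1 / b) f0)"
    using energies_AE_cong[OF f(2) rescale_facts(1)[OF f(1) zero_less_one b bp] ae] by (simp add: Hamiltonian_def Epot_def)
  moreover have "ereal (Hamiltonian \<delta> \<kappa> f0) = ereal (Hamiltonian \<delta> \<kappa> f1)"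
    using min by (simp add: minimizes_I_def)
  ultimately have eqb: "b\<^sup>2 * A - b * D = A - D"
    using H[OF b] H0 by simp
  have "b = 1"
  proof (rule ccontr)
    assume ne: "b \<noteq> 1"
    have "(b - 1) * ((b + 1) * A - D) = 0" using eqb by (simp add: algebra_simps power2_eq_square)
    then have AD: "(b + 1) * A = D" using ne by simp
    then have A: "A > 0" using D b by (metis add_pos_pos zero_less_mult_pos zero_less_one)
    \<comment> \<open>With \<open>D = (b + 1) * A\<close> the energy at scale \<beta> exceeds that
      at 1 by A (\<beta> - 1)(\<beta> - b). As \<open>A\<close> is positive this is negative between
      1 and b; the midpoint is taken.\<close>
    have "A - D \<le> ((1 + b) / 2)\<^sup>2 * A - (1 + b) / 2 * D" using b by (intro low) simp
    then have "(b - 1)\<^sup>2 * A \<le> 0"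
      unfolding AD[symmetric] by (simp add: power2_eq_square field_simps)
    then show False using A ne by (simp add: mult_le_0_iff)
  qed
  then show ?thesis using translation_if_unscaled ae by simp
qed

text \<open>With the minimal ratio as \<open>\<kappa>\<close> the Hamiltonian is zero along the
  whole scaling orbit and cannot select \<open>b\<close>. The kinetic energy is multiplied by
  \<open>b\<^sup>2\<close>, so its equality does.\<close>

lemma pure_manev_case:
  assumes "M1 > 0"
    and min: "minimizes_J j M1 Mj f0" "minimizes_J j M1 Mj f1" and equi: "equimeasurable f0 f1"
    and kin: "kinetic f0 = kinetic f1"
  shows "equal_up_to_translation f0 f1"
proof -
  have "ereal (kinetic f0 / EpotM f0) = ereal (kinetic f1 / EpotM f1)"
    using is_min_J(2)[OF min(1) assms(1)] is_min_J(2)[OF min(2) assms(1)] by simp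
  then have im: "is_min 0 (kinetic f0 / EpotM f0) f0" "is_min 0 (kinetic f0 / EpotM f0) f1"
    using is_min_J(1)[OF min(1) assms(1)] is_min_J(1)[OF min(2) assms(1)] by auto
  have f: "f0 \<in> energy_space j" "f1 \<in> energy_space j" using im by (auto simp: is_min_def)
  obtain y b where b: "b > 0" and ae: "AE z in lborel. f1 z = rescale 1 y b (1 / b) f0 z"
    using minimizers_equal_up_to_scaling[OF im equi] by blast
  have bp: "1 / b > 0" using b by simp
  have "kinetic f1 = b\<^sup>2 * kinetic f0"
    using energies_AE_cong(1)[OF f(2) rescale_facts(1)[OF f(1) zero_less_one b bp] ae] scaled_energies(1)[OF f(1) b] by simp
  moreover have "kinetic f0 > 0" using kinetic_pos[OF f(1)] im(1) by (simp add: is_min_def)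
  ultimately have "b\<^sup>2 = 1" using kin by simp
  then have "b = 1" using b by (simp add: power2_eq_1_iff)
  then show ?thesis using translation_if_unscaled ae by simp
qed

end

theorem lemma1p2:
  "(\<forall>(F :: real \<Rightarrow> real) (\<psi>0 :: R3 \<Rightarrow> real) (\<psi>1 :: R3 \<Rightarrow> real) (Q0 :: phase \<Rightarrow> real) (Q1 :: phase \<Rightarrow> real).
      continuous_on UNIV F \<and> (\<forall>s. F s \<ge> 0) \<and> strict_antimono_on {..0} F \<and>
      F ` {..0} = {0..} \<and> F ` {0..} = {0} \<and>
      continuous_on UNIV \<psi>0 \<and> continuous_on UNIV \<psi>1 \<and>
      (\<forall>x y. norm x = norm y \<longrightarrow> \<psi>0 x = \<psi>0 y) \<and> (\<forall>x y. norm x = norm y \<longrightarrow> \<psi>1 x = \<psi>1 y) \<and>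
      (\<forall>x y. norm x \<le> norm y \<longrightarrow> \<psi>0 x \<le> \<psi>0 y) \<and> (\<forall>x y. norm x \<le> norm y \<longrightarrow> \<psi>1 x \<le> \<psi>1 y) \<and>
      bounded {x. \<psi>0 x < 0} \<and> bounded {x. \<psi>1 x < 0} \<and>
      Q0 = (\<lambda>(x, v). F ((norm v)\<^sup>2 / 2 + \<psi>0 x)) \<and>
      Q1 = (\<lambda>(x, v). F ((norm v)\<^sup>2 / 2 + \<psi>1 x)) \<and>
      equimeasurable Q0 Q1
      \<longrightarrow> Q0 = Q1)
   \<and>
   (\<forall>(j :: real \<Rightarrow> real) (p :: real) (q :: real). H1 j \<and> H2 j p q \<longrightarrow>
      (\<forall>(\<delta> :: real) (\<kappa> :: real) (M1 :: real) (Mj :: real) f0 f1.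
         \<delta> > 0 \<and> \<kappa> \<ge> 0 \<and> M1 > 0 \<and> Mj > 0 \<and>
         \<kappa> * M1 powr ((p - 3) / (3 * (p - 1))) * (M1 + Mj) powr (2 / (3 * (p - 1))) < KjM j p \<and>
         steady_state \<delta> \<kappa> f0 \<and> steady_state \<delta> \<kappa> f1 \<and>
         minimizes_I \<delta> \<kappa> j M1 Mj f0 \<and> minimizes_I \<delta> \<kappa> j M1 Mj f1 \<and>
         equimeasurable f0 f1
         \<longrightarrow> equal_up_to_translation f0 f1)
      \<and>
      (\<forall>(M1 :: real) (Mj :: real) f0 f1.
         M1 > 0 \<and> Mj > 0 \<and>
         steady_state 0 1 f0 \<and> steady_state 0 1 f1 \<and>
         minimizes_J j M1 Mj f0 \<and> minimizes_J j M1 Mj f1 \<and>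
         equimeasurable f0 f1 \<and> kinetic f0 = kinetic f1
         \<longrightarrow> equal_up_to_translation f0 f1))"
proof (intro conjI allI impI; elim conjE)
  fix F :: "real \<Rightarrow> real" and \<psi>0 \<psi>1 :: "R3 \<Rightarrow> real" and Q0 Q1 :: "phase \<Rightarrow> real"
  assume A: "strict_antimono_on {..0} F" "F ` {0..} = {0}" "continuous_on UNIV \<psi>0" "continuous_on UNIV \<psi>1"
    and mono: "\<forall>x y. norm x \<le> norm y \<longrightarrow> \<psi>0 x \<le> \<psi>0 y" "\<forall>x y. norm x \<le> norm y \<longrightarrow> \<psi>1 x \<le> \<psi>1 y"
    and bdd: "bounded {x. \<psi>0 x < 0}"
    and Q: "Q0 = (\<lambda>(x, v). F ((norm v)\<^sup>2 / 2 + \<psi>0 x))" "Q1 = (\<lambda>(x, v). F ((norm v)\<^sup>2 / 2 + \<psi>1 x))"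
    and eq: "equimeasurable Q0 Q1"
  show "Q0 = Q1"
    unfolding Q by (rule equimeasurable_profiles_equal[OF A _ _ bdd eq[unfolded Q]]) (use mono in auto)
next
  fix j :: "real \<Rightarrow> real" and p q \<delta> \<kappa> M1 Mj :: real and f0 f1 :: "phase \<Rightarrow> real"
  assume "H1 j" "H2 j p q" and A: "\<delta> > 0" "\<kappa> \<ge> 0" "M1 > 0"
    "minimizes_I \<delta> \<kappa> j M1 Mj f0" "minimizes_I \<delta> \<kappa> j M1 Mj f1" "equimeasurable f0 f1"
  then interpret casimir j p q by unfold_locales
  show "equal_up_to_translation f0 f1" by (rule poisson_manev_case[OF A])
next
  fix j :: "real \<Rightarrow> real" and p q M1 Mj :: real and f0 f1 :: "phase \<Rightarrow> real"
  assume "H1 j" "H2 j p q" and A: "M1 > 0" "minimizes_J j M1 Mj f0" "minimizes_J j M1 Mj f1"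
    "equimeasurable f0 f1" "kinetic f0 = kinetic f1"
  then interpret casimir j p q by unfold_locales
  show "equal_up_to_translation f0 f1" by (rule pure_manev_case[OF A])
qed

end
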